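(* Assume the setting and Assumptions 1, 2 and 3 described in the context, and suppose in addition that $\theta<r_B$. Then there exists $\varepsilon_0>0$ such that for each $l=0,1,\dots,\tau-1$, as $n\to\infty$, \[ \bar x(n\tau+l)=\theta^{-n\tau-l}\,c_l+O\big((\theta+\varepsilon_0)^{-(n\tau+l)}\big)e^{\rm t}, \] where \[ c_l=\sum_{\nu=0}^{\tau-1}\frac{1}{(\omega_\tau^{\nu})^{l}}\, \frac{\big[x(0)B^*(\theta\omega_\tau^\nu)-x(1)A(0)\big]\Delta_M(\omega_\tau^\nu)v(\theta)}{(\theta\omega_\tau^\nu-1)\big\{\frac{d}{dy}\delta(A^*(y))|_{y=\theta}-1\big\}}\cdot\mu(\theta)\Delta_M(\omega_\tau^\nu)^{-1}, \] and $c_l>0$ (componentwise) for every $l=0,1,\dots,\tau-1$.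
   Context: Let $M_0,M$ be positive integers. Consider a discrete-time Markov chain $\{(X_n,S_n)\}_{n\ge0}$ of M/G/1 type with state space $\{(0,j):1\le j\le M_0\}\cup\{(k,j):k\ge1,1\le j\le M\}$ (the states with first coordinate $k$ form level $k$), whose transition matrix, with states in lexicographic order, is \[ T=\begin{pmatrix}B(0)&B(1)&B(2)&B(3)&\cdots\\ C(0)&A(1)&A(2)&A(3)&\cdots\\ O&A(0)&A(1)&A(2)&\cdots\\ O&O&A(0)&A(1)&\cdots\\ \vdots&\vdots&\vdots&\vdots&\ddots\end{pmatrix}, \] where $A(k)$ ($k\ge0$) are nonnegative $M\times M$ matrices, $B(0)$ is nonnegative $M_0\times M_0$, $B(k)$ ($k\ge1$) are nonnegative $M_0\times M$, $C(0)$ is nonnegative $M\times M_0$. Let $A=\sum_{k\ge0}A(k)$ (assumed stochastic), $B=\sum_{k\ge1}B(k)$ with $B(0)e+Be=e$, where $e$ is a column vector of ones; let $\pi$ be a row vector with $\pi A=\pi$, $\pi e=1$. Let $A^*(z)=\sum_{k\ge0}z^kA(k)$, $B^*(z)=\sum_{k\ge1}z^kB(k)$, with convergence radii $r_A,r_B$ (the convergence radius of $\sum_k z^kY(k)$, $Y(k)\ge0$, is $\sup\{y>0:\sum_k y^kY(k)<\infty\}$). Put $\Gamma_A^*(z)=z^{-1}A^*(z)$. Assumption 1: (a) $T$ is irreducible; (b) $A$ is irreducible; (c) $\rho:=\pi\sum_{k\ge1}kA(k)e<1$; (d) $\sum_{k\ge1}kB(k)e$ is finite. Assumption 2: $r_A>1$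 and $r_B>1$. For a square complex matrix $X$, $\delta(X)$ denotes a maximum-modulus eigenvalue of $X$ with nonnegative argument whose real part is not less than those of the other maximum-modulus eigenvalues (for $X$ nonnegative irreducible it is the Perron–Frobenius eigenvalue). Assumption 3: there is a finite $\theta$ with $1<\theta<r_A$ and $\theta=\delta(A^*(\theta))$. Under these assumptions the chain has a unique stationary probability vector $x=(x(0),x(1),x(2),\dots)$ partitioned by levels; $\bar x(k)=\sum_{l\ge k+1}x(l)$. Let $\mu(\theta)$, $v(\theta)$ be the Perron–Frobenius left and right eigenvectors of $\Gamma_A^*(\theta)$ (eigenvalue $1$), normalized by $\mu(\theta)e=1$, $\mu(\theta)v(\theta)=1$. Period $\tau$: consider the Markov additive process on $\mathbb Z\times\{1,\dots,M\}$ moving from $(k_0,i)$ to $(k_0+k,j)$ with probability $[\Gamma_A(k)]_{i,j}$, where $\Gamma_A(k)=A(k+1)$ for $k\ge-1$ and $\Gamma_A(k)=O$ for $k\le-2$. Write $(k_1,j_1)\to(k_2,j_2)$ if $(k_2,j_2)$ is reached from $(k_1,j_1)$ with positive probability in some positive number of steps. $\tau$ is the common value over $j$ of $\gcd\{k\neq0:(0,j)\to(k,j)\}$. Fix a function $p:\{1,\dots,M\}\to\{0,\dots,\tau-1\}$ such that $[\Gamma_A(k)]_{i,j}>0$ only if $k\equiv p(j)-p(i)\pmod\tau$ (such a function exists), and let $\Delta_M(z)=\mathrm{diag}(z^{-p(1)},\dots,z^{-p(M)})$. Finally $\omega_x=\exp(2\pi\iota/x)$, $\iota=\sqrt{-1}$,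 superscript ${\rm t}$ denotes transpose, and $O(g(k))e^{\rm t}$ denotes a row vector whose entries are $O(g(k))$. *)

theory Defs
  imports "HOL-Analysis.Analysis" "HOL-Library.Landau_Symbols"
begin

text \<open>Conventions. Phases are indexed from 0: level 0 has phases 0..<M0, levels k>=1 have
phases 0..<M. Matrices are functions of (row, column); a matrix sequence Y(k) is a
function nat => nat => nat => real. States of the chain are pairs (level, phase).\<close>

section \<open>Matrix notions\<close>

definition state_space :: "nat \<Rightarrow> nat \<Rightarrow> (nat \<times> nat) set" where
  "state_space M0 M = {(0, j) | j. j < M0} \<union> {(k, j) | k j. 1 \<le> k \<and> j < M}"

text \<open>The transition matrix T of the M/G/1-type chain. Bk k is B(k) for k >= 1 (Bk 0 unused).\<close>
definition mg1_T :: "(nat \<Rightarrow> nat \<Rightarrow> real) \<Rightarrow> (nat \<Rightarrow> nat \<Rightarrow> nat \<Rightarrow> real) \<Rightarrow>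
    (nat \<Rightarrow> nat \<Rightarrow> real) \<Rightarrow> (nat \<Rightarrow> nat \<Rightarrow> nat \<Rightarrow> real) \<Rightarrow>
    nat \<times> nat \<Rightarrow> nat \<times> nat \<Rightarrow> real" where
  "mg1_T B0 Bk C0 A s t =
     (case s of (k, i) \<Rightarrow> case t of (k', j) \<Rightarrow>
       (if k = 0 then (if k' = 0 then B0 i j else Bk k' i j)
        else if k' = 0 then (if k = 1 then C0 i j else 0)
        else if k \<le> k' + 1 then A (k' + 1 - k) i j else 0))"

text \<open>Irreducibility of a (possibly infinite) nonnegative matrix on a state set:
every state reaches every state via positive entries.\<close>
definition irreducible_on :: "'s set \<Rightarrow> ('s \<Rightarrow> 's \<Rightarrow> real) \<Rightarrow> bool" where
  "irreducible_on S P \<longleftrightarrow>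
     (\<forall>s\<in>S. \<forall>t\<in>S. (s, t) \<in> {(a, b). a \<in> S \<and> b \<in> S \<and> P a b > 0}\<^sup>*)"

text \<open>Entrywise sum A = sum_k A(k).\<close>
definition msum :: "(nat \<Rightarrow> nat \<Rightarrow> nat \<Rightarrow> real) \<Rightarrow> nat \<Rightarrow> nat \<Rightarrow> real" where
  "msum Y i j = (\<Sum>k. Y k i j)"

text \<open>Convergence radius of sum_k z^k Y(k) for an m x n matrix sequence Y(k) >= 0
(extended real, may be infinite).\<close>
definition conv_radius_mat :: "(nat \<Rightarrow> nat \<Rightarrow> nat \<Rightarrow> real) \<Rightarrow> nat \<Rightarrow> nat \<Rightarrow> ereal" where
  "conv_radius_mat Y m n =
     Sup {ereal y | y. y > 0 \<and> (\<forall>i<m. \<forall>j<n. summable (\<lambda>k. y ^ k * Y k i j))}"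

text \<open>Generating function A*(z) = sum_{k>=0} z^k A(k) at complex z.\<close>
definition Astar :: "(nat \<Rightarrow> nat \<Rightarrow> nat \<Rightarrow> real) \<Rightarrow> complex \<Rightarrow> nat \<Rightarrow> nat \<Rightarrow> complex" where
  "Astar A z i j = (\<Sum>k. z ^ k * complex_of_real (A k i j))"

text \<open>A*(y) at a real argument y (real matrix).\<close>
definition AstarR :: "(nat \<Rightarrow> nat \<Rightarrow> nat \<Rightarrow> real) \<Rightarrow> real \<Rightarrow> nat \<Rightarrow> nat \<Rightarrow> real" where
  "AstarR A y i j = (\<Sum>k. y ^ k * A k i j)"

text \<open>Generating function B*(z) = sum_{k>=1} z^k B(k) at complex z.\<close>
definition Bstar :: "(nat \<Rightarrow> nat \<Rightarrow> nat \<Rightarrow> real) \<Rightarrow> complex \<Rightarrow> nat \<Rightarrow> nat \<Rightarrow> complex" where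
  "Bstar Bk z i j = (\<Sum>k. if k = 0 then 0 else z ^ k * complex_of_real (Bk k i j))"

text \<open>Eigenvalues of an M x M complex matrix.\<close>
definition is_eigenvalue :: "nat \<Rightarrow> (nat \<Rightarrow> nat \<Rightarrow> complex) \<Rightarrow> complex \<Rightarrow> bool" where
  "is_eigenvalue M X lam \<longleftrightarrow>
     (\<exists>v. (\<exists>i<M. v i \<noteq> 0) \<and> (\<forall>i<M. (\<Sum>j<M. X i j * v j) = lam * v i))"

text \<open>delta(X): the maximum-modulus eigenvalue with nonnegative argument (argument in
(-pi,pi], i.e. Im >= 0) whose real part is not less than those of the other
maximum-modulus eigenvalues.\<close>
definition delta :: "nat \<Rightarrow> (nat \<Rightarrow> nat \<Rightarrow> complex) \<Rightarrow> complex" where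
  "delta M X = (THE lam. is_eigenvalue M X lam
       \<and> (\<forall>\<nu>. is_eigenvalue M X \<nu> \<longrightarrow> norm \<nu> \<le> norm lam)
       \<and> Im lam \<ge> 0
       \<and> (\<forall>\<nu>. is_eigenvalue M X \<nu> \<and> norm \<nu> = norm lam \<longrightarrow> Re \<nu> \<le> Re lam))"

section \<open>Period of the Markov additive process\<close>

text \<open>One step (k0,i) -> (k0+k,j) with probability [Gamma_A(k)]_{ij} = A(k+1)_{ij}, k >= -1.\<close>
definition mad_step :: "(nat \<Rightarrow> nat \<Rightarrow> nat \<Rightarrow> real) \<Rightarrow> nat \<Rightarrow> ((int \<times> nat) \<times> (int \<times> nat)) set" where
  "mad_step A M = {((k0, i), (k1, j)). i < M \<and> j < M \<and> k1 - k0 \<ge> -1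
                                      \<and> A (nat (k1 - k0 + 1)) i j > 0}"

text \<open>tau = gcd{k /= 0 : (0,j) -> (k,j)}, a common value over j; we take phase j = 0.\<close>
definition mad_period :: "(nat \<Rightarrow> nat \<Rightarrow> nat \<Rightarrow> real) \<Rightarrow> nat \<Rightarrow> nat" where
  "mad_period A M = nat (Gcd {k. k \<noteq> 0 \<and> ((0, 0), (k, 0)) \<in> (mad_step A M)\<^sup>+})"

section \<open>Stationary vector and tail sums\<close>

definition stationary_prob :: "(nat \<times> nat) set \<Rightarrow> (nat \<times> nat \<Rightarrow> nat \<times> nat \<Rightarrow> real)
    \<Rightarrow> (nat \<times> nat \<Rightarrow> real) \<Rightarrow> bool" where
  "stationary_prob S P x \<longleftrightarrow>
     (\<forall>s\<in>S. x s \<ge> 0) \<and> (x has_sum 1) S \<and>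
     (\<forall>t\<in>S. ((\<lambda>s. x s * P s t) has_sum x t) S)"

text \<open>xbar(k) = sum_{l >= k+1} x(l), phase j.\<close>
definition xbar :: "(nat \<times> nat \<Rightarrow> real) \<Rightarrow> nat \<Rightarrow> nat \<Rightarrow> real" where
  "xbar x k j = (\<Sum>m. x (k + 1 + m, j))"

text \<open>omega_n = exp(2 pi i / n).\<close>
definition omega :: "nat \<Rightarrow> complex" where
  "omega n = cis (2 * pi / real n)"

text \<open>The vector c_l of the theorem (phase j). Here dd is d/dy delta(A*(y)) at y = theta,
and Delta_M(z) = diag(z^{-p(1)},...,z^{-p(M)}).\<close>
definition coef_c :: "nat \<Rightarrow> nat \<Rightarrow> nat \<Rightarrow> (nat \<Rightarrow> nat \<Rightarrow> nat \<Rightarrow> real)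
    \<Rightarrow> (nat \<Rightarrow> nat \<Rightarrow> nat \<Rightarrow> real) \<Rightarrow> (nat \<times> nat \<Rightarrow> real) \<Rightarrow> real \<Rightarrow> real
    \<Rightarrow> (nat \<Rightarrow> real) \<Rightarrow> (nat \<Rightarrow> real) \<Rightarrow> (nat \<Rightarrow> nat) \<Rightarrow> nat \<Rightarrow> nat \<Rightarrow> complex" where
  "coef_c M0 M \<tau> A Bk x \<theta> dd \<mu> v p l j =
    (\<Sum>\<nu><\<tau>.
      let w = omega \<tau> ^ \<nu>;
          num = (\<Sum>j'<M.
                   ((\<Sum>i<M0. complex_of_real (x (0, i)) * Bstar Bk (complex_of_real \<theta> * w) i j')
                    - (\<Sum>i<M. complex_of_real (x (1, i) * A 0 i j')))
                   * inverse (w ^ p j') * complex_of_real (v j'))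
      in (1 / w ^ l) * (num / ((complex_of_real \<theta> * w - 1) * complex_of_real (dd - 1)))
         * (complex_of_real (\<mu> j) * w ^ p j))"

end

theory Submission
  imports Defs "HOL-Complex_Analysis.Complex_Analysis" "Jordan_Normal_Form.Determinant"
begin

text \<open>
  Let \<open>X(z)\<close> be the row vector of generating functions of the levels \<open>k \<ge> 1\<close>. Stationarity gives
  \<open>X(z) (z I - A*(z)) = z (x(0) B*(z) - x(1) A(0))\<close>. The Perron root \<open>\<delta>(A*(y))\<close> is log-convex in \<open>ln y\<close>,
  equals \<open>y\<close> at \<open>y = 1\<close> and \<open>y = \<theta>\<close>, and has derivative \<open>\<rho> < 1\<close> at 1; so it lies below \<open>y\<close> in between and
  has derivative greater than 1 at \<open>\<theta>\<close>. The corresponding Lyapunov functions \<open>t^k w\<close> show that \<open>X(t)\<close>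
  converges for \<open>t < \<theta>\<close> and is \<open>O(1 / (\<theta> - t))\<close>. By Cramer's rule \<open>X\<close> continues meromorphically beyond
  \<open>|z| = \<theta>\<close>, so it has at most simple poles there. A residue is a left null vector of \<open>\<zeta> I - A*(\<zeta>)\<close>;
  equality in the triangle inequality forces \<open>\<zeta> = \<theta> \<omega>^\<nu>\<close> and makes the residue a multiple of
  \<open>\<mu> \<Delta>(\<omega>^\<nu>)^-1\<close>. Subtracting the principal parts yields the expansion.

  For positivity, the limits \<open>c_l\<close> are nonnegative, and monotonicity of the tails gives \<open>c_(l+1) \<le> \<theta> c_l\<close>
  cyclically, so a single zero entry would make all poles disappear. Then \<open>\<theta>^k x(k)\<close> would be summable,
  which a subharmonic function for the chain killed at level 0 excludes.
\<close>

section \<open>Perron--Frobenius theory\<close>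

text \<open>The order of the zeros of the determinant on |z| = \<theta> is never computed. One
  quantitative estimate replaces it: for t in [z0, \<theta>) there are weights, bounded above and
  below uniformly in t, that contract with factor \<open>1 - \<kappa> * (\<theta> - t)\<close>. The
  linear gap \<theta> - t gives both the growth rate that makes the poles simple and the lower bound
  \<open>1 + \<kappa>\<close> for the slope of the Perron root at \<theta>, hence a nonzero
  denominator in the coefficients. The determinant only supplies some meromorphic continuation.
  Eigenvectors are never differentiated in y. The slope of the Perron root comes from pairing a
  difference quotient with the left eigenvector at the fixed point, and the residue comes from
  pairing the functional equation with the rotated right eigenvector before passing to the limit;
  both computations end in the same sum. A zero entry of one c_l concerns one phase only. It spreads
  to all phases because the entry of c_l at phase j is \<mu>(j) times a function of p(j) - l modulo
  the period.\<close>

lemma bounded_family_convergent_subseq: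
  fixes f :: "nat \<Rightarrow> nat \<Rightarrow> real"
  assumes "\<And>n i. i < M \<Longrightarrow> \<bar>f n i\<bar> \<le> C"
  shows "\<exists>s l. strict_mono s \<and> (\<forall>i<M. (\<lambda>n. f (s n) i) \<longlonglongrightarrow> l i)"
  using assms
proof (induction M)
  case 0
  show ?case by (rule exI[of _ id]) (auto simp: strict_mono_def)
next
  case (Suc M)
  then obtain s l where s: "strict_mono (s::nat\<Rightarrow>nat)" "\<And>i. i < M \<Longrightarrow> (\<lambda>n. f (s n) i) \<longlonglongrightarrow> l i"
    by (metis less_Suc_eq)
  have "bounded (range (\<lambda>n. f (s n) M))"
    unfolding bounded_iff using Suc.prems by (intro exI[of _ C]) auto
  then obtain l' r where r: "strict_mono (r::nat\<Rightarrow>nat)" "((\<lambda>n. f (s n) M) \<circ> r) \<longlonglongrightarrow> l'"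
    using bounded_imp_convergent_subsequence by blast
  have "(\<lambda>n. f ((s \<circ> r) n) i) \<longlonglongrightarrow> (l(M := l')) i" if "i < Suc M" for i
  proof (cases "i = M")
    case True then show ?thesis using r(2) by (simp add: o_def)
  next
    case False
    then have "(\<lambda>n. f (s n) i) \<longlonglongrightarrow> l i" using s(2) that by simp
    from LIMSEQ_subseq_LIMSEQ[OF this r(1)] show ?thesis using False by (simp add: o_def)
  qed
  then show ?case using strict_mono_o[OF s(1) r(1)] by blast
qed

text \<open>Irreducibility as an induction principle. Later uses take for \<open>Z\<close> the
  support of a vector, a set of strict rows, the zero set of a function, or the set where a phase
  identity holds.\<close>

lemma irreducible_on_closed:
  assumes "irreducible_on S P" "a \<in> S" "a \<in> Z"
    and "\<And>s t. s \<in> S \<Longrightarrow> t \<in> S \<Longrightarrow> s \<in> Z \<Longrightarrow> P s t > 0 \<Longrightarrow> t \<in> Z"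
  shows "S \<subseteq> Z"
proof
  fix b assume "b \<in> S"
  then have "(a, b) \<in> {(a, b). a \<in> S \<and> b \<in> S \<and> P a b > 0}\<^sup>*"
    using assms(1,2) unfolding irreducible_on_def by blast
  then show "b \<in> Z"
    by (induction rule: rtrancl_induct) (use assms(3,4) in auto)
qed

lemma irreducible_on_transpose:
  assumes "irreducible_on S P"
  shows "irreducible_on S (\<lambda>i j. P j i)"
proof -
  have "{(a, b). a \<in> S \<and> b \<in> S \<and> P b a > 0} = {(a, b). a \<in> S \<and> b \<in> S \<and> P a b > 0}\<inverse>" by auto
  then show ?thesis using assms unfolding irreducible_on_def by (simp add: rtrancl_converse)
qed

lemma irreducible_on_cong:
  assumes "irreducible_on S P" "\<And>s t. s \<in> S \<Longrightarrow> t \<in> S \<Longrightarrow> P s t > 0 \<longleftrightarrow> Q s t > 0"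
  shows "irreducible_on S Q"
proof -
  have "{(a, b). a \<in> S \<and> b \<in> S \<and> P a b > 0} = {(a, b). a \<in> S \<and> b \<in> S \<and> Q a b > 0}"
    using assms(2) by auto
  then show ?thesis using assms(1) unfolding irreducible_on_def by simp
qed

locale irreducible_matrix =
  fixes M :: nat and N :: "nat \<Rightarrow> nat \<Rightarrow> real"
  assumes M_pos: "0 < M"
    and N_nonneg: "\<And>i j. i < M \<Longrightarrow> j < M \<Longrightarrow> 0 \<le> N i j"
    and N_irred: "irreducible_on {..<M} N"
begin

lemma transpose: "irreducible_matrix M (\<lambda>i j. N j i)"
  using M_pos N_nonneg irreducible_on_transpose[OF N_irred] by unfold_locales auto

lemma backward_closed:
  assumes "a < M" "a \<in> Z" "\<And>i j. i < M \<Longrightarrow> j < M \<Longrightarrow> j \<in> Z \<Longrightarrow> N i j > 0 \<Longrightarrow> i \<in> Z" "i < M"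
  shows "i \<in> Z"
  using irreducible_on_closed[OF irreducible_on_transpose[OF N_irred], of a Z] assms by blast

text \<open>If \<open>w j > 0\<close> and \<open>N i j > 0\<close>, the left side of row
  \<open>i\<close> is positive, so \<open>w i\<close> cannot vanish: positivity spreads backwards
  along the edges.\<close>

lemma nonneg_eigenvector_pos:
  assumes w: "\<And>i. i < M \<Longrightarrow> 0 \<le> w i" and a: "a < M" "w a \<noteq> 0"
    and eig: "\<And>i. i < M \<Longrightarrow> (\<Sum>j<M. N i j * w j) = r * w i" and "i < M"
  shows "w i > 0"
proof -
  have "i \<in> {i. w i > 0}"
  proof (rule backward_closed[OF a(1) _ _ \<open>i < M\<close>])
    show "a \<in> {i. w i > 0}" using w[OF a(1)] a(2) by auto
  next
    fix i j assume ij: "i < M" "j < M" "j \<in> {i. w i > 0}" "N i j > 0"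
    have "0 < N i j * w j" using ij by simp
    also have "\<dots> \<le> (\<Sum>j<M. N i j * w j)"
      using ij N_nonneg w by (intro member_le_sum) auto
    finally have "r * w i > 0" using eig ij by simp
    then show "i \<in> {i. w i > 0}" using w[OF ij(1)] by (cases "w i = 0") auto
  qed
  then show ?thesis by simp
qed

text \<open>Collatz--Wielandt: \<open>r\<close> is the largest \<open>t\<close> with \<open>N w \<ge> t w\<close> for some probability vector
  \<open>w\<close>. For the maximiser, the set of strict rows is enlarged one row at a time by increasing
  a suitable coordinate of \<open>w\<close>, until all rows are strict, against the maximality of \<open>r\<close>.\<close>

lemma perron_frobenius_right:
  "\<exists>r w. (\<forall>i<M. 0 < w i) \<and> (\<Sum>i<M. w i) = 1 \<and> (\<forall>i<M. (\<Sum>j<M. N i j * w j) = r * w i)"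
proof -
  define feas where "feas t w \<longleftrightarrow> (\<forall>i<M. 0 \<le> w i) \<and> (\<Sum>i<M. w i) = 1 \<and>
     (\<forall>i<M. t * w i \<le> (\<Sum>j<M. N i j * w j))" for t and w :: "nat \<Rightarrow> real"
  define S where "S = {t. \<exists>w. feas t w}"
  define B where "B = (\<Sum>i<M. \<Sum>j<M. N i j)"
  have le1: "w i \<le> 1" if "feas t w" "i < M" for t w i
  proof -
    have "w i \<le> (\<Sum>i<M. w i)" using that unfolding feas_def by (intro member_le_sum) auto
    then show ?thesis using that unfolding feas_def by simp
  qed
  have bdd: "t \<le> B" if "feas t w" for t w
  proof -
    have "t = (\<Sum>i<M. t * w i)" using that unfolding feas_def by (simp flip: sum_distrib_left)
    also have "\<dots> \<le> (\<Sum>i<M. \<Sum>j<M. N i j * w j)" using that unfolding feas_def by (intro sum_mono) auto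
    also have "\<dots> \<le> (\<Sum>i<M. \<Sum>j<M. N i j * 1)"
      using N_nonneg le1[OF that] by (intro sum_mono mult_left_mono) auto
    finally show ?thesis by (simp add: B_def)
  qed
  have S0: "0 \<in> S"
  proof -
    have "feas 0 (\<lambda>i. 1 / real M)" unfolding feas_def
      using M_pos N_nonneg by (auto intro!: sum_nonneg)
    then show ?thesis unfolding S_def by blast
  qed
  have bddS: "bdd_above S" using bdd unfolding S_def bdd_above_def by blast
  define r where "r = Sup S"
  have "\<exists>t\<in>S. r - 1 / real (Suc n) < t" for n
    using less_cSup_iff[of S "r - 1 / real (Suc n)"] S0 bddS unfolding r_def by force
  then have "\<exists>t w. r - 1 / real (Suc n) < t \<and> feas t w" for n unfolding S_def by blast
  then obtain t w where tw: "\<And>n. r - 1 / real (Suc n) < t n" "\<And>n. feas (t n) (w n)" by metis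
  have "\<bar>w n i\<bar> \<le> 1" if "i < M" for n i
    using le1[OF tw(2) that] tw(2)[of n] that unfolding feas_def by auto
  then obtain s l where s: "strict_mono s" and l: "\<And>i. i < M \<Longrightarrow> (\<lambda>n. w (s n) i) \<longlonglongrightarrow> l i"
    using bounded_family_convergent_subseq[of M w 1] by blast
  have feas_l: "feas r l" unfolding feas_def
  proof (intro conjI allI impI)
    fix i assume i: "i < M"
    show "0 \<le> l i" using tw(2) i unfolding feas_def
      by (intro tendsto_lowerbound[OF l[OF i]]) auto
    have "(\<lambda>n. (r - 1 / real (Suc n))) \<longlonglongrightarrow> r - 0"
      by (intro tendsto_diff tendsto_const LIMSEQ_Suc lim_1_over_n)
    then have "((\<lambda>n. (r - 1 / real (Suc n))) \<circ> s) \<longlonglongrightarrow> r" using LIMSEQ_subseq_LIMSEQ s by fastforce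
    then have "(\<lambda>n. (r - 1 / real (Suc (s n))) * w (s n) i) \<longlonglongrightarrow> r * l i"
      using l[OF i] by (intro tendsto_mult) (auto simp: o_def)
    moreover have "(\<lambda>n. (\<Sum>j<M. N i j * w (s n) j)) \<longlonglongrightarrow> (\<Sum>j<M. N i j * l j)"
      by (intro tendsto_sum tendsto_mult tendsto_const l) auto
    moreover have "(r - 1 / real (Suc (s n))) * w (s n) i \<le> (\<Sum>j<M. N i j * w (s n) j)" for n
    proof -
      have "(r - 1 / real (Suc (s n))) * w (s n) i \<le> t (s n) * w (s n) i"
        using tw(1)[of "s n"] tw(2)[of "s n"] i unfolding feas_def by (intro mult_right_mono) auto
      then show ?thesis using tw(2)[of "s n"] i unfolding feas_def by fastforce
    qed
    ultimately show "r * l i \<le> (\<Sum>j<M. N i j * l j)" by (intro LIMSEQ_le) auto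
  next
    have "(\<lambda>n. (\<Sum>i<M. w (s n) i)) \<longlonglongrightarrow> (\<Sum>i<M. l i)" by (intro tendsto_sum l) auto
    moreover have "(\<Sum>i<M. w (s n) i) = 1" for n using tw(2) unfolding feas_def by auto
    ultimately show "(\<Sum>i<M. l i) = 1" by (simp add: LIMSEQ_const_iff)
  qed
  \<comment> \<open>\<open>cand\<close> drops the normalisation of \<open>feas\<close>, so that a
    single coordinate may be raised freely; \<open>E u\<close> collects the strict rows.\<close>
  define cand where "cand u \<longleftrightarrow> (\<forall>i<M. 0 \<le> u i) \<and> (\<Sum>i<M. u i) > 0 \<and>
     (\<forall>i<M. r * u i \<le> (\<Sum>j<M. N i j * u j))" for u :: "nat \<Rightarrow> real"
  define E where "E u = {i. i < M \<and> r * u i < (\<Sum>j<M. N i j * u j)}" for u :: "nat \<Rightarrow> real"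
  have finE: "finite (E u)" "card (E u) \<le> M" for u
  proof -
    have "E u \<subseteq> {..<M}" unfolding E_def by auto
    then show "finite (E u)" "card (E u) \<le> M"
      using finite_subset[of "E u" "{..<M}"] card_mono[of "{..<M}" "E u"] by auto
  qed
  have not_all: "E u \<noteq> {..<M}" if "cand u" for u
  proof
    assume all: "E u = {..<M}"
    define U where "U = (\<Sum>i<M. u i)"
    have U: "U > 0" using that unfolding cand_def U_def by auto
    have u_le: "u i \<le> U" if "i < M" for i
      unfolding U_def using that \<open>cand u\<close> unfolding cand_def by (intro member_le_sum) auto
    define d where "d = Min ((\<lambda>i. (\<Sum>j<M. N i j * u j) - r * u i) ` {..<M})"
    have ne: "{..<M} \<noteq> {}" using M_pos by (auto simp: lessThan_empty_iff)
    have lt: "r * u i < (\<Sum>j<M. N i j * u j)" if "i < M" for i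
      using that all unfolding E_def by blast
    have d: "d > 0" unfolding d_def using ne lt by (subst Min_gr_iff) auto
    have dle: "d \<le> (\<Sum>j<M. N i j * u j) - r * u i" if "i < M" for i
      unfolding d_def using that by (intro Min_le) auto
    \<comment> \<open>Every row has slack at least \<open>d\<close>, and \<open>u i \<le> U\<close>,
      so the factor can grow by \<open>d / U\<close>, beyond the supremum.\<close>
    have "feas (r + d / U) (\<lambda>i. u i / U)" unfolding feas_def
    proof (intro conjI allI impI)
      fix i assume i: "i < M"
      show "0 \<le> u i / U" using that U i unfolding cand_def by auto
      have "(r + d / U) * u i = r * u i + d * (u i / U)" using U by (simp add: field_simps)
      also have "d * (u i / U) \<le> d * 1" using u_le[OF i] d U by (intro mult_left_mono) auto
      finally have "(r + d / U) * u i \<le> (\<Sum>j<M. N i j * u j)" using dle[OF i] by linarith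
      then have "(r + d / U) * u i / U \<le> (\<Sum>j<M. N i j * u j) / U" using U by (intro divide_right_mono) auto
      then show "(r + d / U) * (u i / U) \<le> (\<Sum>j<M. N i j * (u j / U))"
        by (simp add: sum_divide_distrib)
    next
      show "(\<Sum>i<M. u i / U) = 1" using U by (simp add: U_def flip: sum_divide_distrib)
    qed
    then have "r + d / U \<le> r" unfolding r_def using bddS S_def by (intro cSup_upper) auto
    then show False using d U by (simp add: field_simps)
  qed
  have cand_l: "cand l" using feas_l unfolding feas_def cand_def by auto
  then obtain u where u: "cand u" and umax: "\<And>u'. cand u' \<Longrightarrow> card (E u') \<le> card (E u)"
    using ex_has_greatest_nat[of cand l "\<lambda>u. card (E u)" "Suc M"] finE(2) by (metis le_imp_less_Suc)
  have "E u = {}"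
  proof (rule ccontr)
    assume "E u \<noteq> {}"
    then obtain a where a: "a \<in> E u" "a < M" by (auto simp: E_def)
    have "\<exists>i j. i < M \<and> j < M \<and> j \<in> E u \<and> i \<notin> E u \<and> N i j > 0"
    proof (rule ccontr)
      assume "\<not> ?thesis"
      then have "i \<in> E u" if "i < M" for i using backward_closed[OF a(2,1) _ that] by blast
      then have "E u = {..<M}" by (auto simp: E_def)
      then show False using not_all u by blast
    qed
    then obtain i j where ij: "i < M" "j < M" "j \<in> E u" "i \<notin> E u" "N i j > 0" by blast
    define gap where "gap = (\<Sum>k<M. N j k * u k) - r * u j"
    have gap: "gap > 0" using ij unfolding E_def gap_def by auto
    \<comment> \<open>Small enough that \<open>r * e < gap\<close>: row \<open>j\<close> stays
      strict although its own coordinate is raised.\<close>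
    define e where "e = gap / (2 * (\<bar>r\<bar> + 1))"
    have e: "e > 0" unfolding e_def using gap by auto
    have "r * e \<le> \<bar>r\<bar> * e" using e by (intro mult_right_mono) auto
    also have "\<dots> = gap * (\<bar>r\<bar> / (2 * (\<bar>r\<bar> + 1)))" by (simp add: e_def)
    also have "\<dots> < gap * 1" using gap by (intro mult_strict_left_mono) (auto simp: field_simps)
    finally have re: "r * e < gap" by simp
    define u' where "u' = u(j := u j + e)"
    have u'eq: "u' k = u k + (if k = j then e else 0)" for k unfolding u'_def by auto
    have Nu': "(\<Sum>k<M. N m k * u' k) = (\<Sum>k<M. N m k * u k) + N m j * e" for m
      unfolding u'eq using ij by (simp add: distrib_left sum.distrib if_distrib[of "\<lambda>x. N m _ * x"] sum.delta cong: if_cong)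
    \<comment> \<open>Raising coordinate \<open>j\<close> changes \<open>r * u\<close> in row
      \<open>j\<close> alone and lowers no right-hand side; row \<open>i\<close> becomes strict
      because \<open>N i j > 0\<close>.\<close>
    have strict: "E u \<union> {i} \<subseteq> E u'"
    proof
      fix m assume m: "m \<in> E u \<union> {i}"
      have mM: "m < M" using m ij by (auto simp: E_def)
      have Nm: "0 \<le> N m j * e" using N_nonneg[OF mM ij(2)] e by auto
      show "m \<in> E u'"
      proof (cases "m = j")
        case True
        then show ?thesis using re Nm mM unfolding E_def Nu' gap_def by (simp add: u'eq distrib_left)
      next
        case False
        show ?thesis
        proof (cases "m = i")
          case True
          have "0 < N i j * e" using ij e by auto
          moreover have "r * u i \<le> (\<Sum>k<M. N i k * u k)" using u ij unfolding cand_def by auto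
          ultimately show ?thesis using True False ij unfolding E_def Nu' by (simp add: u'eq)
        next
          case False2: False
          then have "m \<in> E u" using m by auto
          then show ?thesis using False Nm unfolding E_def Nu' by (simp add: u'eq)
        qed
      qed
    qed
    have "cand u'" unfolding cand_def
    proof (intro conjI allI impI)
      fix m assume m: "m < M"
      show "0 \<le> u' m" using u e m unfolding u'eq cand_def by auto
      show "r * u' m \<le> (\<Sum>k<M. N m k * u' k)"
      proof (cases "m \<in> E u'")
        case True then show ?thesis unfolding E_def by auto
      next
        case False
        then have "m \<noteq> j" using strict ij by auto
        then show ?thesis using u m N_nonneg[OF m ij(2)] e unfolding Nu' cand_def
          by (simp add: u'eq add_increasing2)
      qed
    next
      have "(\<Sum>m<M. u m) \<le> (\<Sum>m<M. u' m)" using e unfolding u'eq by (intro sum_mono) auto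
      then show "0 < (\<Sum>m<M. u' m)" using u unfolding cand_def by auto
    qed
    then have "card (E u') \<le> card (E u)" by (rule umax)
    moreover have "card (E u \<union> {i}) \<le> card (E u')" using strict finE by (intro card_mono) auto
    moreover have "card (E u \<union> {i}) = Suc (card (E u))" using finE ij by auto
    ultimately show False by simp
  qed
  then have eig: "(\<Sum>j<M. N i j * u j) = r * u i" if "i < M" for i
    using u that unfolding cand_def E_def by force
  define U where "U = (\<Sum>i<M. u i)"
  have U: "U > 0" using u unfolding cand_def U_def by auto
  then obtain a where a: "a < M" "u a \<noteq> 0" unfolding U_def
    by (metis lessThan_iff less_irrefl sum.neutral)
  have pos: "u i > 0" if "i < M" for i
    using nonneg_eigenvector_pos[of u a r i, OF _ a eig that] u unfolding cand_def by auto
  show ?thesis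
  proof (intro exI conjI allI impI)
    show "(\<Sum>i<M. u i / U) = 1" using U by (simp add: U_def flip: sum_divide_distrib)
    show "0 < u i / U" if "i < M" for i using pos U that by simp
    show "(\<Sum>j<M. N i j * (u j / U)) = r * (u i / U)" if "i < M" for i
      using eig[OF that] by (simp flip: sum_divide_distrib)
  qed
qed

text \<open>Subtract the largest multiple of \<open>w\<close> that stays below \<open>u\<close>. The
  difference is a nonnegative eigenvector with a zero entry, so by
  \<open>nonneg_eigenvector_pos\<close> it vanishes.\<close>

lemma eigenvector_unique:
  assumes w: "\<And>i. i < M \<Longrightarrow> 0 < w i" and weig: "\<And>i. i < M \<Longrightarrow> (\<Sum>j<M. N i j * w j) = r * w i"
    and ueig: "\<And>i. i < M \<Longrightarrow> (\<Sum>j<M. N i j * u j) = r * u i"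
  shows "\<exists>c. \<forall>i<M. u i = c * w i"
proof -
  define c where "c = Min ((\<lambda>i. u i / w i) ` {..<M})"
  have cle: "c * w i \<le> u i" if "i < M" for i
  proof -
    have "c \<le> u i / w i" unfolding c_def using that by (intro Min_le) auto
    then show ?thesis using w[OF that] by (simp add: field_simps)
  qed
  have "c \<in> (\<lambda>i. u i / w i) ` {..<M}" unfolding c_def using M_pos by (intro Min_in) auto
  then obtain a where a: "a < M" "c = u a / w a" by auto
  have eig: "(\<Sum>j<M. N i j * (u j - c * w j)) = r * (u i - c * w i)" if "i < M" for i
  proof -
    have "(\<Sum>j<M. N i j * (u j - c * w j)) = (\<Sum>j<M. N i j * u j) - c * (\<Sum>j<M. N i j * w j)"
      by (simp add: sum_subtractf sum_distrib_left algebra_simps)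
    also have "\<dots> = r * u i - c * (r * w i)" using that by (simp add: weig ueig)
    finally show ?thesis by (simp add: algebra_simps)
  qed
  have "u i - c * w i = 0" if "i < M" for i
  proof (rule ccontr)
    assume "u i - c * w i \<noteq> 0"
    from nonneg_eigenvector_pos[of "\<lambda>i. u i - c * w i" i r a, OF _ that this eig a(1)]
    have "u a - c * w a > 0" using cle by auto
    then show False using a w[OF a(1)] by auto
  qed
  then show ?thesis by auto
qed

end

section \<open>Comparison with a positive left eigenvector\<close>

lemma left_subinvariant:
  fixes N :: "nat \<Rightarrow> nat \<Rightarrow> real"
  assumes u: "\<And>i. i < M \<Longrightarrow> 0 < u i" and ueig: "\<And>j. j < M \<Longrightarrow> (\<Sum>i<M. u i * N i j) = r * u j"
  shows "(\<Sum>i<M. u i * (\<Sum>j<M. N i j * w j)) = r * (\<Sum>j<M. u j * w j)"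
proof -
  have "(\<Sum>i<M. u i * (\<Sum>j<M. N i j * w j)) = (\<Sum>j<M. (\<Sum>i<M. u i * N i j) * w j)"
    unfolding sum_distrib_left sum_distrib_right by (subst sum.swap) (simp add: mult.assoc)
  also have "\<dots> = (\<Sum>j<M. r * u j * w j)" by (intro sum.cong) (auto simp: ueig)
  finally show ?thesis by (simp add: sum_distrib_left mult.assoc)
qed

text \<open>Pairing the row inequalities with \<open>u > 0\<close> collapses them into one scalar
  inequality. This bound and the reverse one below take the place of spectral radius
  arguments.\<close>

lemma left_positive_le:
  fixes N :: "nat \<Rightarrow> nat \<Rightarrow> real"
  assumes u: "\<And>i. i < M \<Longrightarrow> 0 < u i" and ueig: "\<And>j. j < M \<Longrightarrow> (\<Sum>i<M. u i * N i j) = r * u j"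
    and w: "\<And>i. i < M \<Longrightarrow> 0 \<le> w i" "a < M" "w a \<noteq> 0"
    and le: "\<And>i. i < M \<Longrightarrow> c * w i \<le> (\<Sum>j<M. N i j * w j)"
  shows "c \<le> r"
proof -
  have pos: "0 < (\<Sum>j<M. u j * w j)"
  proof (rule sum_pos2[of _ a])
    show "0 < u a * w a" using w(1)[OF w(2)] w(3) u[OF w(2)] by simp
    show "\<And>i. i \<in> {..<M} \<Longrightarrow> 0 \<le> u i * w i" using u w(1) by (simp add: less_imp_le)
  qed (use w in auto)
  have "c * (\<Sum>j<M. u j * w j) = (\<Sum>i<M. u i * (c * w i))" by (simp add: sum_distrib_left mult_ac)
  also have "\<dots> \<le> (\<Sum>i<M. u i * (\<Sum>j<M. N i j * w j))"
    using u le by (intro sum_mono mult_left_mono) (auto simp: less_imp_le)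
  also have "\<dots> = r * (\<Sum>j<M. u j * w j)" by (rule left_subinvariant[OF u ueig])
  finally show ?thesis using pos by simp
qed

lemma left_positive_ge:
  fixes N :: "nat \<Rightarrow> nat \<Rightarrow> real"
  assumes u: "\<And>i. i < M \<Longrightarrow> 0 < u i" and ueig: "\<And>j. j < M \<Longrightarrow> (\<Sum>i<M. u i * N i j) = r * u j"
    and w: "\<And>i. i < M \<Longrightarrow> 0 < w i" "0 < M"
    and le: "\<And>i. i < M \<Longrightarrow> (\<Sum>j<M. N i j * w j) \<le> c * w i"
  shows "r \<le> c"
proof -
  have pos: "0 < (\<Sum>j<M. u j * w j)" using u w by (intro sum_pos) auto
  have "r * (\<Sum>j<M. u j * w j) = (\<Sum>i<M. u i * (\<Sum>j<M. N i j * w j))"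
    by (rule left_subinvariant[OF u ueig, symmetric])
  also have "\<dots> \<le> (\<Sum>i<M. u i * (c * w i))"
    using u le by (intro sum_mono mult_left_mono) (auto simp: less_imp_le)
  also have "\<dots> = c * (\<Sum>j<M. u j * w j)" by (simp add: sum_distrib_left mult_ac)
  finally show ?thesis using pos by simp
qed

text \<open>The slacks are nonnegative and their \<open>u\<close>-weighted total is zero. Applied to
  the moduli of a complex null vector, this turns the triangle inequality into an equality.\<close>

lemma left_positive_eq:
  fixes N :: "nat \<Rightarrow> nat \<Rightarrow> real"
  assumes u: "\<And>i. i < M \<Longrightarrow> 0 < u i" and ueig: "\<And>j. j < M \<Longrightarrow> (\<Sum>i<M. u i * N i j) = r * u j"
    and le: "\<And>i. i < M \<Longrightarrow> r * w i \<le> (\<Sum>j<M. N i j * w j)" and "i < M"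
  shows "(\<Sum>j<M. N i j * w j) = r * w i"
proof -
  have "(\<Sum>i<M. u i * ((\<Sum>j<M. N i j * w j) - r * w i)) = 0"
    using left_subinvariant[OF u ueig, of w]
    by (simp add: right_diff_distrib sum_subtractf sum_distrib_left mult_ac)
  then have "\<forall>i\<in>{..<M}. u i * ((\<Sum>j<M. N i j * w j) - r * w i) = 0"
    using u le by (subst (asm) sum_nonneg_eq_0_iff) (auto simp: less_imp_le)
  then have "u i * ((\<Sum>j<M. N i j * w j) - r * w i) = 0" using \<open>i < M\<close> by blast
  then show ?thesis using u[OF \<open>i < M\<close>] by simp
qed

lemma norm_eigenvector_ge:
  fixes N :: "nat \<Rightarrow> nat \<Rightarrow> real" and X :: "nat \<Rightarrow> nat \<Rightarrow> complex"
  assumes "\<And>j. j < M \<Longrightarrow> norm (X i j) \<le> N i j" "(\<Sum>j<M. X i j * z j) = lam * z i"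
  shows "norm lam * norm (z i) \<le> (\<Sum>j<M. N i j * norm (z j))"
proof -
  have "norm lam * norm (z i) = norm (\<Sum>j<M. X i j * z j)" by (simp add: assms(2) norm_mult)
  also have "\<dots> \<le> (\<Sum>j<M. N i j * norm (z j))"
    using assms(1) by (intro sum_norm_le) (auto simp: norm_mult mult_right_mono)
  finally show ?thesis .
qed

lemma eigenvalue_norm_le:
  assumes u: "\<And>i. i < M \<Longrightarrow> 0 < u i" and ueig: "\<And>j. j < M \<Longrightarrow> (\<Sum>i<M. u i * N i j) = r * u j"
    and N: "\<And>i j. i < M \<Longrightarrow> j < M \<Longrightarrow> norm (X i j) \<le> N i j"
    and lam: "is_eigenvalue M X lam"
  shows "norm lam \<le> r"
proof -
  obtain z a where z: "a < M" "z a \<noteq> 0" "\<And>i. i < M \<Longrightarrow> (\<Sum>j<M. X i j * z j) = lam * z i"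
    using lam unfolding is_eigenvalue_def by blast
  show ?thesis
  proof (rule left_positive_le[OF u ueig, of "\<lambda>i. norm (z i)" a "norm lam"])
    show "norm lam * norm (z i) \<le> (\<Sum>j<M. N i j * norm (z j))" if "i < M" for i
      by (rule norm_eigenvector_ge[of M X i N z lam]) (use N z that in auto)
  qed (use z in auto)
qed

text \<open>Other eigenvalues may share the modulus \<open>r\<close>. The clause on real parts
  decides: the selected eigenvalue has modulus \<open>r\<close> and real part at least
  \<open>r\<close>, so it equals \<open>r\<close>.\<close>

lemma delta_eq_perron_root:
  assumes u: "\<And>i. i < M \<Longrightarrow> 0 < u i" and ueig: "\<And>j. j < M \<Longrightarrow> (\<Sum>i<M. u i * N i j) = r * u j"
    and w: "\<And>i. i < M \<Longrightarrow> 0 < w i" and weig: "\<And>i. i < M \<Longrightarrow> (\<Sum>j<M. N i j * w j) = r * w i"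
    and N: "\<And>i j. i < M \<Longrightarrow> j < M \<Longrightarrow> 0 \<le> N i j" and "0 < M"
    and X: "\<And>i j. i < M \<Longrightarrow> j < M \<Longrightarrow> X i j = complex_of_real (N i j)"
  shows "delta M X = complex_of_real r"
proof -
  have r: "r \<ge> 0"
  proof -
    have "0 \<le> (\<Sum>j<M. N 0 j * w j)" using N w \<open>0 < M\<close> by (intro sum_nonneg) (simp add: less_imp_le)
    then show ?thesis using weig[OF \<open>0 < M\<close>] w[OF \<open>0 < M\<close>] by (simp add: zero_le_mult_iff)
  qed
  have eig: "is_eigenvalue M X (complex_of_real r)"
    unfolding is_eigenvalue_def
  proof (intro exI[of _ "\<lambda>i. complex_of_real (w i)"] conjI allI impI)
    show "\<exists>i<M. complex_of_real (w i) \<noteq> 0" using w[OF \<open>0 < M\<close>] \<open>0 < M\<close> by (intro exI[of _ 0]) auto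
    show "(\<Sum>j<M. X i j * complex_of_real (w j)) = complex_of_real r * complex_of_real (w i)" if "i < M" for i
    proof -
      have "(\<Sum>j<M. X i j * complex_of_real (w j)) = complex_of_real (\<Sum>j<M. N i j * w j)"
        using that by (simp add: X)
      then show ?thesis using weig[OF that] by simp
    qed
  qed
  have le: "norm lam \<le> r" if "is_eigenvalue M X lam" for lam
    by (rule eigenvalue_norm_le[OF u ueig _ that]) (auto simp: X N)
  show ?thesis unfolding delta_def
  proof (rule the_equality)
    show "is_eigenvalue M X (complex_of_real r) \<and>
      (\<forall>\<nu>. is_eigenvalue M X \<nu> \<longrightarrow> cmod \<nu> \<le> cmod (complex_of_real r)) \<and>
      0 \<le> Im (complex_of_real r) \<and>
      (\<forall>\<nu>. is_eigenvalue M X \<nu> \<and> cmod \<nu> = cmod (complex_of_real r) \<longrightarrow> Re \<nu> \<le> Re (complex_of_real r))"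
      using eig le r by (auto intro: order_trans[OF complex_Re_le_cmod])
  next
    fix lam assume lam: "is_eigenvalue M X lam \<and> (\<forall>\<nu>. is_eigenvalue M X \<nu> \<longrightarrow> cmod \<nu> \<le> cmod lam) \<and>
       0 \<le> Im lam \<and> (\<forall>\<nu>. is_eigenvalue M X \<nu> \<and> cmod \<nu> = cmod lam \<longrightarrow> Re \<nu> \<le> Re lam)"
    then have "cmod lam = r" using le[of lam] eig r by fastforce
    then have "r \<le> Re lam" using lam eig r by fastforce
    then have "Re lam = cmod lam" using \<open>cmod lam = r\<close> complex_Re_le_cmod[of lam] by simp
    then have "Im lam = 0" by (smt (verit) cmod_power2 power2_eq_square power_eq_0_iff zero_eq_power2)
    then show "lam = complex_of_real r" using \<open>Re lam = cmod lam\<close> \<open>cmod lam = r\<close> by (simp add: complex_eq_iff)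
  qed
qed

section \<open>The Perron root of the matrix generating function\<close>

lemma LIMSEQ_subseq_principle:
  fixes f :: "nat \<Rightarrow> 'a :: metric_space"
  assumes "\<And>s. strict_mono (s :: nat \<Rightarrow> nat) \<Longrightarrow> \<exists>t. strict_mono (t :: nat \<Rightarrow> nat) \<and> (\<lambda>n. f (s (t n))) \<longlonglongrightarrow> l"
  shows "f \<longlonglongrightarrow> l"
proof (rule ccontr)
  assume "\<not> f \<longlonglongrightarrow> l"
  then obtain e where e: "e > 0" "\<not> (\<forall>\<^sub>F n in sequentially. dist (f n) l < e)"
    unfolding tendsto_iff by blast
  then have "\<exists>\<^sub>F n in sequentially. \<not> dist (f n) l < e" by (simp add: frequently_def)
  then have "infinite {n. \<not> dist (f n) l < e}"
    by (simp add: cofinite_eq_sequentially[symmetric] frequently_cofinite)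
  then obtain s :: "nat \<Rightarrow> nat" where s: "strict_mono s" "\<And>n. s n \<in> {n. \<not> dist (f n) l < e}"
    using infinite_enumerate by blast
  obtain t :: "nat \<Rightarrow> nat" where t: "(\<lambda>n. f (s (t n))) \<longlonglongrightarrow> l" using assms[OF s(1)] by blast
  have "\<forall>\<^sub>F n in sequentially. dist (f (s (t n))) l < e" using t e(1) unfolding tendsto_iff by blast
  then show False using s(2) by (auto simp: eventually_sequentially)
qed

text \<open>A real \<open>R\<close> with convergence at \<open>R\<close> itself stands in for the
  extended-real convergence radius; analysis then takes place on \<open>ball 0 R\<close>.\<close>

locale matrix_gf =
  fixes M :: nat and A :: "nat \<Rightarrow> nat \<Rightarrow> nat \<Rightarrow> real" and R :: real
  assumes M_pos: "0 < M"
    and A_nonneg: "\<And>k i j. i < M \<Longrightarrow> j < M \<Longrightarrow> 0 \<le> A k i j"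
    and A_irred: "irreducible_on {..<M} (msum A)"
    and R_gt_1: "1 < R"
    and A_summable_R: "\<And>i j. i < M \<Longrightarrow> j < M \<Longrightarrow> summable (\<lambda>k. R ^ k * A k i j)"
begin

lemma summable_norm_A:
  fixes z :: complex
  assumes "i < M" "j < M" "norm z \<le> R"
  shows "summable (\<lambda>k. norm (z ^ k * complex_of_real (A k i j)))"
proof (rule summable_comparison_test'[OF A_summable_R[OF assms(1,2)]])
  fix k :: nat
  have "cmod z ^ k * A k i j \<le> R ^ k * A k i j"
    using assms A_nonneg by (intro mult_right_mono power_mono) auto
  then show "norm (norm (z ^ k * complex_of_real (A k i j))) \<le> R ^ k * A k i j"
    using A_nonneg[OF assms(1,2)] by (simp add: norm_mult norm_power)
qed

lemma summable_A:
  assumes "i < M" "j < M" "0 \<le> y" "y \<le> R"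
  shows "summable (\<lambda>k. y ^ k * A k i j)"
  using summable_norm_A[OF assms(1,2), of "complex_of_real y"] assms A_nonneg
  by (simp add: norm_mult norm_power)

lemma Astar_of_real:
  assumes "i < M" "j < M" "0 \<le> y" "y \<le> R"
  shows "Astar A (complex_of_real y) i j = complex_of_real (AstarR A y i j)"
proof -
  have "(\<lambda>k. y ^ k * A k i j) sums AstarR A y i j"
    unfolding AstarR_def using summable_A[OF assms] by (rule summable_sums)
  from sums_of_real[OF this, where 'a = complex]
  have "(\<lambda>k. complex_of_real y ^ k * complex_of_real (A k i j)) sums complex_of_real (AstarR A y i j)"
    by simp
  then show ?thesis unfolding Astar_def by (rule sums_unique[symmetric])
qed

lemma norm_Astar_le:
  assumes "i < M" "j < M" "norm z \<le> R"
  shows "norm (Astar A z i j) \<le> AstarR A (norm z) i j"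
proof -
  have "norm (Astar A z i j) \<le> (\<Sum>k. norm (z ^ k * complex_of_real (A k i j)))"
    unfolding Astar_def by (rule summable_norm[OF summable_norm_A[OF assms]])
  also have "\<dots> = AstarR A (norm z) i j"
    unfolding AstarR_def using A_nonneg[OF assms(1,2)] by (simp add: norm_mult norm_power)
  finally show ?thesis .
qed

lemma AstarR_nonneg: "i < M \<Longrightarrow> j < M \<Longrightarrow> 0 \<le> y \<Longrightarrow> y \<le> R \<Longrightarrow> 0 \<le> AstarR A y i j"
  unfolding AstarR_def using A_nonneg summable_A by (intro suminf_nonneg) auto

text \<open>The pattern of positive entries is the same for all \<open>y > 0\<close>, since the
  series has nonnegative terms.\<close>

lemma irreducible_AstarR:
  assumes "0 < y" "y \<le> R"
  shows "irreducible_matrix M (AstarR A y)"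
proof
  show "irreducible_on {..<M} (AstarR A y)"
  proof (rule irreducible_on_cong[OF A_irred])
    fix i j assume ij: "i \<in> {..<M}" "j \<in> {..<M}"
    have "msum A i j > 0 \<longleftrightarrow> (\<exists>k. A k i j > 0)"
      unfolding msum_def using summable_A[of i j 1] ij R_gt_1 A_nonneg by (subst suminf_pos_iff) auto
    moreover have "AstarR A y i j > 0 \<longleftrightarrow> (\<exists>k. y ^ k * A k i j > 0)"
      unfolding AstarR_def using summable_A[of i j y] ij assms A_nonneg by (subst suminf_pos_iff) auto
    ultimately show "0 < msum A i j \<longleftrightarrow> 0 < AstarR A y i j" using assms by (simp add: zero_less_mult_iff)
  qed
qed (use M_pos AstarR_nonneg assms in auto)

abbreviation (input) act :: "real \<Rightarrow> (nat \<Rightarrow> real) \<Rightarrow> nat \<Rightarrow> real" where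
  "act y w i \<equiv> (\<Sum>j<M. AstarR A y i j * w j)"

text \<open>Taking the real part makes this a real function of \<open>y\<close>; it is literally the
  function differentiated in the theorem.\<close>

definition Perron :: "real \<Rightarrow> real" where
  "Perron y = Re (delta M (Astar A (complex_of_real y)))"

text \<open>The left vector is a right vector of the transposed matrix, a priori with another root;
  the two comparison lemmas applied to \<open>u\<close> and \<open>w\<close> identify the
  roots.\<close>

lemma Perron_exists:
  assumes "0 < y" "y \<le> R"
  obtains u w where "\<And>i. i < M \<Longrightarrow> 0 < u i" "\<And>i. i < M \<Longrightarrow> 0 < w i" "(\<Sum>i<M. w i) = 1"
    "\<And>j. j < M \<Longrightarrow> (\<Sum>i<M. u i * AstarR A y i j) = Perron y * u j"
    "\<And>i. i < M \<Longrightarrow> act y w i = Perron y * w i"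
    "delta M (Astar A (complex_of_real y)) = complex_of_real (Perron y)"
proof -
  interpret irreducible_matrix M "AstarR A y" by (rule irreducible_AstarR[OF assms])
  interpret tr: irreducible_matrix M "\<lambda>i j. AstarR A y j i" by (rule transpose)
  obtain r w where w: "\<And>i. i < M \<Longrightarrow> 0 < w i" "(\<Sum>i<M. w i) = 1"
    "\<And>i. i < M \<Longrightarrow> act y w i = r * w i"
    using perron_frobenius_right by blast
  obtain r' u where u: "\<And>i. i < M \<Longrightarrow> 0 < u i"
    "\<And>i. i < M \<Longrightarrow> (\<Sum>j<M. AstarR A y j i * u j) = r' * u i"
    using tr.perron_frobenius_right by blast
  have ueig: "(\<Sum>i<M. u i * AstarR A y i j) = r' * u j" if "j < M" for j
    using u(2)[OF that] by (simp add: mult.commute)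
  have "r' = r"
  proof (rule antisym)
    show "r' \<le> r" by (rule left_positive_ge[OF u(1) ueig w(1) M_pos]) (use w(3) in auto)
    show "r \<le> r'"
      by (rule left_positive_le[OF u(1) ueig, of w 0 r]) (use w(1,3) M_pos in \<open>auto simp: less_imp_le less_imp_neq[symmetric]\<close>)
  qed
  then have delta: "delta M (Astar A (complex_of_real y)) = complex_of_real r"
    using ueig by (intro delta_eq_perron_root[of M u "AstarR A y" r w])
      (use u(1) w M_pos AstarR_nonneg assms Astar_of_real in auto)
  then have "Perron y = r" unfolding Perron_def by simp
  then show ?thesis using that[OF u(1) w(1,2)] ueig w(3) delta \<open>r' = r\<close> by simp
qed

lemma Perron_eqI:
  assumes "0 < y" "y \<le> R" "\<And>i. i < M \<Longrightarrow> 0 < w i"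
    and eig: "\<And>i. i < M \<Longrightarrow> act y w i = r * w i"
  shows "Perron y = r"
proof -
  obtain u w' where u: "\<And>i. i < M \<Longrightarrow> 0 < u i"
    "\<And>j. j < M \<Longrightarrow> (\<Sum>i<M. u i * AstarR A y i j) = Perron y * u j"
    by (rule Perron_exists[OF assms(1,2)]) blast
  have "Perron y * (\<Sum>j<M. u j * w j) = (\<Sum>i<M. u i * act y w i)"
    by (rule left_subinvariant[OF u, symmetric])
  also have "\<dots> = r * (\<Sum>j<M. u j * w j)" using eig by (simp add: sum_distrib_left mult_ac)
  finally show ?thesis using sum_pos[of "{..<M}" "\<lambda>j. u j * w j"] u(1) assms(3) M_pos by fastforce
qed

lemma Perron_le:
  assumes "0 < y" "y \<le> R" "\<And>i. i < M \<Longrightarrow> 0 < w i"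
    and eig: "\<And>i. i < M \<Longrightarrow> act y w i \<le> r * w i"
  shows "Perron y \<le> r"
proof -
  obtain u w' where u: "\<And>i. i < M \<Longrightarrow> 0 < u i"
    "\<And>j. j < M \<Longrightarrow> (\<Sum>i<M. u i * AstarR A y i j) = Perron y * u j"
    by (rule Perron_exists[OF assms(1,2)]) blast
  show ?thesis by (rule left_positive_ge[OF u assms(3) M_pos eig])
qed

lemma eigenvalue_Astar_le_Perron:
  assumes "0 < norm z" "norm z \<le> R" "is_eigenvalue M (Astar A z) lam"
  shows "norm lam \<le> Perron (norm z)"
proof -
  obtain u w' where u: "\<And>i. i < M \<Longrightarrow> 0 < u i"
    "\<And>j. j < M \<Longrightarrow> (\<Sum>i<M. u i * AstarR A (norm z) i j) = Perron (norm z) * u j"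
    by (rule Perron_exists[OF assms(1,2)]) blast
  show ?thesis by (rule eigenvalue_norm_le[OF u _ assms(3)]) (use norm_Astar_le assms in auto)
qed

section \<open>Differentiability of the Perron root\<close>

definition dAstarR :: "real \<Rightarrow> nat \<Rightarrow> nat \<Rightarrow> real" where
  "dAstarR y i j = (\<Sum>k. diffs (\<lambda>k. A k i j) k * y ^ k)"

lemma AstarR_has_derivative:
  assumes "i < M" "j < M" "\<bar>y\<bar> < R"
  shows "((\<lambda>y. AstarR A y i j) has_real_derivative dAstarR y i j) (at y)"
  using termdiffs_strong[of "\<lambda>k. A k i j" R y] A_summable_R[OF assms(1,2)] assms(3) R_gt_1
  by (simp add: AstarR_def[abs_def] dAstarR_def mult.commute)

lemma AstarR_tendsto:
  assumes "i < M" "j < M" "\<bar>y\<bar> < R" "X \<longlonglongrightarrow> y"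
  shows "(\<lambda>n. AstarR A (X n) i j) \<longlonglongrightarrow> AstarR A y i j"
  using DERIV_isCont[OF AstarR_has_derivative[OF assms(1-3)]] assms(4)
  by (rule isCont_tendsto_compose)

text \<open>Compactness plus uniqueness: every subsequence has a convergent subsequence, whose limit
  is a nonnegative normalised eigenvector, hence positive, hence equal to \<open>w\<close>.\<close>

lemma eigenvectors_tendsto:
  assumes y: "0 < y" "y < R" and X: "X \<longlonglongrightarrow> y" "\<And>n. 0 < X n" "\<And>n. X n \<le> R"
    and w: "\<And>i. i < M \<Longrightarrow> 0 < w i" "(\<Sum>i<M. w i) = 1"
      "\<And>i. i < M \<Longrightarrow> act y w i = Perron y * w i"
    and W: "\<And>n i. i < M \<Longrightarrow> 0 < W n i" "\<And>n. (\<Sum>i<M. W n i) = 1"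
      "\<And>n i. i < M \<Longrightarrow> (\<Sum>j<M. AstarR A (X n) i j * W n j) = Perron (X n) * W n i"
    and i: "i < M"
  shows "(\<lambda>n. W n i) \<longlonglongrightarrow> w i"
proof (rule LIMSEQ_subseq_principle)
  fix s :: "nat \<Rightarrow> nat" assume s: "strict_mono s"
  have "\<bar>W (s n) i\<bar> \<le> 1" if "i < M" for n i
  proof -
    have "W (s n) i \<le> (\<Sum>i<M. W (s n) i)" using W(1) that by (intro member_le_sum) (auto simp: less_imp_le)
    then show ?thesis using W(1)[OF that, of "s n"] W(2) by simp
  qed
  then obtain t l where t: "strict_mono (t::nat \<Rightarrow> nat)" and l: "\<And>i. i < M \<Longrightarrow> (\<lambda>n. W (s (t n)) i) \<longlonglongrightarrow> l i"
    using bounded_family_convergent_subseq[of M "\<lambda>n. W (s n)" 1] by blast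
  have Xst: "(\<lambda>n. X (s (t n))) \<longlonglongrightarrow> y"
    using LIMSEQ_subseq_LIMSEQ[OF LIMSEQ_subseq_LIMSEQ[OF X(1) s] t] by (simp add: o_def)
  have AW: "(\<lambda>n. \<Sum>j<M. AstarR A (X (s (t n))) i j * W (s (t n)) j) \<longlonglongrightarrow> act y l i"
    if "i < M" for i using that y by (intro tendsto_sum tendsto_mult AstarR_tendsto Xst l) auto
  define r where "r = (\<Sum>i<M. \<Sum>j<M. AstarR A y i j * l j)"
  \<comment> \<open>Summing the eigenvalue equation over the rows expresses the root through the
    normalised vector, so the roots converge along with the vectors.\<close>
  have "Perron (X n) = (\<Sum>i<M. \<Sum>j<M. AstarR A (X n) i j * W n j)" for n
    using W(2)[of n] by (simp add: W(3) flip: sum_distrib_left)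
  then have rlim: "(\<lambda>n. Perron (X (s (t n)))) \<longlonglongrightarrow> r"
    unfolding r_def using tendsto_sum[of "{..<M}", OF AW] by simp
  have leig: "act y l i = r * l i" if "i < M" for i
  proof (rule LIMSEQ_unique[OF AW[OF that]])
    show "(\<lambda>n. \<Sum>j<M. AstarR A (X (s (t n))) i j * W (s (t n)) j) \<longlonglongrightarrow> r * l i"
      using tendsto_mult[OF rlim l[OF that]] that by (simp add: W(3))
  qed
  have l0: "0 \<le> l i" if "i < M" for i
    using W(1)[OF that] by (intro tendsto_lowerbound[OF l[OF that]]) (auto simp: less_imp_le)
  have "(\<lambda>n. \<Sum>i<M. W (s (t n)) i) \<longlonglongrightarrow> (\<Sum>i<M. l i)" by (intro tendsto_sum l) auto
  then have lsum: "(\<Sum>i<M. l i) = 1" by (simp add: W(2) LIMSEQ_const_iff)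
  then obtain a where a: "a < M" "l a \<noteq> 0" by (metis lessThan_iff sum.neutral zero_neq_one)
  interpret irreducible_matrix M "AstarR A y" using y by (intro irreducible_AstarR) auto
  have lpos: "0 < l i" if "i < M" for i by (rule nonneg_eigenvector_pos[OF l0 a leig that])
  have "Perron y = r" using y by (intro Perron_eqI[OF _ _ lpos leig]) auto
  then obtain c where c: "\<forall>i<M. l i = c * w i"
    using eigenvector_unique[of w "Perron y" l] w leig by blast
  then have "(\<Sum>i<M. l i) = c" using w(2) by (simp flip: sum_distrib_left)
  then have "l i = w i" using lsum c i by simp
  then show "\<exists>t. strict_mono t \<and> (\<lambda>n. W (s (t n)) i) \<longlonglongrightarrow> w i" using t l[OF i] by auto
qed

text \<open>Pair the left eigenvector at \<open>y\<close> with the right eigenvector at a nearby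
  point \<open>y'\<close>: \<open>u (A(y') - A(y)) w' = (Perron y' - Perron y) * (u w')\<close>
  holds exactly. Only continuity of the right eigenvectors is then needed to pass to the
  limit.\<close>

lemma Perron_has_derivative:
  assumes y: "0 < y" "y < R"
    and u: "\<And>i. i < M \<Longrightarrow> 0 < u i" "\<And>j. j < M \<Longrightarrow> (\<Sum>i<M. u i * AstarR A y i j) = Perron y * u j"
    and w: "\<And>i. i < M \<Longrightarrow> 0 < w i" "\<And>i. i < M \<Longrightarrow> act y w i = Perron y * w i"
  shows "(Perron has_real_derivative
    (\<Sum>i<M. u i * (\<Sum>j<M. dAstarR y i j * w j)) / (\<Sum>i<M. u i * w i)) (at y)"
proof -
  define S where "S = (\<Sum>i<M. w i)"
  have S: "S > 0" unfolding S_def using w(1) M_pos by (intro sum_pos) auto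
  define w1 where "w1 i = w i / S" for i
  have w1: "\<And>i. i < M \<Longrightarrow> 0 < w1 i" "(\<Sum>i<M. w1 i) = 1"
      "\<And>i. i < M \<Longrightarrow> act y w1 i = Perron y * w1 i"
    using w S by (auto simp: w1_def simp flip: sum_divide_distrib) (simp add: S_def)
  have uw: "(\<Sum>i<M. u i * w i) > 0" using u w M_pos by (intro sum_pos) auto
  have uw1: "(\<Sum>i<M. u i * w1 i) > 0" using u w1 M_pos by (intro sum_pos) auto
  define D where "D = (\<Sum>i<M. u i * (\<Sum>j<M. dAstarR y i j * w1 j)) / (\<Sum>i<M. u i * w1 i)"
  have D_eq: "D = (\<Sum>i<M. u i * (\<Sum>j<M. dAstarR y i j * w j)) / (\<Sum>i<M. u i * w i)"
    unfolding D_def w1_def using S by (simp flip: sum_divide_distrib)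
  define q where "q = (\<lambda>y'. (Perron y' - Perron y) / (y' - y))"
  have "(q \<longlongrightarrow> D) (at y)"
    unfolding tendsto_at_iff_sequentially o_def
  proof (intro allI impI)
    fix X assume X0: "\<forall>n. X n \<in> UNIV - {y}" "X \<longlonglongrightarrow> y"
    have "\<forall>\<^sub>F n in sequentially. X n \<in> {0<..<R}"
      using y by (intro topological_tendstoD[OF X0(2)]) auto
    then obtain n0 where n0: "\<And>n. n \<ge> n0 \<Longrightarrow> X n \<in> {0<..<R}" by (auto simp: eventually_sequentially)
    define Y where "Y n = X (n + n0)" for n
    have Y: "0 < Y n" "Y n \<le> R" "Y n \<noteq> y" for n using n0[of "n + n0"] X0(1) unfolding Y_def by auto
    have Ylim: "Y \<longlonglongrightarrow> y" unfolding Y_def using X0(2) by (rule LIMSEQ_ignore_initial_segment)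
    have "\<exists>w. (\<forall>i<M. 0 < w i) \<and> (\<Sum>i<M. w i) = 1 \<and> (\<forall>i<M. (\<Sum>j<M. AstarR A (Y n) i j * w j) = Perron (Y n) * w i)" for n
      by (rule Perron_exists[OF Y(1,2)[of n]]) blast
    then obtain W where W: "\<And>n i. i < M \<Longrightarrow> 0 < W n i" "\<And>n. (\<Sum>i<M. W n i) = 1"
      "\<And>n i. i < M \<Longrightarrow> (\<Sum>j<M. AstarR A (Y n) i j * W n j) = Perron (Y n) * W n i" by metis
    have Wlim: "(\<lambda>n. W n i) \<longlonglongrightarrow> w1 i" if "i < M" for i
      by (rule eigenvectors_tendsto[OF y Ylim Y(1,2) w1 W that])
    have quot: "(\<lambda>n. (AstarR A (Y n) i j - AstarR A y i j) / (Y n - y)) \<longlonglongrightarrow> dAstarR y i j"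
      if "i < M" "j < M" for i j
    proof -
      have "((\<lambda>z. (AstarR A z i j - AstarR A y i j) / (z - y)) \<longlongrightarrow> dAstarR y i j) (at y)"
        using AstarR_has_derivative[OF that, of y] y by (simp add: has_field_derivative_iff)
      then show ?thesis using Y(3) Ylim unfolding tendsto_at_iff_sequentially o_def by auto
    qed
    define Q where "Q n = (\<Sum>i<M. u i * (\<Sum>j<M. (AstarR A (Y n) i j - AstarR A y i j) / (Y n - y) * W n j)) / (\<Sum>i<M. u i * W n i)" for n
    have "Q \<longlonglongrightarrow> D" unfolding Q_def D_def
      using uw1 by (intro tendsto_divide tendsto_sum tendsto_mult tendsto_const quot Wlim) auto
    moreover have "q (Y n) = Q n" for n
    proof -
      have pos: "(\<Sum>i<M. u i * W n i) > 0" using u W(1) M_pos by (intro sum_pos) auto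
      have "(\<Sum>i<M. u i * (\<Sum>j<M. (AstarR A (Y n) i j - AstarR A y i j) * W n j)) =
        (\<Sum>i<M. u i * (\<Sum>j<M. AstarR A (Y n) i j * W n j)) - (\<Sum>i<M. u i * (\<Sum>j<M. AstarR A y i j * W n j))"
        by (simp add: left_diff_distrib right_diff_distrib sum_subtractf)
      also have "(\<Sum>i<M. u i * (\<Sum>j<M. AstarR A y i j * W n j)) = Perron y * (\<Sum>i<M. u i * W n i)"
        by (rule left_subinvariant[OF u])
      also have "(\<Sum>i<M. u i * (\<Sum>j<M. AstarR A (Y n) i j * W n j)) = Perron (Y n) * (\<Sum>i<M. u i * W n i)"
        by (simp add: W(3) sum_distrib_left mult.left_commute)
      finally have "(\<Sum>i<M. u i * (\<Sum>j<M. (AstarR A (Y n) i j - AstarR A y i j) * W n j)) =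
        (Perron (Y n) - Perron y) * (\<Sum>i<M. u i * W n i)" by (simp add: left_diff_distrib)
      moreover have "Q n = (\<Sum>i<M. u i * (\<Sum>j<M. (AstarR A (Y n) i j - AstarR A y i j) * W n j)) / (Y n - y) / (\<Sum>i<M. u i * W n i)"
        unfolding Q_def by (simp flip: sum_divide_distrib)
      ultimately show ?thesis using pos by (simp add: q_def)
    qed
    ultimately have "(\<lambda>n. q (X (n + n0))) \<longlonglongrightarrow> D" by (simp add: Y_def)
    then show "(\<lambda>n. q (X n)) \<longlonglongrightarrow> D" by (rule LIMSEQ_offset)
  qed
  then show ?thesis unfolding D_eq[symmetric] q_def by (simp add: has_field_derivative_iff)
qed

text \<open>Log-convexity of the Perron root in \<open>ln y\<close>: geometric means of Lyapunov vectors are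
  Lyapunov vectors, by the weighted AM-GM inequality.\<close>

lemma interpolated_Lyapunov:
  assumes z: "0 < z0" "z0 \<le> R" and th: "0 < th" "th \<le> R" and c: "0 < c" and s: "0 \<le> s" "s \<le> 1"
    and t: "t = z0 powr (1 - s) * th powr s" "t \<le> R"
    and w0: "\<And>i. i < M \<Longrightarrow> 0 < w0 i" "\<And>i. i < M \<Longrightarrow> act z0 w0 i \<le> c * z0 * w0 i"
    and v: "\<And>i. i < M \<Longrightarrow> 0 < v i" "\<And>i. i < M \<Longrightarrow> act th v i \<le> th * v i"
    and i: "i < M"
  shows "(\<Sum>j<M. AstarR A t i j * (w0 j powr (1 - s) * v j powr s))
    \<le> c powr (1 - s) * t * (w0 i powr (1 - s) * v i powr s)"
proof -
  \<comment> \<open>\<open>K\<close> is the claimed bound, written as the geometric mean of the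
    right-hand sides of the two given inequalities.\<close>
  define K where "K = (c * z0 * w0 i) powr (1 - s) * (th * v i) powr s"
  have K: "K > 0" unfolding K_def using z th c w0(1)[OF i] v(1)[OF i] by simp
  have K_eq: "K = c powr (1 - s) * t * (w0 i powr (1 - s) * v i powr s)"
    unfolding K_def t(1) using z th c w0(1)[OF i] v(1)[OF i] by (simp add: powr_mult)
  have t0: "t > 0" unfolding t(1) using z th by simp
  \<comment> \<open>AM-GM is applied to ratios against those right-hand sides;
    \<open>\<alpha>\<close> and \<open>\<beta>\<close> undo the normalisation, so that the two
    bounds add up to \<open>K * (1 - s) + K * s\<close>.\<close>
  define \<alpha> where "\<alpha> = K * (1 - s) / (c * z0 * w0 i)"
  define \<beta> where "\<beta> = K * s / (th * v i)"
  have \<alpha>\<beta>: "0 \<le> \<alpha>" "0 \<le> \<beta>" using K s z th c w0(1)[OF i] v(1)[OF i] by (auto simp: \<alpha>_def \<beta>_def)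
  have term_le: "t ^ k * (w0 j powr (1 - s) * v j powr s) \<le> \<alpha> * (z0 ^ k * w0 j) + \<beta> * (th ^ k * v j)" if j: "j < M" for k j
  proof -
    define a where "a = z0 ^ k * w0 j / (c * z0 * w0 i)"
    define b where "b = th ^ k * v j / (th * v i)"
    have ab: "a > 0" "b > 0" unfolding a_def b_def
      using z th c w0(1)[OF i] v(1)[OF i] w0(1)[OF j] v(1)[OF j] by auto
    have "a powr (1 - s) * b powr s \<le> (1 - s) * a + s * b"
      using s ab by (intro Youngs_inequality_0) auto
    moreover have "a powr (1 - s) * b powr s = t ^ k * (w0 j powr (1 - s) * v j powr s) / K"
    proof -
      have "(z0 ^ k) powr (1 - s) * (th ^ k) powr s = t ^ k"
        unfolding t(1) power_mult_distrib using z th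
        by (simp add: powr_realpow[symmetric] powr_powr mult.commute)
      moreover have "a powr (1 - s) * b powr s = ((z0 ^ k) powr (1 - s) * (th ^ k) powr s) * (w0 j powr (1 - s) * v j powr s) / K"
        unfolding a_def b_def K_def using z th c w0(1)[OF i] v(1)[OF i] w0(1)[OF j] v(1)[OF j]
        by (simp add: powr_divide powr_mult)
      ultimately show ?thesis by simp
    qed
    ultimately have "t ^ k * (w0 j powr (1 - s) * v j powr s) / K \<le> (1 - s) * a + s * b" by simp
    then have "t ^ k * (w0 j powr (1 - s) * v j powr s) \<le> K * ((1 - s) * a + s * b)"
      using K by (simp add: pos_divide_le_eq mult.commute)
    also have "\<dots> = \<alpha> * (z0 ^ k * w0 j) + \<beta> * (th ^ k * v j)"
      by (simp add: a_def b_def \<alpha>_def \<beta>_def algebra_simps)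
    finally show ?thesis .
  qed
  have entry: "AstarR A t i j * (w0 j powr (1 - s) * v j powr s) \<le> \<alpha> * (AstarR A z0 i j * w0 j) + \<beta> * (AstarR A th i j * v j)"
    if j: "j < M" for j
  proof (rule sums_le)
    show "(\<lambda>k. (t ^ k * A k i j) * (w0 j powr (1 - s) * v j powr s)) sums (AstarR A t i j * (w0 j powr (1 - s) * v j powr s))"
      unfolding AstarR_def using summable_A[OF i j] t0 t(2) by (intro sums_mult2 summable_sums) auto
    show "(\<lambda>k. \<alpha> * ((z0 ^ k * A k i j) * w0 j) + \<beta> * ((th ^ k * A k i j) * v j)) sums
       (\<alpha> * (AstarR A z0 i j * w0 j) + \<beta> * (AstarR A th i j * v j))"
      unfolding AstarR_def using summable_A[OF i j] z th
      by (intro sums_add sums_mult sums_mult2 summable_sums) auto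
    show "(t ^ k * A k i j) * (w0 j powr (1 - s) * v j powr s) \<le> \<alpha> * ((z0 ^ k * A k i j) * w0 j) + \<beta> * ((th ^ k * A k i j) * v j)" for k
      using mult_right_mono[OF term_le[OF j, of k] A_nonneg[OF i j, of k]] by (simp add: algebra_simps)
  qed
  have "(\<Sum>j<M. AstarR A t i j * (w0 j powr (1 - s) * v j powr s))
    \<le> (\<Sum>j<M. \<alpha> * (AstarR A z0 i j * w0 j) + \<beta> * (AstarR A th i j * v j))"
    by (intro sum_mono entry) auto
  also have "\<dots> = \<alpha> * act z0 w0 i + \<beta> * act th v i"
    by (simp add: sum.distrib sum_distrib_left)
  also have "\<dots> \<le> \<alpha> * (c * z0 * w0 i) + \<beta> * (th * v i)"
    using \<alpha>\<beta> w0(2)[OF i] v(2)[OF i] by (intro add_mono mult_left_mono) auto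
  also have "\<dots> = K * (1 - s) + K * s"
    unfolding \<alpha>_def \<beta>_def using z th c w0(1)[OF i] v(1)[OF i] by simp
  also have "\<dots> = K" by (simp add: algebra_simps)
  finally show ?thesis unfolding K_eq .
qed

end

section \<open>Contraction between 1 and \<theta>, and the slope at \<theta>\<close>

locale tail_kernel = matrix_gf +
  fixes \<theta> :: real and \<mu> v :: "nat \<Rightarrow> real"
  assumes theta: "1 < \<theta>" "\<theta> < R"
    and stochastic: "\<And>i. i < M \<Longrightarrow> (\<Sum>j<M. AstarR A 1 i j) = 1"
    and Perron_1_deriv: "\<exists>d<1. (Perron has_real_derivative d) (at 1)"
    and mu_pos: "\<And>i. i < M \<Longrightarrow> 0 < \<mu> i" and v_pos: "\<And>i. i < M \<Longrightarrow> 0 < v i"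
    and mu_eig: "\<And>j. j < M \<Longrightarrow> (\<Sum>i<M. \<mu> i * AstarR A \<theta> i j) = \<theta> * \<mu> j"
    and v_eig: "\<And>i. i < M \<Longrightarrow> act \<theta> v i = \<theta> * v i"
    and mu_v: "(\<Sum>i<M. \<mu> i * v i) = 1"
begin

lemma Perron_1: "Perron 1 = 1"
  using R_gt_1 stochastic by (intro Perron_eqI[of 1 "\<lambda>_. 1"]) auto

lemma Perron_theta: "Perron \<theta> = \<theta>"
  using theta by (intro Perron_eqI[of _ v]) (auto simp: v_pos v_eig)

text \<open>Here the drift condition enters, in the form of a derivative below 1:
  \<open>Perron y - y\<close> vanishes at 1 and decreases there, so the Perron vector at a nearby
  \<open>z0 > 1\<close> contracts strictly.\<close>

lemma strict_Lyapunov_start: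
  obtains z0 w0 c where "1 < z0" "z0 < \<theta>" "0 < c" "c < 1" "\<And>i. i < M \<Longrightarrow> 0 < w0 i"
    "\<And>i. i < M \<Longrightarrow> act z0 w0 i \<le> c * z0 * w0 i"
proof -
  obtain d where d: "d < 1" "(Perron has_real_derivative d) (at 1)" using Perron_1_deriv by blast
  have "((\<lambda>y. Perron y - y) has_real_derivative d - 1) (at 1)"
    by (intro derivative_intros d)
  then obtain e where e: "e > 0" "\<And>h. 0 < h \<Longrightarrow> h < e \<Longrightarrow> Perron (1 + h) - (1 + h) < Perron 1 - 1"
    using DERIV_neg_dec_right[of "\<lambda>y. Perron y - y" "d - 1" 1] d(1) by auto
  define h where "h = min (e / 2) ((\<theta> - 1) / 2)"
  have h: "0 < h" "h < e" "1 + h < \<theta>" using e(1) theta unfolding h_def by (auto simp: min_def field_simps)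
  define z0 where "z0 = 1 + h"
  have z0: "1 < z0" "z0 < \<theta>" "Perron z0 < z0" using h e(2)[of h] Perron_1 by (auto simp: z0_def)
  obtain w0 where w0: "\<And>i. i < M \<Longrightarrow> 0 < w0 i"
    "\<And>i. i < M \<Longrightarrow> act z0 w0 i = Perron z0 * w0 i"
    by (rule Perron_exists[of z0]) (use z0 theta in \<open>auto simp del: lessThan_iff\<close>)
  \<comment> \<open>The maximum with 1/2 secures \<open>0 < c\<close>, as needed for the real powers
    of \<open>c\<close> below.\<close>
  define c where "c = max (Perron z0 / z0) (1/2)"
  show ?thesis
  proof (rule that[of z0 c w0])
    show "act z0 w0 i \<le> c * z0 * w0 i" if "i < M" for i
    proof -
      have "Perron z0 / z0 \<le> c" unfolding c_def by simp
      then have "Perron z0 \<le> c * z0" using z0 by (simp add: field_simps)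
      then show ?thesis using w0 that by (simp add: less_imp_le mult_right_mono)
    qed
  qed (use z0 w0 in \<open>auto simp: c_def\<close>)
qed

text \<open>Interpolate geometrically between the contracting vector at \<open>z0\<close> and the
  invariant vector \<open>v\<close> at \<theta>. The factor is \<open>c powr (1 - s)\<close>, at
  most \<open>1 - (1 - c) * (1 - s)\<close> by AM-GM, and \<open>1 - s\<close> is at least a
  multiple of \<theta> - t because ln x \<le> x - 1. Entries stay between the extreme entries
  \<open>m\<close> and \<open>W\<close> of the two vectors, which makes the bounds uniform in
  \<open>t\<close>.\<close>

lemma Lyapunov_vectors:
  obtains z0 \<kappa> m W where "1 < z0" "z0 < \<theta>" "0 < \<kappa>" "0 < m"
    "\<And>t. z0 \<le> t \<Longrightarrow> t < \<theta> \<Longrightarrow> \<exists>w. (\<forall>i<M. m \<le> w i \<and> w i \<le> W) \<and>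
       (\<forall>i<M. act t w i \<le> (1 - \<kappa> * (\<theta> - t)) * t * w i)"
proof -
  obtain z0 w0 c where z0: "1 < z0" "z0 < \<theta>" and c: "0 < c" "c < 1" and w0: "\<And>i. i < M \<Longrightarrow> 0 < w0 i"
    "\<And>i. i < M \<Longrightarrow> act z0 w0 i \<le> c * z0 * w0 i"
    by (rule strict_Lyapunov_start) blast
  define F where "F = w0 ` {..<M} \<union> v ` {..<M}"
  have F: "finite F" "F \<noteq> {}" "\<And>a. a \<in> F \<Longrightarrow> 0 < a" unfolding F_def using M_pos w0 v_pos by auto
  define m where "m = Min F"
  define W where "W = Max F"
  have m: "0 < m" unfolding m_def using F by (subst Min_gr_iff) auto
  have bounds: "m \<le> w0 i" "m \<le> v i" "w0 i \<le> W" "v i \<le> W" if "i < M" for i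
    unfolding m_def W_def using F(1) that by (auto simp: F_def)
  have W: "0 < W" using m bounds[OF M_pos] by linarith
  define \<Lambda> where "\<Lambda> = ln (\<theta> / z0)"
  have \<Lambda>: "\<Lambda> > 0" unfolding \<Lambda>_def using z0 by (auto intro!: ln_gt_zero)
  define \<kappa> where "\<kappa> = (1 - c) / (\<theta> * \<Lambda>)"
  have \<kappa>: "0 < \<kappa>" unfolding \<kappa>_def using c \<Lambda> theta by simp
  show ?thesis
  proof (rule that[OF z0 \<kappa> m, of W])
    fix t assume t: "z0 \<le> t" "t < \<theta>"
    \<comment> \<open>The relative position of \<open>ln t\<close> between \<open>ln z0\<close> and
      \<open>ln \<theta>\<close>.\<close>
    define s where "s = ln (t / z0) / \<Lambda>"
    have s1: "1 - s = ln (\<theta> / t) / \<Lambda>"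
      using \<Lambda> t z0 unfolding s_def \<Lambda>_def by (simp add: ln_div field_simps)
    have s: "0 \<le> s" "s \<le> 1"
    proof -
      show "0 \<le> s" unfolding s_def using \<Lambda> t z0 by (intro divide_nonneg_pos) auto
      have "0 \<le> 1 - s" unfolding s1 using \<Lambda> t z0 by (intro divide_nonneg_pos) auto
      then show "s \<le> 1" by simp
    qed
    have t_eq: "t = z0 powr (1 - s) * \<theta> powr s"
    proof -
      have "s * \<Lambda> = ln t - ln z0" unfolding s_def using \<Lambda> t z0 by (simp add: ln_div)
      then have "(1 - s) * ln z0 + s * ln \<theta> = ln t"
        unfolding \<Lambda>_def using z0 by (simp add: ln_div algebra_simps)
      then have "exp ((1 - s) * ln z0 + s * ln \<theta>) = t" using t z0 by simp
      then show ?thesis using z0 by (simp add: powr_def exp_add)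
    qed
    define w where "w i = w0 i powr (1 - s) * v i powr s" for i
    have cs: "c powr (1 - s) \<le> 1 - \<kappa> * (\<theta> - t)"
    proof -
      have "c powr (1 - s) * 1 powr s \<le> (1 - s) * c + s * 1"
        using s c by (intro Youngs_inequality_0) auto
      also have "\<dots> = 1 - (1 - c) * (1 - s)" by (simp add: algebra_simps)
      finally have 1: "c powr (1 - s) \<le> 1 - (1 - c) * (1 - s)" by simp
      have "ln (t / \<theta>) \<le> t / \<theta> - 1" using t z0 by (intro ln_le_minus_one) auto
      then have "(\<theta> - t) / \<theta> \<le> ln (\<theta> / t)" using t z0 by (simp add: ln_div field_simps)
      then have "(\<theta> - t) / \<theta> / \<Lambda> \<le> 1 - s" unfolding s1 using \<Lambda> by (intro divide_right_mono) auto
      then have "(1 - c) * ((\<theta> - t) / \<theta> / \<Lambda>) \<le> (1 - c) * (1 - s)" using c by (intro mult_left_mono) auto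
      then show ?thesis using 1 unfolding \<kappa>_def by simp
    qed
    show "\<exists>w. (\<forall>i<M. m \<le> w i \<and> w i \<le> W) \<and>
       (\<forall>i<M. act t w i \<le> (1 - \<kappa> * (\<theta> - t)) * t * w i)"
    proof (intro exI[of _ w] conjI allI impI)
      fix i assume i: "i < M"
      have "m powr (1 - s) * m powr s \<le> w i" unfolding w_def
        using m bounds[OF i] s by (intro mult_mono powr_mono2) auto
      then show "m \<le> w i" using m by (simp flip: powr_add)
      have "w i \<le> W powr (1 - s) * W powr s" unfolding w_def
        using bounds[OF i] s w0(1)[OF i] v_pos[OF i] by (intro mult_mono powr_mono2) auto
      then show "w i \<le> W" using W by (simp flip: powr_add)
      have "act t w i \<le> c powr (1 - s) * t * w i"
        unfolding w_def using z0 t theta c s w0 v_pos v_eig i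
        by (intro interpolated_Lyapunov[OF _ _ _ _ _ _ _ t_eq]) auto
      also have "\<dots> \<le> (1 - \<kappa> * (\<theta> - t)) * t * w i"
        using cs t z0 \<open>m \<le> w i\<close> m by (intro mult_right_mono) auto
      finally show "act t w i \<le> (1 - \<kappa> * (\<theta> - t)) * t * w i" .
    qed
  qed
qed

text \<open>Stated as a pairing rather than as a derivative because the residue computation ends in
  this sum.\<close>

definition dd :: real where "dd = (\<Sum>i<M. \<mu> i * (\<Sum>j<M. dAstarR \<theta> i j * v j))"

lemma Perron_deriv_theta: "(Perron has_real_derivative dd) (at \<theta>)"
proof -
  have "(Perron has_real_derivative
    (\<Sum>i<M. \<mu> i * (\<Sum>j<M. dAstarR \<theta> i j * v j)) / (\<Sum>i<M. \<mu> i * v i)) (at \<theta>)"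
    using theta by (intro Perron_has_derivative) (auto simp: Perron_theta mu_pos v_pos mu_eig v_eig)
  then show ?thesis by (simp add: mu_v dd_def)
qed

text \<open>The contraction rate is linear in \<theta> - t, so
  \<open>Perron t \<le> t - \<kappa> * (\<theta> - t)\<close>, and the difference quotients from the
  left are at least \<open>1 + \<kappa>\<close>.\<close>

lemma dd_gt_1: "1 < dd"
proof -
  obtain z0 \<kappa> m W where L: "1 < z0" "z0 < \<theta>" "0 < \<kappa>" "0 < m"
    "\<And>t. z0 \<le> t \<Longrightarrow> t < \<theta> \<Longrightarrow> \<exists>w. (\<forall>i<M. m \<le> w i \<and> w i \<le> W) \<and>
       (\<forall>i<M. act t w i \<le> (1 - \<kappa> * (\<theta> - t)) * t * w i)"
    by (rule Lyapunov_vectors) blast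
  have le: "1 + \<kappa> \<le> (Perron t - Perron \<theta>) / (t - \<theta>)" if t: "z0 \<le> t" "t < \<theta>" for t
  proof -
    obtain w where w: "\<And>i. i < M \<Longrightarrow> m \<le> w i"
      "\<And>i. i < M \<Longrightarrow> act t w i \<le> (1 - \<kappa> * (\<theta> - t)) * t * w i" using L(5)[OF t] by blast
    have "Perron t \<le> (1 - \<kappa> * (\<theta> - t)) * t"
      using t L theta by (intro Perron_le[of _ w] w(2)) (auto intro: less_le_trans[OF L(4) w(1)])
    moreover have "\<kappa> * (\<theta> - t) * 1 \<le> \<kappa> * (\<theta> - t) * t" using t L by (intro mult_left_mono) auto
    ultimately have "(1 + \<kappa>) * (\<theta> - t) \<le> \<theta> - Perron t" by (simp add: algebra_simps)
    then have "1 + \<kappa> \<le> (\<theta> - Perron t) / (\<theta> - t)" using t by (simp add: pos_le_divide_eq)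
    also have "\<dots> = (Perron t - Perron \<theta>) / (t - \<theta>)"
      by (metis Perron_theta minus_diff_eq minus_divide_divide)
    finally show ?thesis .
  qed
  have "((\<lambda>t. (Perron t - Perron \<theta>) / (t - \<theta>)) \<longlongrightarrow> dd) (at \<theta>)"
    using Perron_deriv_theta by (simp add: has_field_derivative_iff)
  then have lim: "((\<lambda>t. (Perron t - Perron \<theta>) / (t - \<theta>)) \<longlongrightarrow> dd) (at_left \<theta>)"
    by (rule tendsto_mono[rotated]) (simp add: at_le)
  have "\<forall>\<^sub>F t in at_left \<theta>. t \<in> {z0<..<\<theta>}"
    by (rule eventually_at_leftI[OF _ L(2)]) auto
  then have "\<forall>\<^sub>F t in at_left \<theta>. 1 + \<kappa> \<le> (Perron t - Perron \<theta>) / (t - \<theta>)"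
    by eventually_elim (use le in auto)
  then have "1 + \<kappa> \<le> dd" by (intro tendsto_lowerbound[OF lim]) auto
  then show ?thesis using L(3) by simp
qed

end

section \<open>Singularity analysis with simple poles on the circle of convergence\<close>

lemma power_series_coeff_unique:
  fixes a b :: "nat \<Rightarrow> complex"
  assumes "0 < r" "\<And>z. norm z < r \<Longrightarrow> (\<lambda>n. a n * z ^ n) sums f z" "\<And>z. norm z < r \<Longrightarrow> (\<lambda>n. b n * z ^ n) sums f z"
  shows "a = b"
proof -
  have ev: "\<forall>\<^sub>F z in nhds 0. z \<in> ball 0 r" using assms(1) by (intro eventually_nhds_in_open) auto
  have "f has_fps_expansion Abs_fps a"
    by (rule has_fps_expansionI) (use ev in \<open>eventually_elim, simp add: assms(2)\<close>)
  moreover have "f has_fps_expansion Abs_fps b"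
    by (rule has_fps_expansionI) (use ev in \<open>eventually_elim, simp add: assms(3)\<close>)
  ultimately have "Abs_fps a = Abs_fps b" by (rule fps_expansion_unique_complex)
  then show ?thesis by (simp add: fps_eq_iff fun_eq_iff)
qed

lemma removable_singularities_lim:
  fixes f :: "complex \<Rightarrow> complex"
  assumes "finite Z" "open S" "Z \<subseteq> S" "f holomorphic_on (S - Z)"
    and lim: "\<And>z. z \<in> Z \<Longrightarrow> ((\<lambda>w. (w - z) * f w) \<longlongrightarrow> 0) (at z)"
  shows "\<exists>g. g holomorphic_on S \<and> (\<forall>z\<in>S - Z. g z = f z)"
proof (rule removable_singularities)
  fix z assume z: "z \<in> Z"
  define S' where "S' = S - (Z - {z})"
  have op: "open S'" unfolding S'_def using assms(1,2) by (intro open_Diff finite_imp_closed) auto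
  have "z \<in> interior S'" using op z assms(3) unfolding S'_def by (simp add: interior_open) blast
  moreover have "f holomorphic_on (S' - {z})"
    by (rule holomorphic_on_subset[OF assms(4)]) (auto simp: S'_def)
  ultimately obtain B where "\<forall>\<^sub>F w in at z. norm (f w) \<le> B"
    using holomorphic_on_extend_lim[of f S' z] holomorphic_on_extend_bounded[of f S' z] lim[OF z] by blast
  then show "f \<in> O[at z](\<lambda>_. 1)" by (intro bigoI[of _ B]) auto
qed (use assms in \<open>auto simp: interior_open\<close>)

lemma radial_at_circle:
  fixes \<zeta> :: complex
  assumes "\<zeta> \<noteq> 0"
  shows "filterlim (\<lambda>t. complex_of_real t * \<zeta>) (at \<zeta>) (at_left 1)"
    and "\<forall>\<^sub>F t in at_left 1. 0 < t \<and> t < (1::real)"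
proof -
  show ev: "\<forall>\<^sub>F t in at_left 1. 0 < t \<and> t < (1::real)"
    by (rule eventually_at_leftI[of 0]) auto
  have "((\<lambda>t. complex_of_real t * \<zeta>) \<longlongrightarrow> complex_of_real 1 * \<zeta>) (at_left 1)"
    by (intro tendsto_intros)
  moreover have "\<forall>\<^sub>F t in at_left 1. complex_of_real t * \<zeta> \<noteq> \<zeta>"
    using ev by eventually_elim (use assms in auto)
  ultimately show "filterlim (\<lambda>t. complex_of_real t * \<zeta>) (at \<zeta>) (at_left 1)"
    by (simp add: filterlim_at)
qed

text \<open>Growth is controlled only inside the disc. That suffices, since a pole tends to infinity
  along every approach, the radial one included.\<close>

lemma not_pole_if_radially_bounded:
  fixes g :: "complex \<Rightarrow> complex"
  assumes "\<zeta> \<noteq> 0" and bd: "\<forall>\<^sub>F t in at_left 1. norm (g (complex_of_real t * \<zeta>)) \<le> C"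
  shows "\<not> is_pole g \<zeta>"
proof
  assume "is_pole g \<zeta>"
  then have "filterlim (\<lambda>t. g (complex_of_real t * \<zeta>)) at_infinity (at_left 1)"
    unfolding is_pole_def using radial_at_circle(1)[OF assms(1)] by (rule filterlim_compose)
  then have "\<forall>\<^sub>F t in at_left 1. max C 0 + 1 \<le> norm (g (complex_of_real t * \<zeta>))"
    by (auto simp: filterlim_at_infinity[of 0])
  with bd have "\<forall>\<^sub>F t in at_left (1::real). False" by eventually_elim auto
  then show False by simp
qed

text \<open>A power series that continues to a quotient \<open>N / D\<close> beyond its circle of convergence and grows
  at most like \<open>1 / (\<rho> - |z|)\<close> has only simple poles on the circle. Subtracting their principal parts
  leaves a function holomorphic in a larger disc, whose coefficients decay faster.\<close>

lemma simple_pole_coefficient_asymptotics: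
  fixes a :: "nat \<Rightarrow> complex" and f D N :: "complex \<Rightarrow> complex"
  assumes \<rho>: "0 < \<rho>" "\<rho> < R"
    and f: "\<And>z. norm z < \<rho> \<Longrightarrow> (\<lambda>n. a n * z ^ n) sums f z"
    and DN: "D holomorphic_on ball 0 R" "N holomorphic_on ball 0 R"
    and eq: "\<And>z. norm z < \<rho> \<Longrightarrow> f z * D z = N z"
    and D0: "norm \<xi> < R" "D \<xi> \<noteq> 0"
    and growth: "\<And>z. r0 \<le> norm z \<Longrightarrow> norm z < \<rho> \<Longrightarrow> norm (f z) \<le> C / (\<rho> - norm z)" "r0 < \<rho>"
  obtains Z L r C' where "finite Z" "\<And>\<zeta>. \<zeta> \<in> Z \<Longrightarrow> norm \<zeta> = \<rho>" "\<rho> < r"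
    "\<And>\<zeta>. norm \<zeta> = \<rho> \<Longrightarrow> ((\<lambda>t. (complex_of_real t * \<zeta> - \<zeta>) * f (complex_of_real t * \<zeta>)) \<longlongrightarrow> L \<zeta>) (at_left 1)"
    "\<And>\<zeta>. norm \<zeta> = \<rho> \<Longrightarrow> \<zeta> \<notin> Z \<Longrightarrow> L \<zeta> = 0"
    "\<And>k. norm (a k + (\<Sum>\<zeta>\<in>Z. L \<zeta> / \<zeta> ^ Suc k)) \<le> C' / r ^ k"
proof -
  \<comment> \<open>A closed disc strictly inside \<open>ball 0 R\<close>: there \<open>D\<close>,
    which is not identically zero because of \<open>\<xi>\<close>, has finitely many zeros.\<close>
  define R1 where "R1 = (\<rho> + R) / 2"
  have R1: "\<rho> < R1" "R1 < R" using \<rho> by (auto simp: R1_def)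
  define Z0 where "Z0 = {z \<in> cball 0 R1. D z = 0}"
  have finZ0: "finite Z0"
  proof (cases "D constant_on ball 0 R")
    case True
    then have "D z = D \<xi>" if "z \<in> ball 0 R" for z
      using that D0(1) unfolding constant_on_def by auto
    then have "Z0 = {}" unfolding Z0_def using D0(2) R1 by auto
    then show ?thesis by simp
  next
    case False
    then show ?thesis unfolding Z0_def using DN(1) R1
      by (intro holomorphic_compact_finite_zeros) auto
  qed
  define Z where "Z = {z \<in> Z0. norm z = \<rho>}"
  have finZ: "finite Z" unfolding Z_def using finZ0 by auto
  \<comment> \<open>\<open>R2\<close> and, below, \<open>r1\<close> bound an annulus in which all
    zeros of \<open>D\<close> have modulus \<open>\<rho>\<close>. The inserted elements keep the two
    sets nonempty.\<close>
  define F1 where "F1 = insert R1 (norm ` {z \<in> Z0. norm z > \<rho>})"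
  define R2 where "R2 = Min F1"
  have R2: "\<rho> < R2" "R2 \<le> R1" unfolding R2_def F1_def using finZ0 R1
    by (auto simp: Min_gr_iff)
  have R2z: "D z \<noteq> 0" if "\<rho> < norm z" "norm z < R2" for z
  proof
    assume "D z = 0"
    then have "z \<in> {z \<in> Z0. norm z > \<rho>}" using that R2 by (auto simp: Z0_def)
    then have "R2 \<le> norm z" unfolding R2_def F1_def using finZ0 by (intro Min_le) auto
    then show False using that by simp
  qed
  define F2 where "F2 = insert 0 (norm ` {z \<in> Z0. norm z < \<rho>})"
  define r1 where "r1 = Max F2"
  have r1: "r1 < \<rho>" unfolding r1_def F2_def using finZ0 \<rho> by (subst Max_less_iff) auto
  have r1z: "D z \<noteq> 0" if "r1 < norm z" "norm z < \<rho>" for z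
  proof
    assume "D z = 0"
    then have "z \<in> {z \<in> Z0. norm z < \<rho>}" using that R1 by (auto simp: Z0_def)
    then have "norm z \<le> r1" unfolding r1_def F2_def using finZ0 by (intro Max_ge) auto
    then show False using that by simp
  qed
  have Dnz: "D z \<noteq> 0" if "r1 < norm z" "norm z < R2" "z \<notin> Z" for z
  proof (cases "norm z = \<rho>")
    case True
    then show ?thesis using that R1 by (auto simp: Z_def Z0_def)
  next
    case False
    then show ?thesis using that R2z r1z by (cases "norm z < \<rho>") auto
  qed
  define An where "An = {z :: complex. r1 < norm z \<and> norm z < R2}"
  have opAn: "open An" unfolding An_def
    by (intro open_Collect_conj open_Collect_less continuous_intros)
  have An_sub: "An \<subseteq> ball 0 R" unfolding An_def using R1 R2 by auto
  \<comment> \<open>Deep inside the disc \<open>D\<close> may vanish, so \<open>f\<close> itself is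
    used there; the quotient continues it across the circle, and the two agree inside the disc on
    the annulus.\<close>
  define F where "F z = (if norm z < \<rho> then f z else N z / D z)" for z
  have F_eq: "F z = N z / D z" if "z \<in> An - Z" for z
  proof (cases "norm z < \<rho>")
    case True
    then show ?thesis using eq[of z] Dnz[of z] that unfolding F_def An_def by (simp add: field_simps)
  qed (simp add: F_def)
  have Zin: "Z \<subseteq> An" "Z \<subseteq> ball 0 R2" unfolding Z_def An_def using r1 R2 by auto
  have Z0': "0 \<notin> Z" unfolding Z_def using \<rho> by auto
  have opAnZ: "open (An - Z)" using opAn finZ by (intro open_Diff finite_imp_closed)
  have holF: "F holomorphic_on (ball 0 R2 - Z)"
  proof -
    have "f holomorphic_on ball 0 \<rho>"
      by (rule power_series_holomorphic[of _ _ a]) (use f in auto)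
    then have "F holomorphic_on ball 0 \<rho>" by (rule holomorphic_transform) (auto simp: F_def)
    moreover have "(\<lambda>z. N z / D z) holomorphic_on (An - Z)"
      using DN An_sub Dnz by (intro holomorphic_intros holomorphic_on_subset[OF DN(1)] holomorphic_on_subset[OF DN(2)])
        (auto simp: An_def)
    then have "F holomorphic_on (An - Z)" by (rule holomorphic_transform) (use F_eq in auto)
    ultimately have "F holomorphic_on (ball 0 \<rho> \<union> (An - Z))"
      using opAnZ by (intro holomorphic_on_Un) auto
    then show ?thesis by (rule holomorphic_on_subset) (use r1 in \<open>auto simp: An_def\<close>)
  qed
  have radial_in: "\<forall>\<^sub>F t in at_left 1. max r0 0 \<le> norm (complex_of_real t * \<zeta>) \<and> norm (complex_of_real t * \<zeta>) < \<rho>"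
    if "norm \<zeta> = \<rho>" for \<zeta>
  proof (rule eventually_at_leftI[of "max (r0 / \<rho>) 0"])
    fix t assume "t \<in> {max (r0 / \<rho>) 0<..<1}"
    then show "max r0 0 \<le> norm (complex_of_real t * \<zeta>) \<and> norm (complex_of_real t * \<zeta>) < \<rho>"
      using that \<rho> by (auto simp: norm_mult field_simps)
  qed (use growth(2) \<rho> in auto)
  have lim: "\<exists>l. ((\<lambda>z. (z - \<zeta>) * F z) \<longlongrightarrow> l) (at \<zeta>)" if \<zeta>: "\<zeta> \<in> Z" for \<zeta>
  proof -
    have n\<zeta>: "norm \<zeta> = \<rho>" "\<zeta> \<noteq> 0" using \<zeta> \<rho> unfolding Z_def by auto
    have an: "N analytic_on {\<zeta>}" "D analytic_on {\<zeta>}"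
      using DN n\<zeta> \<rho> by (auto simp: analytic_at intro: exI[of _ "ball 0 R"])
    have an': "(\<lambda>z. z - \<zeta>) analytic_on {\<zeta>}" by (intro analytic_intros)
    \<comment> \<open>On the radius through \<open>\<zeta>\<close> the factor has modulus
      \<open>\<rho> - norm z\<close>, which cancels the growth bound.\<close>
    define q where "q = (\<lambda>z. (z - \<zeta>) * (N z / D z))"
    have ne: "not_essential q \<zeta>" unfolding q_def
      by (intro not_essential_times not_essential_divide isolated_singularity_at_divide
          not_essential_analytic isolated_singularity_at_analytic an an')
    have ev: "\<forall>\<^sub>F z in at \<zeta>. z \<in> An - Z"
    proof -
      have "\<forall>\<^sub>F z in at \<zeta>. z \<in> (An - (Z - {\<zeta>})) - {\<zeta>}"
        using \<zeta> Zin finZ opAn by (intro eventually_at_in_open open_Diff finite_imp_closed) auto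
      then show ?thesis by eventually_elim auto
    qed
    then have qF: "\<forall>\<^sub>F z in at \<zeta>. q z = (z - \<zeta>) * F z"
      by eventually_elim (simp add: q_def F_eq)
    have "\<forall>\<^sub>F t in at_left 1. norm (q (complex_of_real t * \<zeta>)) \<le> \<bar>C\<bar>"
      using eventually_compose_filterlim[OF qF radial_at_circle(1)[OF n\<zeta>(2)]] radial_in[OF n\<zeta>(1)] radial_at_circle(2)[OF n\<zeta>(2)]
    proof eventually_elim
      case (elim t)
      define z where "z = complex_of_real t * \<zeta>"
      have nz: "norm z = t * \<rho>" "t < 1" using elim n\<zeta> by (auto simp: z_def norm_mult)
      have "z - \<zeta> = complex_of_real (t - 1) * \<zeta>" by (simp add: z_def algebra_simps)
      then have "norm (z - \<zeta>) = \<bar>t - 1\<bar> * \<rho>" using n\<zeta> by (simp only: norm_mult norm_of_real)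
      then have d: "norm (z - \<zeta>) = \<rho> - norm z" using nz by (simp add: algebra_simps)
      have "norm (q z) = norm (z - \<zeta>) * norm (f z)" using elim unfolding z_def[symmetric] by (simp add: F_def norm_mult)
      also have "\<dots> \<le> (\<rho> - norm z) * (C / (\<rho> - norm z))" unfolding d
        using growth(1)[of z] elim unfolding z_def[symmetric] by (intro mult_left_mono) auto
      also have "\<dots> \<le> \<bar>C\<bar>" using elim unfolding z_def[symmetric] by simp
      finally show ?case unfolding z_def .
    qed
    then have "\<not> is_pole q \<zeta>" by (rule not_pole_if_radially_bounded[OF n\<zeta>(2)])
    then obtain l where "(q \<longlongrightarrow> l) (at \<zeta>)" using ne unfolding not_essential_def by blast
    then show ?thesis using tendsto_cong[OF qF] by blast
  qed
  \<comment> \<open>Off \<open>Z\<close> the value 0 is the right limit, as \<open>F\<close> is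
    continuous at such points of the circle.\<close>
  define L where "L \<zeta> = (if \<zeta> \<in> Z then SOME l. ((\<lambda>z. (z - \<zeta>) * F z) \<longlongrightarrow> l) (at \<zeta>) else 0)" for \<zeta>
  have L: "((\<lambda>z. (z - \<zeta>) * F z) \<longlongrightarrow> L \<zeta>) (at \<zeta>)" if "norm \<zeta> = \<rho>" for \<zeta>
  proof (cases "\<zeta> \<in> Z")
    case True
    then show ?thesis using someI_ex[OF lim[OF True]] by (simp add: L_def)
  next
    case False
    have "isCont F \<zeta>"
      using holomorphic_on_imp_continuous_on[OF holF] False that R2 finZ
      by (subst (asm) continuous_on_eq_continuous_at) (auto intro!: open_Diff finite_imp_closed)
    then have "((\<lambda>z. (z - \<zeta>) * F z) \<longlongrightarrow> (\<zeta> - \<zeta>) * F \<zeta>) (at \<zeta>)"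
      unfolding isCont_def by (intro tendsto_intros)
    then show ?thesis using False by (simp add: L_def)
  qed
  define G where "G z = F z - (\<Sum>\<zeta>\<in>Z. L \<zeta> / (z - \<zeta>))" for z
  have "\<exists>H. H holomorphic_on ball 0 R2 \<and> (\<forall>z\<in>ball 0 R2 - Z. H z = G z)"
  proof (rule removable_singularities_lim[OF finZ _ Zin(2)])
    show "G holomorphic_on ball 0 R2 - Z" unfolding G_def
      by (intro holomorphic_intros holF) auto
    fix \<zeta> assume \<zeta>: "\<zeta> \<in> Z"
    then have n\<zeta>: "norm \<zeta> = \<rho>" by (auto simp: Z_def)
    have *: "((\<lambda>z. (z - \<zeta>) * (\<Sum>\<eta>\<in>Z - {\<zeta>}. L \<eta> / (z - \<eta>))) \<longlongrightarrow> (\<zeta> - \<zeta>) * (\<Sum>\<eta>\<in>Z - {\<zeta>}. L \<eta> / (\<zeta> - \<eta>))) (at \<zeta>)"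
      by (intro tendsto_intros) auto
    have "((\<lambda>z. (z - \<zeta>) * F z - L \<zeta> - (z - \<zeta>) * (\<Sum>\<eta>\<in>Z - {\<zeta>}. L \<eta> / (z - \<eta>))) \<longlongrightarrow> L \<zeta> - L \<zeta> - 0) (at \<zeta>)"
      using * by (intro tendsto_diff L n\<zeta> tendsto_const) auto
    moreover have "\<forall>\<^sub>F z in at \<zeta>. (z - \<zeta>) * F z - L \<zeta> - (z - \<zeta>) * (\<Sum>\<eta>\<in>Z - {\<zeta>}. L \<eta> / (z - \<eta>)) = (z - \<zeta>) * G z"
    proof -
      have "\<forall>\<^sub>F z in at \<zeta>. z \<noteq> \<zeta>" by (simp add: eventually_at_filter)
      then show ?thesis
        by eventually_elim (simp add: G_def sum.remove[OF finZ \<zeta>] algebra_simps, simp add: field_simps)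
    qed
    ultimately show "((\<lambda>z. (z - \<zeta>) * G z) \<longlongrightarrow> 0) (at \<zeta>)"
      by (auto intro: Lim_transform_eventually)
  qed auto
  then obtain H where H: "H holomorphic_on ball 0 R2" "\<And>z. z \<in> ball 0 R2 - Z \<Longrightarrow> H z = G z" by blast
  define h where "h n = (deriv ^^ n) H 0 / fact n" for n
  have hsums: "(\<lambda>n. h n * z ^ n) sums H z" if "norm z < R2" for z
    using holomorphic_power_series[OF H(1), of z] that by (simp add: h_def)
  have "(\<lambda>n. (a n + (\<Sum>\<zeta>\<in>Z. L \<zeta> / \<zeta> ^ Suc n)) * z ^ n) sums H z" if z: "norm z < \<rho>" for z
  proof -
    \<comment> \<open>The expansion of \<open>L \<zeta> / (z - \<zeta>)\<close> at 0 has
      coefficients \<open>- L \<zeta> / \<zeta> ^ Suc n\<close>, whence the plus sign in the final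
      estimate.\<close>
    have pole: "(\<lambda>n. L \<zeta> / \<zeta> ^ Suc n * z ^ n) sums (- (L \<zeta> / (z - \<zeta>)))" if "\<zeta> \<in> Z" for \<zeta>
    proof -
      have n\<zeta>: "norm \<zeta> = \<rho>" "\<zeta> \<noteq> 0" using that \<rho> by (auto simp: Z_def)
      have "norm (z / \<zeta>) < 1" using n\<zeta> z \<rho> by (simp add: norm_divide)
      then have "(\<lambda>n. L \<zeta> / \<zeta> * (z / \<zeta>) ^ n) sums (L \<zeta> / \<zeta> * (1 / (1 - z / \<zeta>)))"
        by (intro sums_mult geometric_sums)
      moreover have "L \<zeta> / \<zeta> * (1 / (1 - z / \<zeta>)) = - (L \<zeta> / (z - \<zeta>))"
      proof -
        have "z \<noteq> \<zeta>" using z n\<zeta> by auto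
        then show ?thesis using n\<zeta> by (simp add: field_simps)
      qed
      moreover have "L \<zeta> / \<zeta> * (z / \<zeta>) ^ n = L \<zeta> / \<zeta> ^ Suc n * z ^ n" for n by (simp add: power_divide)
      ultimately show ?thesis by simp
    qed
    have "(\<lambda>n. a n * z ^ n + (\<Sum>\<zeta>\<in>Z. L \<zeta> / \<zeta> ^ Suc n * z ^ n)) sums (f z + (\<Sum>\<zeta>\<in>Z. - (L \<zeta> / (z - \<zeta>))))"
      by (intro sums_add f z sums_sum pole)
    moreover have "f z + (\<Sum>\<zeta>\<in>Z. - (L \<zeta> / (z - \<zeta>))) = H z"
    proof -
      have "z \<notin> Z" "norm z < R2" using z R2 by (auto simp: Z_def)
      then show ?thesis using H(2)[of z] z by (simp add: G_def F_def sum_negf)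
    qed
    ultimately show ?thesis by (simp add: distrib_right sum_distrib_right)
  qed
  then have coeff: "(\<lambda>n. a n + (\<Sum>\<zeta>\<in>Z. L \<zeta> / \<zeta> ^ Suc n)) = h"
    using hsums R2 \<rho>(1) by (intro power_series_coeff_unique[of \<rho> _ H]) auto
  define r where "r = (\<rho> + R2) / 2"
  have r: "\<rho> < r" "r < R2" using R2 by (auto simp: r_def)
  have "summable (\<lambda>n. h n * complex_of_real r ^ n)"
    using hsums[of "complex_of_real r"] r \<rho> by (auto dest: sums_summable)
  then have "Bseq (\<lambda>n. h n * complex_of_real r ^ n)"
    by (intro convergent_imp_Bseq summable_LIMSEQ_zero[THEN convergentI])
  then obtain C' where C': "\<And>n. norm (h n * complex_of_real r ^ n) \<le> C'" by (auto simp: Bseq_def)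
  show ?thesis
  proof (rule that[of Z r L C'])
    fix k
    show "norm (a k + (\<Sum>\<zeta>\<in>Z. L \<zeta> / \<zeta> ^ Suc k)) \<le> C' / r ^ k"
      using C'[of k] r \<rho> fun_cong[OF coeff, of k] by (simp add: norm_mult norm_power pos_le_divide_eq)
  next
    fix \<zeta> :: complex assume n\<zeta>: "norm \<zeta> = \<rho>"
    have "((\<lambda>t. (complex_of_real t * \<zeta> - \<zeta>) * F (complex_of_real t * \<zeta>)) \<longlongrightarrow> L \<zeta>) (at_left 1)"
      using L[OF n\<zeta>] radial_at_circle(1)[of \<zeta>] n\<zeta> \<rho> by (auto intro: filterlim_compose)
    moreover have "\<forall>\<^sub>F t in at_left 1. (complex_of_real t * \<zeta> - \<zeta>) * F (complex_of_real t * \<zeta>) = (complex_of_real t * \<zeta> - \<zeta>) * f (complex_of_real t * \<zeta>)"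
      using radial_in[OF n\<zeta>] by eventually_elim (simp add: F_def)
    ultimately show "((\<lambda>t. (complex_of_real t * \<zeta> - \<zeta>) * f (complex_of_real t * \<zeta>)) \<longlongrightarrow> L \<zeta>) (at_left 1)"
      by (rule Lim_transform_eventually)
  qed (use finZ r in \<open>auto simp: Z_def L_def\<close>)
qed

section \<open>The level process and its generating function\<close>

lemma sum_shifted_index:
  fixes f :: "nat \<Rightarrow> 'a :: comm_monoid_add"
  assumes "1 \<le> l"
  shows "(\<Sum>k\<le>K. if l \<le> k + 1 then f (k + 1 - l) else 0) = (\<Sum>n<K + 2 - l. f n)"
proof (induction K)
  case 0
  then show ?case using assms by (cases "l = 1") auto
next
  case (Suc K)
  show ?case
  proof (cases "l \<le> Suc K + 1")
    case True
    then have "Suc K + 2 - l = Suc (Suc K + 1 - l)" by simp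
    moreover have "K + 2 - l = Suc K + 1 - l" by simp
    ultimately show ?thesis using Suc True by simp
  next
    case False
    then show ?thesis using Suc by simp
  qed
qed

text \<open>\<open>y k\<close> is the stationary mass of level \<open>k \<ge> 1\<close> and \<open>b k\<close> the flow from level 0 into it;
  both are set to 0 at \<open>k = 0\<close>.\<close>

locale level_process = tail_kernel +
  fixes y b :: "nat \<Rightarrow> nat \<Rightarrow> real"
  assumes y_nonneg: "\<And>k j. j < M \<Longrightarrow> 0 \<le> y k j"
    and y_0: "\<And>j. j < M \<Longrightarrow> y 0 j = 0"
    and y_summable: "\<And>j. j < M \<Longrightarrow> summable (\<lambda>k. y k j)"
    and b_nonneg: "\<And>k j. j < M \<Longrightarrow> 0 \<le> b k j"
    and b_0: "\<And>j. j < M \<Longrightarrow> b 0 j = 0"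
    and b_summable_R: "\<And>j. j < M \<Longrightarrow> summable (\<lambda>k. R ^ k * b k j)"
    and y_eq: "\<And>k j. 1 \<le> k \<Longrightarrow> j < M \<Longrightarrow>
      y k j = b k j + (\<Sum>l\<le>k + 1. \<Sum>i<M. y l i * A (k + 1 - l) i j)"
begin

text \<open>One-step expectation of \<open>h\<close> from \<open>(l, i)\<close>, with targets above
  level \<open>K\<close> discarded. For \<open>h\<close> vanishing at level 0 it is a truncation of
  the kernel killed there.\<close>

definition taboo :: "(nat \<Rightarrow> nat \<Rightarrow> real) \<Rightarrow> nat \<Rightarrow> nat \<Rightarrow> nat \<Rightarrow> real" where
  "taboo h K l i = (\<Sum>k\<le>K. if l \<le> k + 1 then \<Sum>j<M. A (k + 1 - l) i j * h k j else 0)"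

text \<open>Invariance of \<open>y\<close> tested against \<open>h\<close>, cut at level
  \<open>K\<close> so that all sums are finite. Sources go up to \<open>K + 1\<close> because a step
  descends by at most one level.\<close>

lemma level_sum:
  assumes h0: "\<And>j. j < M \<Longrightarrow> h 0 j = 0"
  shows "(\<Sum>k\<le>K. \<Sum>j<M. y k j * h k j) =
    (\<Sum>k\<le>K. \<Sum>j<M. b k j * h k j) + (\<Sum>l\<le>K + 1. \<Sum>i<M. y l i * taboo h K l i)"
proof -
  have term_eq: "y k j * h k j = b k j * h k j +
     (\<Sum>l\<le>K + 1. \<Sum>i<M. if l \<le> k + 1 then y l i * (A (k + 1 - l) i j * h k j) else 0)"
    if "k \<le> K" "j < M" for k j
  proof (cases "k = 0")
    case True
    then show ?thesis using h0[OF that(2)] by (simp cong: if_cong)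
  next
    case False
    have "(\<Sum>l\<le>K + 1. \<Sum>i<M. if l \<le> k + 1 then y l i * (A (k + 1 - l) i j * h k j) else 0)
      = (\<Sum>l\<le>k + 1. \<Sum>i<M. if l \<le> k + 1 then y l i * (A (k + 1 - l) i j * h k j) else 0)"
      using that by (intro sum.mono_neutral_right) auto
    also have "\<dots> = (\<Sum>l\<le>k + 1. \<Sum>i<M. y l i * A (k + 1 - l) i j) * h k j"
      unfolding sum_distrib_right by (intro sum.cong) (auto simp: mult.assoc)
    finally show ?thesis using y_eq[of k j] False that by (simp add: distrib_right)
  qed
  have "(\<Sum>k\<le>K. \<Sum>j<M. y k j * h k j) = (\<Sum>k\<le>K. \<Sum>j<M. b k j * h k j) +
    (\<Sum>k\<le>K. \<Sum>j<M. \<Sum>l\<le>K + 1. \<Sum>i<M. if l \<le> k + 1 then y l i * (A (k + 1 - l) i j * h k j) else 0)"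
    unfolding sum.distrib[symmetric] by (intro sum.cong refl term_eq) auto
  also have "(\<Sum>k\<le>K. \<Sum>j<M. \<Sum>l\<le>K + 1. \<Sum>i<M. if l \<le> k + 1 then y l i * (A (k + 1 - l) i j * h k j) else 0)
    = (\<Sum>k\<le>K. \<Sum>l\<le>K + 1. \<Sum>i<M. \<Sum>j<M. if l \<le> k + 1 then y l i * (A (k + 1 - l) i j * h k j) else 0)"
    by (rule sum.cong[OF refl], subst sum.swap, rule sum.cong[OF refl], rule sum.swap)
  also have "\<dots> = (\<Sum>l\<le>K + 1. \<Sum>i<M. \<Sum>k\<le>K. \<Sum>j<M. if l \<le> k + 1 then y l i * (A (k + 1 - l) i j * h k j) else 0)"
    by (subst sum.swap, rule sum.cong[OF refl], rule sum.swap)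
  also have "\<dots> = (\<Sum>l\<le>K + 1. \<Sum>i<M. y l i * taboo h K l i)"
    unfolding taboo_def sum_distrib_left by (intro sum.cong refl) (auto simp: sum_distrib_left)
  finally show ?thesis .
qed

text \<open>A test function of product form turns the one-step expectation into a partial sum of
  \<open>AstarR A s\<close>. The case \<open>s = 1\<close> with constant \<open>w\<close> gives the
  trivial bound by the supremum.\<close>

lemma taboo_le:
  assumes "1 \<le> l" "i < M" "0 \<le> s" "s \<le> R"
    and h: "\<And>k j. j < M \<Longrightarrow> l \<le> k + 1 \<Longrightarrow> h k j \<le> q * (s ^ (k + 1 - l) * w j)"
    and q: "0 \<le> q" "\<And>j. j < M \<Longrightarrow> 0 \<le> w j"
  shows "taboo h K l i \<le> q * act s w i"
proof -
  define F where "F n = (\<Sum>j<M. q * (s ^ n * A n i j * w j))" for n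
  have "taboo h K l i \<le> (\<Sum>k\<le>K. if l \<le> k + 1 then F (k + 1 - l) else 0)"
    unfolding taboo_def
  proof (intro sum_mono)
    fix k
    show "(if l \<le> k + 1 then \<Sum>j<M. A (k + 1 - l) i j * h k j else 0) \<le> (if l \<le> k + 1 then F (k + 1 - l) else 0)"
    proof (cases "l \<le> k + 1")
      case True
      have "A (k + 1 - l) i j * h k j \<le> q * (s ^ (k + 1 - l) * A (k + 1 - l) i j * w j)" if "j < M" for j
        using mult_left_mono[OF h[OF that True] A_nonneg[OF assms(2) that, of "k + 1 - l"]] by (simp add: mult_ac)
      then show ?thesis using True unfolding F_def by (auto intro: sum_mono)
    qed auto
  qed
  also have "\<dots> = (\<Sum>n<K + 2 - l. F n)" by (rule sum_shifted_index[OF assms(1)])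
  also have "\<dots> = q * (\<Sum>j<M. (\<Sum>n<K + 2 - l. s ^ n * A n i j) * w j)"
    unfolding F_def by (subst sum.swap) (simp add: sum_distrib_left sum_distrib_right mult_ac)
  also have "\<dots> \<le> q * act s w i"
    unfolding AstarR_def using assms A_nonneg summable_A
    by (intro mult_left_mono sum_mono mult_right_mono sum_le_suminf) auto
  finally show ?thesis .
qed

text \<open>The test function \<open>t^k w\<close> is truncated at height \<open>H\<close> because \<open>y\<close> is only known to be
  summable at this stage.\<close>

lemma Lyapunov_bound:
  assumes t: "0 < t" "t \<le> R" and w: "\<And>i. i < M \<Longrightarrow> 0 < w i" and c: "c < 1"
    and le: "\<And>i. i < M \<Longrightarrow> act t w i \<le> c * t * w i"
  shows "(\<Sum>k\<le>K. \<Sum>j<M. y k j * (t ^ k * w j)) \<le> (\<Sum>j<M. (\<Sum>k. t ^ k * b k j) * w j) / (1 - c)"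
proof -
  define Bs where "Bs = (\<Sum>j<M. (\<Sum>k. t ^ k * b k j) * w j)"
  define g where "g k j = (if k = 0 then 0 else t ^ k * w j)" for k :: nat and j :: nat
  have g0: "0 \<le> g k j" if "j < M" for k j using t w[OF that] by (simp add: g_def)
  have b_summable: "summable (\<lambda>k. t ^ k * b k j)" if "j < M" for j
  proof (rule summable_comparison_test'[OF b_summable_R[OF that]])
    show "norm (t ^ k * b k j) \<le> R ^ k * b k j" for k
      using t b_nonneg[OF that, of k] by (simp add: mult_right_mono power_mono)
  qed
  \<comment> \<open>\<open>y\<close> integrated against a lower bound for the one-step loss of
    \<open>min g H\<close>, whose expectation after a step is at most
    \<open>min (c * g) H\<close>.\<close>
  define T where "T H K = (\<Sum>k\<le>K. \<Sum>j<M. y k j * (min (g k j) H - min (c * g k j) H))" for H K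
  have step: "T H K \<le> Bs + H * (\<Sum>j<M. y (Suc K) j)" if H: "0 \<le> H" for H K
  proof -
    define h where "h k j = min (g k j) H" for k j
    have "(\<Sum>k\<le>K. \<Sum>j<M. b k j * h k j) \<le> (\<Sum>k\<le>K. \<Sum>j<M. (t ^ k * b k j) * w j)"
    proof (intro sum_mono)
      fix k j assume "j \<in> {..<M}"
      then have "h k j \<le> t ^ k * w j" using t w[of j] by (auto simp: h_def g_def)
      then show "b k j * h k j \<le> t ^ k * b k j * w j"
        using mult_left_mono[of "h k j" "t ^ k * w j" "b k j"] b_nonneg \<open>j \<in> {..<M}\<close> by (simp add: mult_ac)
    qed
    also have "\<dots> = (\<Sum>j<M. (\<Sum>k\<le>K. t ^ k * b k j) * w j)"
      by (subst sum.swap) (simp add: sum_distrib_right)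
    also have "\<dots> \<le> Bs" unfolding Bs_def
      using t w b_nonneg b_summable by (intro sum_mono mult_right_mono sum_le_suminf) (auto simp: less_imp_le)
    finally have bpart: "(\<Sum>k\<le>K. \<Sum>j<M. b k j * h k j) \<le> Bs" .
    have tab: "taboo h K l i \<le> min (c * g l i) H" if l: "1 \<le> l" and i: "i < M" for l i
    proof -
      have "taboo h K l i \<le> t ^ (l - 1) * act t w i"
      proof (rule taboo_le[OF l i])
        fix k j assume "j < M" "l \<le> k + 1"
        have "l - 1 + (k + 1 - l) = k" using l \<open>l \<le> k + 1\<close> by simp
        then have "t ^ (l - 1) * t ^ (k + 1 - l) = t ^ k" by (simp flip: power_add)
        moreover have "h k j \<le> t ^ k * w j" using t w[OF \<open>j < M\<close>] by (auto simp: h_def g_def)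
        ultimately show "h k j \<le> t ^ (l - 1) * (t ^ (k + 1 - l) * w j)" by (simp flip: mult.assoc)
      qed (use t w in \<open>auto simp: less_imp_le\<close>)
      also have "\<dots> \<le> t ^ (l - 1) * (c * t * w i)" using t le[OF i] by (intro mult_left_mono) auto
      also have "\<dots> = c * (t ^ Suc (l - 1) * w i)" by simp
      also have "\<dots> = c * g l i" using l by (simp add: g_def)
      finally have 1: "taboo h K l i \<le> c * g l i" .
      \<comment> \<open>Stochasticity: a function bounded by \<open>H\<close> keeps this bound after
        one step.\<close>
      have "taboo h K l i \<le> H * (\<Sum>j<M. AstarR A 1 i j * 1)"
        using R_gt_1 H by (intro taboo_le[OF l i]) (auto simp: h_def)
      then have "taboo h K l i \<le> H" using stochastic[OF i] by simp
      then show ?thesis using 1 by simp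
    qed
    have "(\<Sum>k\<le>K. \<Sum>j<M. y k j * h k j) =
      (\<Sum>k\<le>K. \<Sum>j<M. b k j * h k j) + (\<Sum>l\<le>K + 1. \<Sum>i<M. y l i * taboo h K l i)"
      using H by (intro level_sum) (auto simp: h_def g_def)
    also have "(\<Sum>l\<le>K + 1. \<Sum>i<M. y l i * taboo h K l i) \<le> (\<Sum>l\<le>K + 1. \<Sum>i<M. y l i * min (c * g l i) H)"
    proof (intro sum_mono)
      fix l i assume "i \<in> {..<M}"
      then show "y l i * taboo h K l i \<le> y l i * min (c * g l i) H"
        using tab[of l i] y_nonneg[of i l] y_0[of i] by (cases "l = 0") (auto intro: mult_left_mono)
    qed
    also have "\<dots> = (\<Sum>l\<le>K. \<Sum>i<M. y l i * min (c * g l i) H) + (\<Sum>i<M. y (Suc K) i * min (c * g (Suc K) i) H)"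
      by simp
    also have "(\<Sum>i<M. y (Suc K) i * min (c * g (Suc K) i) H) \<le> (\<Sum>i<M. y (Suc K) i * H)"
      using y_nonneg by (intro sum_mono mult_left_mono) auto
    finally show ?thesis using bpart unfolding T_def h_def
      by (simp add: right_diff_distrib sum_subtractf sum_distrib_left mult.commute)
  qed
  have mono: "T H K \<le> T H K'" if "0 \<le> H" "K \<le> K'" for H K K'
  proof -
    have "0 \<le> y k j * (min (g k j) H - min (c * g k j) H)" if "j < M" for k j
    proof -
      have "c * g k j \<le> 1 * g k j" using c g0[OF that] by (intro mult_right_mono) auto
      then show ?thesis using y_nonneg[OF that] by (intro mult_nonneg_nonneg) auto
    qed
    then show ?thesis unfolding T_def using that
      by (intro sum_mono2) (auto intro: sum_nonneg)
  qed
  \<comment> \<open>The inflow from level \<open>Suc K\<close> costs at most \<open>H\<close> times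
    its mass, which tends to 0; monotonicity in \<open>K\<close> carries the limiting bound back to
    every finite \<open>K\<close>.\<close>
  have T_le: "T H K \<le> Bs" if H: "0 \<le> H" for H K
  proof (rule LIMSEQ_le_const)
    have "(\<lambda>K. y (Suc K) j) \<longlonglongrightarrow> 0" if "j < M" for j
      using summable_LIMSEQ_zero[OF y_summable[OF that]] by (rule LIMSEQ_Suc)
    then have "(\<lambda>K. Bs + H * (\<Sum>j<M. y (Suc K) j)) \<longlonglongrightarrow> Bs + H * (\<Sum>j<M. 0)"
      by (intro tendsto_intros) auto
    then show "(\<lambda>K. Bs + H * (\<Sum>j<M. y (Suc K) j)) \<longlonglongrightarrow> Bs" by simp
    show "\<exists>N. \<forall>n\<ge>N. T H K \<le> Bs + H * (\<Sum>j<M. y (Suc n) j)"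
      using mono[OF H] step[OF H] order_trans by blast
  qed
  \<comment> \<open>Large enough for the truncation to be inactive on the levels up to
    \<open>K\<close>.\<close>
  define H where "H = (\<Sum>k\<le>K. \<Sum>j<M. g k j)"
  have gH: "g k j \<le> H" if "k \<le> K" "j < M" for k j
  proof -
    have "g k j \<le> (\<Sum>j<M. g k j)" using that g0 by (intro member_le_sum) auto
    also have "\<dots> \<le> H" unfolding H_def using that g0 by (intro member_le_sum) (auto intro: sum_nonneg)
    finally show ?thesis .
  qed
  have H0: "0 \<le> H" unfolding H_def using g0 by (auto intro!: sum_nonneg)
  have "T H K = (\<Sum>k\<le>K. \<Sum>j<M. (1 - c) * (y k j * (t ^ k * w j)))"
    unfolding T_def
  proof (intro sum.cong refl)
    fix k j assume kj: "k \<in> {..K}" "j \<in> {..<M}"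
    have "c * g k j \<le> 1 * g k j" using c g0[of j k] kj by (intro mult_right_mono) auto
    then have "min (g k j) H - min (c * g k j) H = (1 - c) * g k j"
      using gH[of k j] kj by (simp add: algebra_simps)
    then show "y k j * (min (g k j) H - min (c * g k j) H) = (1 - c) * (y k j * (t ^ k * w j))"
      using y_0[of j] kj by (cases "k = 0") (auto simp: g_def)
  qed
  then have "(1 - c) * (\<Sum>k\<le>K. \<Sum>j<M. y k j * (t ^ k * w j)) \<le> Bs"
    using T_le[OF H0, of K] by (simp add: sum_distrib_left)
  then show ?thesis using c unfolding Bs_def by (simp add: pos_le_divide_eq mult.commute)
qed

text \<open>The denominator \<open>1 - c\<close> of \<open>Lyapunov_bound\<close> is here
  \<open>\<kappa> * (\<theta> - t)\<close>, and the uniform bounds on the weights make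
  \<open>C\<close> independent of \<open>t\<close>. The inequality \<open>Perron z0 < z0\<close> is
  recorded for a later proof that a determinant does not vanish identically.\<close>

lemma y_growth:
  obtains z0 C where "1 < z0" "z0 < \<theta>" "Perron z0 < z0"
    "\<And>t j. z0 \<le> t \<Longrightarrow> t < \<theta> \<Longrightarrow> j < M \<Longrightarrow> summable (\<lambda>k. t ^ k * y k j)"
    "\<And>t j. z0 \<le> t \<Longrightarrow> t < \<theta> \<Longrightarrow> j < M \<Longrightarrow> (\<Sum>k. t ^ k * y k j) \<le> C / (\<theta> - t)"
proof -
  obtain z0 \<kappa> m W where L: "1 < z0" "z0 < \<theta>" "0 < \<kappa>" "0 < m"
    "\<And>t. z0 \<le> t \<Longrightarrow> t < \<theta> \<Longrightarrow> \<exists>w. (\<forall>i<M. m \<le> w i \<and> w i \<le> W) \<and>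
       (\<forall>i<M. act t w i \<le> (1 - \<kappa> * (\<theta> - t)) * t * w i)"
    by (rule Lyapunov_vectors) blast
  define BR where "BR = (\<Sum>j<M. (\<Sum>k. R ^ k * b k j) * W)"
  define C where "C = BR / \<kappa> / m"
  have partial: "(\<Sum>k<K. t ^ k * y k j) \<le> C / (\<theta> - t)" if t: "z0 \<le> t" "t < \<theta>" and j: "j < M" for t j K
  proof -
    obtain w where w: "\<And>i. i < M \<Longrightarrow> m \<le> w i \<and> w i \<le> W"
      "\<And>i. i < M \<Longrightarrow> act t w i \<le> (1 - \<kappa> * (\<theta> - t)) * t * w i" using L(5)[OF t] by blast
    have wpos: "0 < w i" if "i < M" for i using w(1)[OF that] L(4) by linarith
    have t0: "0 < t" "t \<le> R" using t L theta by auto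
    have "m * (\<Sum>k<K. t ^ k * y k j) \<le> (\<Sum>k<K. y k j * (t ^ k * w j))"
      unfolding sum_distrib_left
    proof (intro sum_mono)
      fix k
      have "m * (t ^ k * y k j) \<le> w j * (t ^ k * y k j)"
        using w(1)[OF j] t0 y_nonneg[OF j] by (intro mult_right_mono) auto
      then show "m * (t ^ k * y k j) \<le> y k j * (t ^ k * w j)" by (simp add: mult_ac)
    qed
    also have "\<dots> \<le> (\<Sum>k<K. \<Sum>j<M. y k j * (t ^ k * w j))"
      using j y_nonneg wpos t0 by (intro sum_mono member_le_sum) (auto simp: less_imp_le)
    also have "\<dots> \<le> (\<Sum>k\<le>K. \<Sum>j<M. y k j * (t ^ k * w j))"
      using y_nonneg wpos t0 by (intro sum_mono2) (auto simp: less_imp_le intro!: sum_nonneg)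
    also have "\<dots> \<le> (\<Sum>j<M. (\<Sum>k. t ^ k * b k j) * w j) / (1 - (1 - \<kappa> * (\<theta> - t)))"
      using t L w(2) wpos t0 by (intro Lyapunov_bound) auto
    also have "\<dots> \<le> BR / (1 - (1 - \<kappa> * (\<theta> - t)))"
    proof -
      have "(\<Sum>k. t ^ k * b k i) * w i \<le> (\<Sum>k. R ^ k * b k i) * W" if i: "i < M" for i
      proof (intro mult_mono)
        have le: "t ^ k * b k i \<le> R ^ k * b k i" for k
          using t0 b_nonneg[OF i] by (intro mult_right_mono power_mono) auto
        have s: "summable (\<lambda>k. t ^ k * b k i)"
          by (rule summable_comparison_test'[OF b_summable_R[OF i]]) (use le t0 b_nonneg[OF i] in auto)
        show "(\<Sum>k. t ^ k * b k i) \<le> (\<Sum>k. R ^ k * b k i)" by (rule suminf_le[OF le s b_summable_R[OF i]])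
        show "0 \<le> (\<Sum>k. R ^ k * b k i)"
          using b_nonneg[OF i] R_gt_1 by (intro suminf_nonneg b_summable_R[OF i]) auto
      qed (use w(1)[OF i] wpos[OF i] in auto)
      then show ?thesis unfolding BR_def using t L by (intro divide_right_mono sum_mono) auto
    qed
    finally have "m * (\<Sum>k<K. t ^ k * y k j) \<le> BR / (\<kappa> * (\<theta> - t))" by simp
    then have "(\<Sum>k<K. t ^ k * y k j) \<le> BR / (\<kappa> * (\<theta> - t)) / m"
      by (rule mult_imp_le_div_pos[OF L(4), of "\<Sum>k<K. t ^ k * y k j", simplified mult.commute[of _ m]])
    then show ?thesis unfolding C_def by (simp add: mult.assoc divide_divide_eq_left mult.left_commute mult.commute)
  qed
  have summ: "summable (\<lambda>k. t ^ k * y k j)" if "z0 \<le> t" "t < \<theta>" "j < M" for t j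
    using that partial[OF that] y_nonneg L by (intro summableI_nonneg_bounded[of _ "C / (\<theta> - t)"]) auto
  obtain w where w: "\<And>i. i < M \<Longrightarrow> m \<le> w i"
      "\<And>i. i < M \<Longrightarrow> act z0 w i \<le> (1 - \<kappa> * (\<theta> - z0)) * z0 * w i"
    using L(5)[of z0] L(2) by blast
  have "Perron z0 \<le> (1 - \<kappa> * (\<theta> - z0)) * z0"
    using L theta by (intro Perron_le[of _ w] w(2)) (auto intro: less_le_trans[OF L(4) w(1)])
  also have "\<dots> < 1 * z0" using L by (intro mult_strict_right_mono) auto
  finally have "Perron z0 < z0" by simp
  then show ?thesis
    using that[of z0 C] L(1,2) summ suminf_le_const[OF summ partial] by blast
qed

section \<open>Generating functions and the functional equation\<close>

definition X :: "complex \<Rightarrow> nat \<Rightarrow> complex" where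
  "X z j = (\<Sum>k. complex_of_real (y k j) * z ^ k)"

definition bgf :: "complex \<Rightarrow> nat \<Rightarrow> complex" where
  "bgf z j = (\<Sum>k. complex_of_real (b k j) * z ^ k)"

text \<open>The subtracted sum is the flow from level 1 to level 0 that the product of
  \<open>X\<close> with \<open>Astar\<close> counts although \<open>y 0\<close> is set to
  zero.\<close>

definition rhs :: "complex \<Rightarrow> nat \<Rightarrow> complex" where
  "rhs z j = z * (bgf z j - complex_of_real (\<Sum>i<M. y 1 i * A 0 i j))"

lemma summable_X:
  assumes "norm z < \<theta>" "j < M"
  shows "summable (\<lambda>k. norm (complex_of_real (y k j) * z ^ k))"
proof -
  obtain z0 C where z0: "1 < z0" "z0 < \<theta>"
    "\<And>t j. z0 \<le> t \<Longrightarrow> t < \<theta> \<Longrightarrow> j < M \<Longrightarrow> summable (\<lambda>k. t ^ k * y k j)"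
    by (rule y_growth) blast
  define t where "t = max z0 (norm z)"
  have "summable (\<lambda>k. t ^ k * y k j)" using z0 assms unfolding t_def by (intro z0(3)) auto
  then show ?thesis
  proof (rule summable_comparison_test')
    fix k
    have "norm z ^ k * y k j \<le> t ^ k * y k j"
      using y_nonneg[OF assms(2)] unfolding t_def by (intro mult_right_mono power_mono) auto
    then show "norm (norm (complex_of_real (y k j) * z ^ k)) \<le> t ^ k * y k j"
      using y_nonneg[OF assms(2), of k] by (simp add: norm_mult norm_power mult.commute)
  qed
qed

lemma X_sums: "norm z < \<theta> \<Longrightarrow> j < M \<Longrightarrow> (\<lambda>k. complex_of_real (y k j) * z ^ k) sums X z j"
  unfolding X_def by (rule summable_sums[OF summable_norm_cancel[OF summable_X]])

lemma bgf_sums: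
  assumes "norm z \<le> R" "j < M"
  shows "(\<lambda>k. complex_of_real (b k j) * z ^ k) sums bgf z j"
  unfolding bgf_def
proof (rule summable_sums[OF summable_norm_cancel[OF summable_comparison_test'[OF b_summable_R[OF assms(2)]]]])
  fix k
  have "norm z ^ k * b k j \<le> R ^ k * b k j"
    using b_nonneg[OF assms(2)] assms by (intro mult_right_mono power_mono) auto
  then show "norm (norm (complex_of_real (b k j) * z ^ k)) \<le> R ^ k * b k j"
    using b_nonneg[OF assms(2), of k] by (simp add: norm_mult norm_power mult.commute)
qed

lemma X_growth:
  obtains z0 C where "1 < z0" "z0 < \<theta>" "Perron z0 < z0"
    "\<And>z :: complex. \<And>j. z0 \<le> norm z \<Longrightarrow> norm z < \<theta> \<Longrightarrow> j < M \<Longrightarrow> norm (X z j) \<le> C / (\<theta> - norm z)"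
proof -
  obtain z0 C where z0: "1 < z0" "z0 < \<theta>" "Perron z0 < z0"
    "\<And>t j. z0 \<le> t \<Longrightarrow> t < \<theta> \<Longrightarrow> j < M \<Longrightarrow> summable (\<lambda>k. t ^ k * y k j)"
    "\<And>t j. z0 \<le> t \<Longrightarrow> t < \<theta> \<Longrightarrow> j < M \<Longrightarrow> (\<Sum>k. t ^ k * y k j) \<le> C / (\<theta> - t)"
    by (rule y_growth) blast
  show ?thesis
  proof (rule that[OF z0(1-3)])
    fix z :: complex and j assume z: "z0 \<le> norm z" "norm z < \<theta>" "j < M"
    have "norm (X z j) \<le> (\<Sum>k. norm (complex_of_real (y k j) * z ^ k))"
      unfolding X_def by (rule summable_norm[OF summable_X[OF z(2,3)]])
    also have "\<dots> = (\<Sum>k. norm z ^ k * y k j)"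
      using y_nonneg[OF z(3)] by (simp add: norm_mult norm_power mult.commute)
    also have "\<dots> \<le> C / (\<theta> - norm z)" by (rule z0(5)[OF z])
    finally show "norm (X z j) \<le> C / (\<theta> - norm z)" .
  qed
qed

lemma X_eq:
  assumes z: "norm z < \<theta>" and j: "j < M"
  shows "z * X z j - (\<Sum>i<M. X z i * Astar A z i j) = rhs z j"
proof -
  define c where "c n = (\<Sum>l\<le>n. \<Sum>i<M. y l i * A (n - l) i j)" for n
  have "(\<lambda>n. \<Sum>l\<le>n. (complex_of_real (y l i) * z ^ l) * (z ^ (n - l) * complex_of_real (A (n - l) i j)))
    sums (X z i * Astar A z i j)" if i: "i < M" for i
    unfolding X_def Astar_def
    using summable_X[OF z i] summable_norm_A[OF i j, of z] z theta by (intro Cauchy_product_sums) auto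
  then have "(\<lambda>n. \<Sum>i<M. \<Sum>l\<le>n. (complex_of_real (y l i) * z ^ l) * (z ^ (n - l) * complex_of_real (A (n - l) i j)))
    sums (\<Sum>i<M. X z i * Astar A z i j)" by (intro sums_sum) auto
  moreover have "(\<Sum>i<M. \<Sum>l\<le>n. (complex_of_real (y l i) * z ^ l) * (z ^ (n - l) * complex_of_real (A (n - l) i j)))
    = z ^ n * complex_of_real (c n)" for n
  proof -
    have "(complex_of_real (y l i) * z ^ l) * (z ^ (n - l) * complex_of_real (A (n - l) i j)) =
      z ^ n * complex_of_real (y l i * A (n - l) i j)" if "l \<le> n" for l i
    proof -
      have "z ^ l * z ^ (n - l) = z ^ n" using that by (simp flip: power_add)
      then show ?thesis by (simp add: mult_ac)
    qed
    then have "(\<Sum>i<M. \<Sum>l\<le>n. (complex_of_real (y l i) * z ^ l) * (z ^ (n - l) * complex_of_real (A (n - l) i j)))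
      = (\<Sum>i<M. \<Sum>l\<le>n. z ^ n * complex_of_real (y l i * A (n - l) i j))"
      by (intro sum.cong refl) auto
    also have "\<dots> = z ^ n * complex_of_real (c n)"
      unfolding c_def by (subst sum.swap) (simp add: sum_distrib_left)
    finally show ?thesis .
  qed
  ultimately have S: "(\<lambda>n. z ^ n * complex_of_real (c n)) sums (\<Sum>i<M. X z i * Astar A z i j)" by simp
  have c0: "c 0 = 0" unfolding c_def using y_0 by simp
  \<comment> \<open>\<open>y_eq\<close> starts at level 1, so this coefficient has no partner among
    the \<open>y k j\<close> and is left over in \<open>rhs\<close>.\<close>
  have c1: "c 1 = (\<Sum>i<M. y 1 i * A 0 i j)" unfolding c_def using y_0 by simp
  have cS: "c (Suc k) = y k j - b k j" if "1 \<le> k" for k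
    using y_eq[OF that j] by (simp add: c_def)
  have single: "(\<lambda>k. if k = 0 then z * complex_of_real (c 1) else 0) sums (z * complex_of_real (c 1))"
    using sums_single[of 0 "\<lambda>_. z * complex_of_real (c 1)"] by simp
  have "(\<lambda>k. z * (complex_of_real (y k j) * z ^ k - complex_of_real (b k j) * z ^ k) +
      (if k = 0 then z * complex_of_real (c 1) else 0)) sums (z * (X z j - bgf z j) + z * complex_of_real (c 1))"
    using X_sums[OF z j] bgf_sums[of z j] z theta j
    by (intro sums_add sums_mult sums_diff single) auto
  moreover have "z * (complex_of_real (y k j) * z ^ k - complex_of_real (b k j) * z ^ k) +
      (if k = 0 then z * complex_of_real (c 1) else 0) = z ^ Suc k * complex_of_real (c (Suc k))" for k
    using y_0[OF j] b_0[OF j] by (cases "k = 0") (simp_all add: cS right_diff_distrib left_diff_distrib mult_ac)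
  ultimately have "(\<lambda>k. z ^ Suc k * complex_of_real (c (Suc k))) sums (z * (X z j - bgf z j) + z * complex_of_real (c 1))"
    by simp
  then have "(\<lambda>n. z ^ n * complex_of_real (c n)) sums (z * (X z j - bgf z j) + z * complex_of_real (c 1))"
    using c0 by (subst (asm) sums_Suc_iff) simp
  then have "(\<Sum>i<M. X z i * Astar A z i j) = z * (X z j - bgf z j) + z * complex_of_real (c 1)"
    using S sums_unique2 by blast
  then show ?thesis unfolding rhs_def c1 by (simp add: algebra_simps)
qed

end

section \<open>The poles on the circle of radius \<open>\<theta>\<close>\<close>

lemma holomorphic_det:
  fixes f :: "complex \<Rightarrow> nat \<Rightarrow> nat \<Rightarrow> complex"
  assumes "\<And>i j. i < n \<Longrightarrow> j < n \<Longrightarrow> (\<lambda>z. f z i j) holomorphic_on S"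
  shows "(\<lambda>z. Determinant.det (Matrix.mat n n (\<lambda>(i, j). f z i j))) holomorphic_on S"
proof -
  have "(\<lambda>z. \<Sum>p\<in>{p. p permutes {0..<n}}. signof p * (\<Prod>i = 0..<n. f z i (p i))) holomorphic_on S"
    by (intro holomorphic_intros assms) (auto simp: permutes_in_image)
  moreover have "Determinant.det (Matrix.mat n n (\<lambda>(i, j). f z i j)) =
      (\<Sum>p\<in>{p. p permutes {0..<n}}. signof p * (\<Prod>i = 0..<n. f z i (p i)))" for z
    unfolding Determinant.det_def by (auto simp: permutes_in_image intro!: sum.cong prod.cong)
  ultimately show ?thesis by simp
qed

text \<open>Cramer's rule in terms of plain functions: cofactors are polynomials in the entries and
  hence holomorphic. The clause on kernel vectors serves to exhibit a point where \<open>D\<close>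
  is nonzero.\<close>

lemma holomorphic_adjugate:
  fixes f :: "complex \<Rightarrow> nat \<Rightarrow> nat \<Rightarrow> complex"
  assumes hol: "\<And>i j. i < n \<Longrightarrow> j < n \<Longrightarrow> (\<lambda>z. f z i j) holomorphic_on S"
  obtains D Adj where "D holomorphic_on S"
    "\<And>i j. i < n \<Longrightarrow> j < n \<Longrightarrow> (\<lambda>z. Adj z i j) holomorphic_on S"
    "\<And>z i k. i < n \<Longrightarrow> k < n \<Longrightarrow> (\<Sum>j<n. f z i j * Adj z j k) = (if i = k then D z else 0)"
    "\<And>z. D z = 0 \<Longrightarrow> \<exists>u. (\<exists>i<n. u i \<noteq> 0) \<and> (\<forall>i<n. (\<Sum>j<n. f z i j * u j) = 0)"
proof -
  define F where "F z = Matrix.mat n n (\<lambda>(i, j). f z i j)" for z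
  define D where "D z = Determinant.det (F z)" for z
  define Adj where "Adj z j k = adj_mat (F z) $$ (j, k)" for z j k
  have carr: "F z \<in> carrier_mat n n" for z by (simp add: F_def)
  note adj = adj_mat[OF carr]
  show ?thesis
  proof (rule that[of D Adj])
    show "D holomorphic_on S" unfolding D_def F_def by (rule holomorphic_det[OF hol])
    show "(\<lambda>z. Adj z i j) holomorphic_on S" if ij: "i < n" "j < n" for i j
    proof -
      have "mat_delete (F z) j i = Matrix.mat (n - 1) (n - 1)
        (\<lambda>(i', j'). f z (if i' < j then i' else Suc i') (if j' < i then j' else Suc j'))" for z
        unfolding mat_delete_def F_def using ij by (intro eq_matI) auto
      then have "Adj z i j = (-1) ^ (j + i) * Determinant.det (Matrix.mat (n - 1) (n - 1)
        (\<lambda>(i', j'). f z (if i' < j then i' else Suc i') (if j' < i then j' else Suc j')))" for z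
        using ij carr by (simp add: Adj_def adj_mat_def cofactor_def F_def)
      moreover have "(\<lambda>z. (-1) ^ (j + i) * Determinant.det (Matrix.mat (n - 1) (n - 1)
        (\<lambda>(i', j'). f z (if i' < j then i' else Suc i') (if j' < i then j' else Suc j')))) holomorphic_on S"
        by (intro holomorphic_intros holomorphic_det hol) auto
      ultimately show ?thesis by simp
    qed
    show "(\<Sum>j<n. f z i j * Adj z j k) = (if i = k then D z else 0)" if ik: "i < n" "k < n" for z i k
    proof -
      have "(F z * adj_mat (F z)) $$ (i, k) = (\<Sum>j = 0..<n. F z $$ (i, j) * adj_mat (F z) $$ (j, k))"
        using ik adj(1)[of z] carr[of z] by (simp add: scalar_prod_def)
      also have "\<dots> = (\<Sum>j<n. f z i j * Adj z j k)"
        using ik by (simp add: F_def Adj_def lessThan_atLeast0)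
      finally show ?thesis using adj(2)[of z] ik by (cases "i = k") (simp_all add: D_def)
    qed
    fix z assume "D z = 0"
    then obtain u where u: "u \<in> carrier_vec n" "u \<noteq> 0\<^sub>v n" "F z *\<^sub>v u = 0\<^sub>v n"
      unfolding D_def using det_0_iff_vec_prod_zero[OF carr] by blast
    show "\<exists>u. (\<exists>i<n. u i \<noteq> 0) \<and> (\<forall>i<n. (\<Sum>j<n. f z i j * u j) = 0)"
    proof (intro exI[of _ "vec_index u"] conjI allI impI)
      show "\<exists>i<n. vec_index u i \<noteq> 0"
      proof (rule ccontr)
        assume "\<not> ?thesis"
        then have "u = 0\<^sub>v n" using u(1) by (intro eq_vecI) auto
        then show False using u(2) by simp
      qed
      fix i assume i: "i < n"
      have "vec_index (F z *\<^sub>v u) i = (\<Sum>j = 0..<n. F z $$ (i, j) * vec_index u j)"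
        using i u(1) carr[of z] by (simp add: scalar_prod_def)
      also have "\<dots> = (\<Sum>j<n. f z i j * vec_index u j)" using i by (simp add: F_def lessThan_atLeast0)
      finally show "(\<Sum>j<n. f z i j * vec_index u j) = 0" using u(3) i by simp
    qed
  qed
qed

section \<open>Roots of unity and the period\<close>

lemma powi_cong_period:
  fixes w :: complex
  assumes "w ^ t = 1" "0 < t" "int t dvd m - n"
  shows "w powi m = w powi n"
proof -
  have w: "w \<noteq> 0" using assms(1,2) by (auto simp: power_0_left)
  obtain q where q: "m - n = int t * q" using assms(3) by (auto simp: dvd_def)
  have "w powi (int t * q) = 1" using assms(1) by (simp add: power_int_mult)
  moreover have "w powi m = w powi n * w powi (m - n)" using w by (simp flip: power_int_add)
  ultimately show ?thesis using q by simp
qed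

text \<open>If \<open>w\<close> has finite order, the order divides every element of
  \<open>S\<close> and so the gcd. Otherwise \<open>S\<close> contains at most 0, its gcd is 0, and
  the claim reads \<open>w ^ 0 = 1\<close>.\<close>

lemma powi_Gcd_eq_1:
  fixes w :: complex and S :: "int set"
  assumes w: "w \<noteq> 0" and S: "\<And>k. k \<in> S \<Longrightarrow> w powi k = 1"
  shows "w ^ nat (Gcd S) = 1"
proof (cases "\<exists>n>0. w ^ n = 1")
  case True
  define n where "n = (LEAST n. n > 0 \<and> w ^ n = 1)"
  have n: "n > 0" "w ^ n = 1" using LeastI_ex[OF True] unfolding n_def by auto
  have least: "n \<le> m" if "m > 0" "w ^ m = 1" for m unfolding n_def using that by (intro Least_le) auto
  have "int n dvd k" if k: "k \<in> S" for k
  proof (rule ccontr)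
    assume "\<not> int n dvd k"
    then have "k mod int n \<noteq> 0" by (simp add: dvd_eq_mod_eq_0)
    moreover have "0 \<le> k mod int n" using n(1) by simp
    ultimately have pos: "k mod int n > 0" by linarith
    have "int n dvd k - k mod int n" by (simp add: minus_mod_eq_mult_div)
    then have "w powi k = w powi (k mod int n)" by (rule powi_cong_period[OF n(2,1)])
    then have "w ^ nat (k mod int n) = 1" using S[OF k] pos by (simp add: power_int_def)
    moreover have "nat (k mod int n) < n" using n(1) by (simp add: nat_less_iff)
    ultimately show False using least[of "nat (k mod int n)"] pos by simp
  qed
  then have "int n dvd Gcd S" by (rule Gcd_greatest)
  then have "int n dvd int (nat (Gcd S))" by simp
  then have "n dvd nat (Gcd S)" by (simp only: int_dvd_int_iff)
  then show ?thesis using n(2) by (auto simp: dvd_def power_mult)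
next
  case False
  have "k = 0" if "k \<in> S" for k
  proof (rule ccontr)
    assume "k \<noteq> 0"
    have "w ^ nat \<bar>k\<bar> = 1" using S[OF that] by (cases "k \<ge> 0") (auto simp: power_int_def power_inverse)
    moreover have "nat \<bar>k\<bar> > 0" using \<open>k \<noteq> 0\<close> by simp
    ultimately show False using False by blast
  qed
  then have "S \<subseteq> {0}" by blast
  then have "Gcd S = 0" by (simp only: Gcd_0_iff)
  then show ?thesis by (simp only: nat_0 power_0)
qed

lemma unit_complex_eq_1: "norm (u :: complex) = 1 \<Longrightarrow> Re u = 1 \<Longrightarrow> u = 1"
  by (simp add: complex_eq_iff cmod_def)

lemma Re_scale: "Re (complex_of_real r * x) = r * Re x"
  by simp

locale periodic_level_process = level_process +
  fixes p :: "nat \<Rightarrow> nat"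
  assumes period_pos: "0 < mad_period A M"
    and p_prop: "\<And>k i j. i < M \<Longrightarrow> j < M \<Longrightarrow> 0 < A k i j \<Longrightarrow>
          int (mad_period A M) dvd (int k - 1) - (int (p j) - int (p i))"
begin

abbreviation (input) "\<tau> \<equiv> mad_period A M"

text \<open>On the support of \<open>A k i j\<close> the phase function fixes \<open>k\<close>
  modulo \<open>\<tau>\<close>, so \<open>w ^ k\<close> factors out of the series. In matrix form,
  A*(s w) = w \<Delta>(w) A*(s) \<Delta>(w)^-1.\<close>

lemma Astar_rotated:
  assumes w: "w ^ \<tau> = 1" and ij: "i < M" "j < M" and s: "0 \<le> s" "s \<le> R"
  shows "Astar A (complex_of_real s * w) i j = w powi (1 + int (p j) - int (p i)) * complex_of_real (AstarR A s i j)"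
proof -
  have "(\<lambda>k. w powi (1 + int (p j) - int (p i)) * complex_of_real (s ^ k * A k i j)) sums
    (w powi (1 + int (p j) - int (p i)) * complex_of_real (AstarR A s i j))"
    unfolding AstarR_def using summable_A[OF ij s] by (intro sums_mult sums_of_real summable_sums)
  moreover have "w powi (1 + int (p j) - int (p i)) * complex_of_real (s ^ k * A k i j) =
    (complex_of_real s * w) ^ k * complex_of_real (A k i j)" for k
  proof (cases "A k i j > 0")
    case True
    have "w powi (int k) = w powi (1 + int (p j) - int (p i))"
      using p_prop[OF ij True] by (intro powi_cong_period[OF w period_pos]) (simp add: algebra_simps)
    then have "w powi (1 + int (p j) - int (p i)) = w ^ k" by simp
    then show ?thesis by (simp add: power_mult_distrib mult_ac)
  next
    case False
    then have "A k i j = 0" using A_nonneg[OF ij, of k] by simp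
    then show ?thesis by simp
  qed
  ultimately have "(\<lambda>k. (complex_of_real s * w) ^ k * complex_of_real (A k i j)) sums
    (w powi (1 + int (p j) - int (p i)) * complex_of_real (AstarR A s i j))" by (simp only:)
  then show ?thesis unfolding Astar_def by (rule sums_unique[symmetric])
qed

text \<open>Equality in the triangle inequality forces the phases of a left null vector to rotate with the
  Markov additive process, and a closed path then yields \<open>w^\<tau> = 1\<close>.\<close>

lemma left_null_vector:
  assumes w: "norm w = 1"
    and eig: "\<And>j. j < M \<Longrightarrow> (\<Sum>i<M. L i * Astar A (complex_of_real \<theta> * w) i j) = complex_of_real \<theta> * w * L j"
  shows "(\<forall>j<M. L j = 0) \<or> (w ^ \<tau> = 1 \<and> (\<exists>q. \<forall>j<M. L j = q * complex_of_real (\<mu> j) * w ^ p j))"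
proof -
  define \<zeta> where "\<zeta> = complex_of_real \<theta> * w"
  have n\<zeta>: "norm \<zeta> = \<theta>" using w theta by (simp add: \<zeta>_def norm_mult)
  have w0: "w \<noteq> 0" using w by auto
  interpret tr: irreducible_matrix M "\<lambda>i j. AstarR A \<theta> j i"
    by (rule irreducible_matrix.transpose[OF irreducible_AstarR]) (use theta in auto)
  have vtr: "(\<Sum>i<M. v i * AstarR A \<theta> j i) = \<theta> * v j" if "j < M" for j
    using v_eig[OF that] by (simp add: mult.commute)
  \<comment> \<open>The moduli of \<open>L\<close> satisfy the left eigenvalue inequality at
    \<theta>; pairing with \<open>v\<close> forces equality, so they are proportional to
    \<open>\<mu>\<close>.\<close>
  have "\<theta> * norm (L j) \<le> (\<Sum>i<M. AstarR A \<theta> i j * norm (L i))" if j: "j < M" for j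
  proof -
    have "norm \<zeta> * norm (L j) \<le> (\<Sum>i<M. (\<lambda>j i. AstarR A \<theta> i j) j i * norm (L i))"
    proof (rule norm_eigenvector_ge[where X = "\<lambda>j i. Astar A \<zeta> i j"])
      show "norm (Astar A \<zeta> i j) \<le> AstarR A \<theta> i j" if "i < M" for i
        using norm_Astar_le[OF that j, of \<zeta>] n\<zeta> theta by simp
      show "(\<Sum>i<M. Astar A \<zeta> i j * L i) = \<zeta> * L j" using eig[OF j] by (simp add: \<zeta>_def mult.commute)
    qed
    then show ?thesis by (simp add: n\<zeta>)
  qed
  then have neig: "(\<Sum>i<M. AstarR A \<theta> i j * norm (L i)) = \<theta> * norm (L j)" if "j < M" for j
    using left_positive_eq[of M v "\<lambda>i j. AstarR A \<theta> j i" \<theta> "\<lambda>i. norm (L i)" j] v_pos vtr that by blast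
  have "\<exists>c. \<forall>i<M. norm (L i) = c * \<mu> i"
    by (rule tr.eigenvector_unique[of \<mu> \<theta>]) (use mu_pos mu_eig neig in \<open>auto simp: mult.commute\<close>)
  then obtain c where c: "\<And>i. i < M \<Longrightarrow> norm (L i) = c * \<mu> i" by blast
  show ?thesis
  proof (cases "c = 0")
    case True
    then show ?thesis using c by auto
  next
    case False
    have Lnz: "L j \<noteq> 0" if "j < M" for j using c[OF that] False mu_pos[OF that] by auto
    define U where "U j = L j / complex_of_real (norm (L j))" for j
    have U: "norm (U j) = 1" "L j = complex_of_real (norm (L j)) * U j" if "j < M" for j
      using Lnz[OF that] by (auto simp: U_def norm_divide)
    have edge: "U j = U i * w powi (int k - 1)" if ij: "i < M" "j < M" and A: "0 < A k i j" for i j k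
    proof -
      \<comment> \<open>\<open>e i k\<close> compares the phase carried from \<open>i\<close> by a
        jump of index \<open>k\<close> with the phase required at \<open>j\<close>; the claim is
        that it equals 1 wherever \<open>A k i j > 0\<close>.\<close>
      define e where "e i k = U i * w ^ k * cnj (w * U j)" for i k
      have ne: "norm (e i k) = 1" if "i < M" for i k
        using U(1)[OF that] U(1)[OF ij(2)] w by (simp add: e_def norm_mult norm_power)
      define d where "d i k = \<theta> ^ k * A k i j * (1 - Re (e i k))" for i k
      have d0: "0 \<le> d i k" if "i < M" for i k
        using A_nonneg[OF that ij(2)] theta complex_Re_le_cmod[of "e i k"] ne[OF that, of k] by (simp add: d_def)
      have ds: "(\<lambda>k. d i k) sums (AstarR A \<theta> i j - Re (U i * cnj (w * U j) * Astar A \<zeta> i j))" if i: "i < M" for i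
      proof -
        have "(\<lambda>k. \<zeta> ^ k * complex_of_real (A k i j)) sums Astar A \<zeta> i j"
          unfolding Astar_def using summable_norm_cancel[OF summable_norm_A[OF i ij(2), of \<zeta>]] n\<zeta> theta
          by (intro summable_sums) auto
        then have "(\<lambda>k. Re (U i * cnj (w * U j) * (\<zeta> ^ k * complex_of_real (A k i j)))) sums
          Re (U i * cnj (w * U j) * Astar A \<zeta> i j)" by (intro sums_Re sums_mult)
        moreover have "(\<lambda>k. \<theta> ^ k * A k i j) sums AstarR A \<theta> i j"
          unfolding AstarR_def using summable_A[OF i ij(2)] theta by (intro summable_sums) auto
        ultimately have "(\<lambda>k. \<theta> ^ k * A k i j - Re (U i * cnj (w * U j) * (\<zeta> ^ k * complex_of_real (A k i j))))
          sums (AstarR A \<theta> i j - Re (U i * cnj (w * U j) * Astar A \<zeta> i j))" by (intro sums_diff)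
        moreover have "\<theta> ^ k * A k i j - Re (U i * cnj (w * U j) * (\<zeta> ^ k * complex_of_real (A k i j))) = d i k" for k
        proof -
          have "U i * cnj (w * U j) * (\<zeta> ^ k * complex_of_real (A k i j)) = complex_of_real (\<theta> ^ k * A k i j) * e i k"
            by (simp add: e_def \<zeta>_def power_mult_distrib mult_ac)
          then show ?thesis by (simp only: d_def Re_scale right_diff_distrib mult_1_right)
        qed
        ultimately show ?thesis by simp
      qed
      \<comment> \<open>Column \<open>j\<close> of the eigenvalue equation, multiplied by
        \<open>cnj (w * U j)\<close>, makes the nonnegative deficits add up to zero, so each of them
        vanishes.\<close>
      have "(\<Sum>i<M. norm (L i) * (\<Sum>k. d i k)) = 0"
      proof -
        have "(\<Sum>i<M. norm (L i) * (\<Sum>k. d i k)) =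
          (\<Sum>i<M. norm (L i) * AstarR A \<theta> i j - Re (cnj (w * U j) * (L i * Astar A \<zeta> i j)))"
        proof (intro sum.cong refl)
          fix i assume "i \<in> {..<M}"
          then have i: "i < M" by simp
          have "norm (L i) * (\<Sum>k. d i k) = norm (L i) * AstarR A \<theta> i j - norm (L i) * Re (U i * cnj (w * U j) * Astar A \<zeta> i j)"
            unfolding sums_unique[OF ds[OF i], symmetric] by (rule right_diff_distrib)
          also have "norm (L i) * Re (U i * cnj (w * U j) * Astar A \<zeta> i j) =
            Re (complex_of_real (norm (L i)) * (U i * cnj (w * U j) * Astar A \<zeta> i j))"
            by (rule Re_scale[symmetric])
          also have "complex_of_real (norm (L i)) * (U i * cnj (w * U j) * Astar A \<zeta> i j) = cnj (w * U j) * (L i * Astar A \<zeta> i j)"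
            by (subst (2) U(2)[OF i]) (simp add: mult_ac)
          finally show "norm (L i) * (\<Sum>k. d i k) = norm (L i) * AstarR A \<theta> i j - Re (cnj (w * U j) * (L i * Astar A \<zeta> i j))" .
        qed
        also have "\<dots> = (\<Sum>i<M. AstarR A \<theta> i j * norm (L i)) - Re (cnj (w * U j) * (\<Sum>i<M. L i * Astar A \<zeta> i j))"
          by (simp only: sum_subtractf sum_distrib_left Re_sum mult.commute[of "norm _"])
        also have "\<dots> = \<theta> * norm (L j) - Re (cnj (w * U j) * (\<zeta> * L j))"
          using neig[OF ij(2)] eig[OF ij(2)] by (simp add: \<zeta>_def)
        also have "cnj (w * U j) * (\<zeta> * L j) = complex_of_real (\<theta> * norm (L j)) * ((w * U j) * cnj (w * U j))"
          by (subst U(2)[OF ij(2)]) (simp add: \<zeta>_def mult_ac)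
        also have "(w * U j) * cnj (w * U j) = 1"
          using w U(1)[OF ij(2)] by (simp only: complex_norm_square[symmetric] norm_mult) simp
        finally show ?thesis by simp
      qed
      moreover have "0 \<le> norm (L i) * (\<Sum>k. d i k)" if "i < M" for i
        using d0[OF that] sums_summable[OF ds[OF that]] by (intro mult_nonneg_nonneg suminf_nonneg) auto
      ultimately have "norm (L i) * (\<Sum>k. d i k) = 0"
        using ij(1) sum_nonneg_eq_0_iff[of "{..<M}" "\<lambda>i. norm (L i) * (\<Sum>k. d i k)"] by auto
      then have "(\<Sum>k. d i k) = 0" using Lnz[OF ij(1)] by simp
      then have "d i k = 0"
        using suminf_eq_zero_iff[OF sums_summable[OF ds[OF ij(1)]]] d0[OF ij(1)] by auto
      then have "Re (e i k) = 1" using A theta by (simp add: d_def)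
      then have e1: "e i k = 1" using ne[OF ij(1)] by (intro unit_complex_eq_1)
      have "U i * w ^ k = U i * w ^ k * (cnj (w * U j) * (w * U j))"
        using w U(1)[OF ij(2)] by (simp only: complex_norm_square[symmetric] norm_mult mult.commute[of "cnj _"]) simp
      also have "\<dots> = e i k * (w * U j)" by (simp add: e_def mult_ac)
      finally have "U i * w ^ k = w * U j" by (simp add: e1)
      then show ?thesis using w0 by (simp add: power_int_diff field_simps)
    qed
    have step: "U b = U a * w powi (k1 - k0)" "a < M" "b < M" if "((k0, a), (k1, b)) \<in> mad_step A M" for k0 k1 a b
    proof -
      have *: "a < M" "b < M" "k1 - k0 \<ge> -1" "0 < A (nat (k1 - k0 + 1)) a b"
        using that by (auto simp: mad_step_def)
      show "a < M" "b < M" using * by auto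
      show "U b = U a * w powi (k1 - k0)" using edge[OF *(1,2,4)] *(3) by simp
    qed
    have path: "U (snd t) = U (snd s) * w powi (fst t - fst s)" if "(s, t) \<in> (mad_step A M)\<^sup>+" for s t
      using that
    proof (induction rule: trancl_induct)
      case (base t)
      then show ?case using step(1)[of "fst s" "snd s" "fst t" "snd t"] by simp
    next
      case (step t t')
      then have "U (snd t') = U (snd t) * w powi (fst t' - fst t)"
        using \<open>\<And>k1 k0 b a. ((k0, a), k1, b) \<in> mad_step A M \<Longrightarrow> U b = U a * w powi (k1 - k0)\<close>[of "fst t" "snd t" "fst t'" "snd t'"] by simp
      also have "U (snd t) = U (snd s) * w powi (fst t - fst s)" using step by simp
      finally show ?case using w0 by (simp add: mult.assoc flip: power_int_add)
    qed
    have "w powi k = 1" if "((0, 0), (k, 0)) \<in> (mad_step A M)\<^sup>+" for k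
      using path[OF that] U(1)[OF M_pos] by force
    then have wt: "w ^ \<tau> = 1" unfolding mad_period_def by (intro powi_Gcd_eq_1[OF w0]) auto
    \<comment> \<open>A jump multiplies the phase by \<open>w powi (int k - 1)\<close>, and
      \<open>w ^ \<tau> = 1\<close> reduces this exponent to the difference of the values of
      \<open>p\<close>; hence the product is the same for all phases.\<close>
    have "{..<M} \<subseteq> {j. U j * w powi (- int (p j)) = U 0 * w powi (- int (p 0))}"
    proof (rule irreducible_on_closed[OF A_irred, of 0])
      fix i j assume ij: "i \<in> {..<M}" "j \<in> {..<M}"
        "i \<in> {j. U j * w powi (- int (p j)) = U 0 * w powi (- int (p 0))}" "0 < msum A i j"
      have s: "summable (\<lambda>k. A k i j)" using summable_A[of i j 1] ij R_gt_1 by simp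
      obtain k where k: "0 < A k i j"
        using ij suminf_pos_iff[OF s] A_nonneg unfolding msum_def by auto
      have "U j * w powi (- int (p j)) = U i * (w powi (int k - 1) * w powi (- int (p j)))"
        using edge[OF _ _ k] ij by simp
      also have "w powi (int k - 1) * w powi (- int (p j)) = w powi (int k - 1 - int (p j))"
        using w0 by (simp flip: power_int_add)
      also have "\<dots> = w powi (- int (p i))"
        using p_prop[OF _ _ k] ij by (intro powi_cong_period[OF wt period_pos]) (simp add: algebra_simps)
      finally show "j \<in> {j. U j * w powi (- int (p j)) = U 0 * w powi (- int (p 0))}" using ij by simp
    qed (use M_pos in auto)
    then have Uj: "U j * w powi (- int (p j)) = U 0 * w powi (- int (p 0))" if "j < M" for j using that by auto
    have "L j = (complex_of_real c * (U 0 * w powi (- int (p 0)))) * complex_of_real (\<mu> j) * w ^ p j" if j: "j < M" for j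
    proof -
      have "L j = complex_of_real (c * \<mu> j) * U j" using U(2)[OF j] c[OF j] by simp
      also have "U j = U j * w powi (- int (p j)) * w ^ p j" using w0 by (simp add: power_int_minus)
      finally show ?thesis unfolding Uj[OF j] by (simp add: mult_ac)
    qed
    then show ?thesis using wt by blast
  qed
qed

lemma Astar_holomorphic: "i < M \<Longrightarrow> j < M \<Longrightarrow> (\<lambda>z. Astar A z i j) holomorphic_on ball 0 R"
  using summable_norm_cancel[OF summable_norm_A, of i j]
  by (intro power_series_holomorphic[of _ _ "\<lambda>k. complex_of_real (A k i j)"])
     (auto simp: Astar_def mult.commute intro!: summable_sums)

lemma rhs_holomorphic: "j < M \<Longrightarrow> (\<lambda>z. rhs z j) holomorphic_on ball 0 R"
proof -
  assume j: "j < M"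
  have "(\<lambda>z. bgf z j) holomorphic_on ball 0 R"
    by (rule power_series_holomorphic[of _ _ "\<lambda>k. complex_of_real (b k j)"]) (use bgf_sums j in auto)
  then show ?thesis unfolding rhs_def by (intro holomorphic_intros)
qed

lemma radial_tendsto:
  assumes "f holomorphic_on ball 0 R" "norm \<zeta> = \<theta>"
  shows "((\<lambda>t. f (complex_of_real t * \<zeta>)) \<longlongrightarrow> f \<zeta>) (at_left 1)"
proof -
  have "isCont f \<zeta>"
    using holomorphic_on_imp_continuous_on[OF assms(1)] assms(2) theta
    by (subst (asm) continuous_on_eq_continuous_at) auto
  then have "(f \<longlongrightarrow> f \<zeta>) (at \<zeta>)" by (simp add: isCont_def)
  moreover have "\<zeta> \<noteq> 0" using assms(2) theta by auto
  ultimately show ?thesis using radial_at_circle(1) filterlim_compose by blast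
qed

text \<open>Multiplying the functional equation by \<open>z - \<zeta>\<close> and letting
  \<open>z\<close> tend to \<open>\<zeta>\<close> radially removes \<open>rhs\<close>, so
  \<open>L\<close> is a left null vector and is known up to a factor. The factor comes from pairing
  the equation with the rotated vector \<open>v'\<close> before the limit: rotation reduces the
  defect of \<open>v'\<close> to a real function vanishing at \<theta>, whose derivative supplies
  \<open>1 - dd\<close>.\<close>

lemma residue_formula:
  assumes w: "norm w = 1" and \<zeta>: "\<zeta> = complex_of_real \<theta> * w"
    and L: "\<And>j. j < M \<Longrightarrow> ((\<lambda>t. (complex_of_real t * \<zeta> - \<zeta>) * X (complex_of_real t * \<zeta>) j) \<longlongrightarrow> L j) (at_left 1)"
  shows "w ^ \<tau> \<noteq> 1 \<Longrightarrow> j < M \<Longrightarrow> L j = 0"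
    and "w ^ \<tau> = 1 \<Longrightarrow> j < M \<Longrightarrow> L j = complex_of_real (\<mu> j) * w ^ p j *
      (\<Sum>j'<M. rhs \<zeta> j' * inverse (w ^ p j') * complex_of_real (v j')) / complex_of_real (1 - dd)"
proof -
  have n\<zeta>: "norm \<zeta> = \<theta>" using w theta by (simp add: \<zeta> norm_mult)
  have \<zeta>0: "\<zeta> \<noteq> 0" using n\<zeta> theta by auto
  have w0: "w \<noteq> 0" using w by auto
  define Z where "Z t = complex_of_real t * \<zeta>" for t
  have Zlim: "(Z \<longlongrightarrow> \<zeta>) (at_left 1)" unfolding Z_def by (rule tendsto_eq_intros refl | simp)+
  have ev: "\<forall>\<^sub>F t in at_left 1. 0 < t \<and> t < (1::real)" by (rule radial_at_circle(2)[OF \<zeta>0])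
  have nZ: "norm (Z t) < \<theta>" if "0 < t" "t < 1" for t
    using that theta n\<zeta> by (simp add: Z_def norm_mult)
  note L = L[folded Z_def]
  have eig: "(\<Sum>i<M. L i * Astar A \<zeta> i j) = \<zeta> * L j" if j: "j < M" for j
  proof -
    have lim_a: "((\<lambda>t. Z t * ((Z t - \<zeta>) * X (Z t) j) - (\<Sum>i<M. ((Z t - \<zeta>) * X (Z t) i) * Astar A (Z t) i j)) \<longlongrightarrow>
      \<zeta> * L j - (\<Sum>i<M. L i * Astar A \<zeta> i j)) (at_left 1)"
      using radial_tendsto[OF Astar_holomorphic n\<zeta>] j unfolding Z_def[symmetric]
      by (intro tendsto_diff tendsto_mult Zlim L tendsto_sum) auto
    have lim_b: "((\<lambda>t. (Z t - \<zeta>) * rhs (Z t) j) \<longlongrightarrow> (\<zeta> - \<zeta>) * rhs \<zeta> j) (at_left 1)"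
      using radial_tendsto[OF rhs_holomorphic[OF j] n\<zeta>] unfolding Z_def[symmetric]
      by (intro tendsto_diff tendsto_mult Zlim tendsto_const)
    have ev_eq: "\<forall>\<^sub>F t in at_left 1. (Z t - \<zeta>) * rhs (Z t) j =
      Z t * ((Z t - \<zeta>) * X (Z t) j) - (\<Sum>i<M. ((Z t - \<zeta>) * X (Z t) i) * Astar A (Z t) i j)"
      using ev
    proof eventually_elim
      case (elim t)
      then have "rhs (Z t) j = Z t * X (Z t) j - (\<Sum>i<M. X (Z t) i * Astar A (Z t) i j)"
        using X_eq[OF nZ j, of t] by simp
      then have "(Z t - \<zeta>) * rhs (Z t) j = (Z t - \<zeta>) * (Z t * X (Z t) j) - (Z t - \<zeta>) * (\<Sum>i<M. X (Z t) i * Astar A (Z t) i j)"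
        by (simp only: right_diff_distrib)
      then show ?case by (simp add: sum_distrib_left mult_ac)
    qed
    have "\<zeta> * L j - (\<Sum>i<M. L i * Astar A \<zeta> i j) = (\<zeta> - \<zeta>) * rhs \<zeta> j"
      by (rule tendsto_unique[OF trivial_limit_at_left_real lim_a Lim_transform_eventually[OF lim_b ev_eq]])
    then show ?thesis by simp
  qed
  have alt: "(\<forall>j<M. L j = 0) \<or> (w ^ \<tau> = 1 \<and> (\<exists>q. \<forall>j<M. L j = q * complex_of_real (\<mu> j) * w ^ p j))"
    using eig unfolding \<zeta> by (intro left_null_vector[OF w])
  then show "L j = 0" if "w ^ \<tau> \<noteq> 1" "j < M" using that by blast
  assume wt: "w ^ \<tau> = 1" and j: "j < M"
  obtain q where q: "\<And>j. j < M \<Longrightarrow> L j = q * complex_of_real (\<mu> j) * w ^ p j"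
    using alt by (metis mult_zero_left)
  \<comment> \<open>The entries of \<open>\<Delta>(w) v\<close>, the right null vector at
    \<open>\<zeta>\<close>.\<close>
  define v' where "v' j = inverse (w ^ p j) * complex_of_real (v j)" for j
  \<comment> \<open>The defect of \<open>v\<close> as an eigenvector at real \<open>s\<close>. It
    vanishes at \<theta> with derivative \<open>d\<close>, and dividing it by
    \<open>t * \<theta> - \<theta>\<close> absorbs the factor \<open>Z t - \<zeta>\<close>.\<close>
  define \<psi> where "\<psi> i s = s * v i - act s v i" for i s
  define d where "d i = v i - (\<Sum>j<M. dAstarR \<theta> i j * v j)" for i
  have \<psi>0: "\<psi> i \<theta> = 0" if "i < M" for i using v_eig[OF that] by (simp add: \<psi>_def)
  have "((\<lambda>t. \<psi> i (t * \<theta>) / (t * \<theta> - \<theta>)) \<longlongrightarrow> d i) (at_left 1)" if i: "i < M" for i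
  proof -
    have "(\<psi> i has_real_derivative (1 * v i - (\<Sum>j<M. dAstarR \<theta> i j * v j))) (at \<theta>)"
      unfolding \<psi>_def using AstarR_has_derivative i theta
      by (intro derivative_intros DERIV_cmult_right) auto
    then have "((\<lambda>s. \<psi> i s / (s - \<theta>)) \<longlongrightarrow> d i) (at \<theta>)"
      using \<psi>0[OF i] by (simp add: has_field_derivative_iff d_def)
    moreover have "filterlim (\<lambda>t. t * \<theta>) (at \<theta>) (at_left 1)"
    proof -
      have "((\<lambda>t. t * \<theta>) \<longlongrightarrow> 1 * \<theta>) (at_left 1)" by (intro tendsto_intros)
      moreover have "\<forall>\<^sub>F t in at_left 1. t * \<theta> \<noteq> \<theta>" using ev by eventually_elim (use theta in auto)
      ultimately show ?thesis by (simp add: filterlim_at)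
    qed
    ultimately show ?thesis by (rule filterlim_compose)
  qed
  then have lim1: "((\<lambda>t. \<Sum>i<M. ((Z t - \<zeta>) * X (Z t) i) * (inverse (w ^ p i) * complex_of_real (\<psi> i (t * \<theta>) / (t * \<theta> - \<theta>))))
    \<longlongrightarrow> (\<Sum>i<M. L i * (inverse (w ^ p i) * complex_of_real (d i)))) (at_left 1)"
    by (intro tendsto_sum tendsto_mult L tendsto_const tendsto_of_real) auto
  have lim2: "((\<lambda>t. \<Sum>j<M. rhs (Z t) j * v' j) \<longlongrightarrow> (\<Sum>j<M. rhs \<zeta> j * v' j)) (at_left 1)"
    using radial_tendsto[OF rhs_holomorphic n\<zeta>] unfolding Z_def[symmetric]
    by (intro tendsto_sum tendsto_mult tendsto_const) auto
  have ev_eq: "\<forall>\<^sub>F t in at_left 1. (\<Sum>i<M. ((Z t - \<zeta>) * X (Z t) i) * (inverse (w ^ p i) * complex_of_real (\<psi> i (t * \<theta>) / (t * \<theta> - \<theta>))))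
    = (\<Sum>j<M. rhs (Z t) j * v' j)"
    using ev
  proof eventually_elim
    case (elim t)
    have tt: "0 \<le> t * \<theta>" "t * \<theta> \<le> R" "t * \<theta> \<noteq> \<theta>"
    proof -
      have "t * \<theta> < 1 * \<theta>" using elim theta by (intro mult_strict_right_mono) auto
      then show "t * \<theta> \<le> R" "t * \<theta> \<noteq> \<theta>" using theta by linarith+
      show "0 \<le> t * \<theta>" using elim theta by simp
    qed
    have Zt: "Z t = complex_of_real (t * \<theta>) * w" by (simp add: Z_def \<zeta>)
    have phi: "Z t * v' i - (\<Sum>j<M. Astar A (Z t) i j * v' j) = w * inverse (w ^ p i) * complex_of_real (\<psi> i (t * \<theta>))"
      if i: "i < M" for i
    proof -
      have "Astar A (Z t) i j * v' j = w * inverse (w ^ p i) * complex_of_real (AstarR A (t * \<theta>) i j * v j)" if "j < M" for j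
      proof -
        have "w powi (1 + int (p j) - int (p i)) = w * w ^ p j * inverse (w ^ p i)"
          using w0 by (simp add: power_int_add power_int_diff divide_inverse)
        then show ?thesis unfolding Zt Astar_rotated[OF wt i that tt(1,2)] v'_def using w0 by (simp add: field_simps)
      qed
      then have "(\<Sum>j<M. Astar A (Z t) i j * v' j) = w * inverse (w ^ p i) * complex_of_real (\<Sum>j<M. AstarR A (t * \<theta>) i j * v j)"
        by (simp add: sum_distrib_left)
      then show ?thesis by (simp add: \<psi>_def Zt v'_def algebra_simps)
    qed
    have "(\<Sum>j<M. rhs (Z t) j * v' j) = (\<Sum>j<M. (Z t * X (Z t) j - (\<Sum>i<M. X (Z t) i * Astar A (Z t) i j)) * v' j)"
      using X_eq nZ elim by (intro sum.cong) auto
    also have "\<dots> = (\<Sum>i<M. X (Z t) i * (Z t * v' i)) - (\<Sum>j<M. \<Sum>i<M. X (Z t) i * (Astar A (Z t) i j * v' j))"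
      by (simp add: right_diff_distrib sum_subtractf sum_distrib_left mult_ac)
    also have "(\<Sum>j<M. \<Sum>i<M. X (Z t) i * (Astar A (Z t) i j * v' j)) = (\<Sum>i<M. X (Z t) i * (\<Sum>j<M. Astar A (Z t) i j * v' j))"
      by (subst sum.swap) (simp add: sum_distrib_left)
    also have "(\<Sum>i<M. X (Z t) i * (Z t * v' i)) - \<dots> = (\<Sum>i<M. X (Z t) i * (w * inverse (w ^ p i) * complex_of_real (\<psi> i (t * \<theta>))))"
      unfolding sum_subtractf[symmetric] right_diff_distrib[symmetric] by (intro sum.cong refl) (simp add: phi)
    also have "\<dots> = (\<Sum>i<M. ((Z t - \<zeta>) * X (Z t) i) * (inverse (w ^ p i) * complex_of_real (\<psi> i (t * \<theta>) / (t * \<theta> - \<theta>))))"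
    proof (intro sum.cong refl)
      fix i
      have zd: "Z t - \<zeta> = complex_of_real (t * \<theta> - \<theta>) * w" by (simp add: Zt \<zeta> algebra_simps)
      have "complex_of_real (\<psi> i (t * \<theta>)) = complex_of_real (t * \<theta> - \<theta>) * complex_of_real (\<psi> i (t * \<theta>) / (t * \<theta> - \<theta>))"
        using tt(3) by (simp flip: of_real_mult)
      then show "X (Z t) i * (w * inverse (w ^ p i) * complex_of_real (\<psi> i (t * \<theta>))) =
        ((Z t - \<zeta>) * X (Z t) i) * (inverse (w ^ p i) * complex_of_real (\<psi> i (t * \<theta>) / (t * \<theta> - \<theta>)))"
        unfolding zd by (simp only: mult_ac)
    qed
    finally show ?case by simp
  qed
  have "(\<Sum>j<M. rhs \<zeta> j * v' j) = (\<Sum>i<M. L i * (inverse (w ^ p i) * complex_of_real (d i)))"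
    by (rule tendsto_unique[OF trivial_limit_at_left_real lim2 Lim_transform_eventually[OF lim1 ev_eq]])
  also have "\<dots> = (\<Sum>i<M. q * complex_of_real (\<mu> i * d i))"
    using w0 by (intro sum.cong) (auto simp: q)
  also have "\<dots> = q * complex_of_real (\<Sum>i<M. \<mu> i * d i)" by (simp add: sum_distrib_left)
  also have "(\<Sum>i<M. \<mu> i * d i) = 1 - dd"
    by (simp add: d_def dd_def right_diff_distrib sum_subtractf mu_v)
  finally have "q = (\<Sum>j<M. rhs \<zeta> j * v' j) / complex_of_real (1 - dd)" using dd_gt_1 by (simp add: field_simps)
  then show "L j = complex_of_real (\<mu> j) * w ^ p j *
      (\<Sum>j'<M. rhs \<zeta> j' * inverse (w ^ p j') * complex_of_real (v j')) / complex_of_real (1 - dd)"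
    using q[OF j] by (simp add: v'_def mult_ac)
qed

end

section \<open>The killed kernel and divergence at \<theta>\<close>

context level_process
begin

text \<open>Since \<open>\<theta>^k v\<close> is harmonic for the free kernel, \<open>h = max (\<theta>^k v - max v) 0\<close> is subharmonic for the
  kernel killed at level 0. If \<open>y\<close> integrated \<open>h\<close>, invariance would force \<open>h\<close> to be harmonic and
  to vanish wherever level 0 feeds in, hence at every state.\<close>

lemma not_summable_at_theta:
  assumes y_pos: "\<And>k j. 1 \<le> k \<Longrightarrow> j < M \<Longrightarrow> 0 < y k j"
    and reach: "\<And>Z k j. (\<And>k j. 1 \<le> k \<Longrightarrow> j < M \<Longrightarrow> 0 < b k j \<Longrightarrow> (k, j) \<in> Z) \<Longrightarrow>
      (\<And>k i k' j. 1 \<le> k \<Longrightarrow> 1 \<le> k' \<Longrightarrow> i < M \<Longrightarrow> j < M \<Longrightarrow> (k, i) \<in> Z \<Longrightarrow> k \<le> k' + 1 \<Longrightarrow>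
         0 < A (k' + 1 - k) i j \<Longrightarrow> (k', j) \<in> Z) \<Longrightarrow> 1 \<le> k \<Longrightarrow> j < M \<Longrightarrow> (k, j) \<in> Z"
    and summ: "\<And>j. j < M \<Longrightarrow> summable (\<lambda>k. \<theta> ^ k * y k j)"
  shows False
proof -
  \<comment> \<open>Constants are harmonic for the stochastic free kernel, so subtracting
    \<open>vm\<close> preserves harmonicity. The maximum makes the difference nonpositive at level
    0, where cutting off at 0 then agrees with killing.\<close>
  define vm where "vm = Max (v ` {..<M})"
  have vm: "v j \<le> vm" if "j < M" for j unfolding vm_def using that by (intro Max_ge) auto
  have vm0: "0 < vm" using vm[OF M_pos] v_pos[OF M_pos] by linarith
  define h where "h k j = (if k = 0 then 0 else max (\<theta> ^ k * v j - vm) 0)" for k :: nat and j :: nat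
  have h0: "0 \<le> h k j" for k j by (simp add: h_def)
  have h_le: "h k j \<le> \<theta> ^ k * v j" if "j < M" for k j
    using v_pos[OF that] vm0 theta by (auto simp: h_def)
  have h_ge: "\<theta> ^ k * v j - vm \<le> h k j" if "j < M" for k j using vm[OF that] by (auto simp: h_def)
  have tab0: "0 \<le> (if l \<le> k + 1 then \<Sum>j<M. A (k + 1 - l) i j * h k j else 0)" if "i < M" for l k i
    using that A_nonneg h0 by (auto intro!: sum_nonneg)
  have tab_mono: "taboo h K l i \<le> taboo h K' l i" if "K \<le> K'" "i < M" for K K' l i
    unfolding taboo_def using that tab0 by (intro sum_mono2) auto
  have tab_bd: "taboo h K l i \<le> \<theta> ^ l * v i" if l: "1 \<le> l" and i: "i < M" for K l i
  proof -
    have "taboo h K l i \<le> \<theta> ^ (l - 1) * act \<theta> v i"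
    proof (rule taboo_le[OF l i])
      fix k j assume "j < M" "l \<le> k + 1"
      have "l - 1 + (k + 1 - l) = k" using l \<open>l \<le> k + 1\<close> by simp
      then have "\<theta> ^ (l - 1) * \<theta> ^ (k + 1 - l) = \<theta> ^ k" by (simp flip: power_add)
      then show "h k j \<le> \<theta> ^ (l - 1) * (\<theta> ^ (k + 1 - l) * v j)"
        using h_le[OF \<open>j < M\<close>] by (simp flip: mult.assoc)
    qed (use theta v_pos in \<open>auto simp: less_imp_le\<close>)
    also have "\<dots> = \<theta> ^ Suc (l - 1) * v i" using v_eig[OF i] by simp
    finally show ?thesis using l by simp
  qed
  have "\<exists>q. (\<lambda>K. taboo h K l i) \<longlonglongrightarrow> q" if "1 \<le> l" "i < M" for l i
  proof -
    have "incseq (\<lambda>K. taboo h K l i)" using tab_mono that by (auto simp: incseq_def)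
    then show ?thesis using incseq_convergent[of "\<lambda>K. taboo h K l i" "\<theta> ^ l * v i"] tab_bd[OF that] by blast
  qed
  \<comment> \<open>\<open>Q\<close> is the full killed kernel applied to \<open>h\<close>, as the
    increasing limit of its truncations.\<close>
  then obtain Q where Q: "\<And>l i. 1 \<le> l \<Longrightarrow> i < M \<Longrightarrow> (\<lambda>K. taboo h K l i) \<longlonglongrightarrow> Q l i" by metis
  have tab_le_Q: "taboo h K l i \<le> Q l i" if "1 \<le> l" "i < M" for K l i
    using tab_mono that by (intro incseq_le[OF _ Q]) (auto simp: incseq_def)
  have sub: "h l i \<le> Q l i" if l: "1 \<le> l" and i: "i < M" for l i
  proof -
    define F where "F n = (\<Sum>j<M. \<theta> ^ (l - 1) * (\<theta> ^ n * A n i j * v j) - vm * A n i j)" for n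
    have "F sums (\<Sum>j<M. \<theta> ^ (l - 1) * (AstarR A \<theta> i j * v j) - vm * AstarR A 1 i j)"
      unfolding F_def
    proof (intro sums_sum sums_diff sums_mult)
      fix j assume "j \<in> {..<M}"
      then have j: "j < M" by simp
      show "(\<lambda>n. \<theta> ^ n * A n i j * v j) sums (AstarR A \<theta> i j * v j)"
        unfolding AstarR_def using theta i j by (intro sums_mult2 summable_sums summable_A) auto
      show "(\<lambda>n. A n i j) sums (AstarR A 1 i j)"
        unfolding AstarR_def using summable_sums[OF summable_A[OF i j, of 1]] R_gt_1 by simp
    qed
    moreover have "(\<Sum>j<M. \<theta> ^ (l - 1) * (AstarR A \<theta> i j * v j) - vm * AstarR A 1 i j) = \<theta> ^ l * v i - vm"
    proof -
      have "(\<Sum>j<M. \<theta> ^ (l - 1) * (AstarR A \<theta> i j * v j) - vm * AstarR A 1 i j) =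
        \<theta> ^ (l - 1) * act \<theta> v i - vm * (\<Sum>j<M. AstarR A 1 i j)"
        by (simp add: sum_subtractf sum_distrib_left)
      also have "\<dots> = \<theta> ^ Suc (l - 1) * v i - vm" using v_eig[OF i] stochastic[OF i] by simp
      finally show ?thesis using l by simp
    qed
    ultimately have Fs: "(\<lambda>n. \<Sum>k<n. F k) \<longlonglongrightarrow> \<theta> ^ l * v i - vm" by (simp add: sums_def)
    have "(\<lambda>K. \<Sum>n<K + 2. F n) \<longlonglongrightarrow> \<theta> ^ l * v i - vm" by (rule LIMSEQ_ignore_initial_segment[OF Fs])
    moreover have "(\<lambda>K. taboo h (K + l) l i) \<longlonglongrightarrow> Q l i" by (rule LIMSEQ_ignore_initial_segment[OF Q[OF that]])
    \<comment> \<open>Starting at level \<open>l\<close>, targets up to level \<open>K + l\<close>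
      correspond to jump indices below \<open>K + 2\<close>.\<close>
    moreover have "(\<Sum>n<K + 2. F n) \<le> taboo h (K + l) l i" for K
    proof -
      have "(\<Sum>n<K + 2. F n) = (\<Sum>k\<le>K + l. if l \<le> k + 1 then F (k + 1 - l) else 0)"
        using sum_shifted_index[OF l, of F "K + l"] by simp
      also have "\<dots> \<le> taboo h (K + l) l i" unfolding taboo_def
      proof (intro sum_mono)
        fix k
        show "(if l \<le> k + 1 then F (k + 1 - l) else 0) \<le> (if l \<le> k + 1 then \<Sum>j<M. A (k + 1 - l) i j * h k j else 0)"
        proof (cases "l \<le> k + 1")
          case True
          have "l - 1 + (k + 1 - l) = k" using l True by simp
          then have pow: "\<theta> ^ (l - 1) * \<theta> ^ (k + 1 - l) = \<theta> ^ k" by (simp flip: power_add)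
          have "F (k + 1 - l) = (\<Sum>j<M. A (k + 1 - l) i j * (\<theta> ^ k * v j - vm))"
            unfolding F_def pow[symmetric] by (simp add: algebra_simps)
          also have "\<dots> \<le> (\<Sum>j<M. A (k + 1 - l) i j * h k j)"
            using A_nonneg[OF i] h_ge by (intro sum_mono mult_left_mono) auto
          finally show ?thesis using True by simp
        qed auto
      qed
      finally show ?thesis .
    qed
    ultimately have 1: "\<theta> ^ l * v i - vm \<le> Q l i" by (intro LIMSEQ_le) auto
    have "0 \<le> taboo h 0 l i" unfolding taboo_def using tab0[OF i] by (intro sum_nonneg) blast
    then have "0 \<le> Q l i" using tab_le_Q[OF that, of 0] by linarith
    then show ?thesis using 1 l by (simp add: h_def)
  qed
  have yh0: "0 \<le> (\<Sum>j<M. y k j * h k j)" for k using y_nonneg h0 by (intro sum_nonneg) auto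
  have yh_summ: "summable (\<lambda>k. \<Sum>j<M. y k j * h k j)"
  proof (rule summable_comparison_test')
    show "summable (\<lambda>k. \<Sum>j<M. \<theta> ^ k * y k j * v j)" by (intro summable_sum summable_mult2 summ) auto
    fix k
    have "(\<Sum>j<M. y k j * h k j) \<le> (\<Sum>j<M. y k j * (\<theta> ^ k * v j))"
      using y_nonneg h_le by (intro sum_mono mult_left_mono) auto
    then show "norm (\<Sum>j<M. y k j * h k j) \<le> (\<Sum>j<M. \<theta> ^ k * y k j * v j)" using yh0[of k] by (simp add: mult_ac)
  qed
  define Y where "Y = (\<Sum>k. \<Sum>j<M. y k j * h k j)"
  \<comment> \<open>In total, invariance gives \<open>b h + y Q \<le> y h\<close> while
    \<open>h \<le> Q\<close>; since \<open>Y\<close> is finite, no single surplus can be positive.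
    Two limits are taken: \<open>K\<close> first, over a fixed block of levels up to
    \<open>L\<close>, and then \<open>L\<close>.\<close>
  have key: "b k0 j0 * h k0 j0 + y l0 i0 * (Q l0 i0 - h l0 i0) \<le> 0"
    if "1 \<le> k0" "j0 < M" "1 \<le> l0" "i0 < M" for k0 j0 l0 i0
  proof -
    have 1: "b k0 j0 * h k0 j0 + (\<Sum>l\<le>L. \<Sum>i<M. y l i * Q l i) \<le> Y" if L: "k0 \<le> L" for L
    proof (rule LIMSEQ_le_const2)
      have "(\<lambda>K. y l i * taboo h K l i) \<longlonglongrightarrow> y l i * Q l i" if "i < M" for l i
        using Q[of l i] y_0 that by (cases "l = 0") (auto intro: tendsto_mult)
      then show "(\<lambda>K. b k0 j0 * h k0 j0 + (\<Sum>l\<le>L. \<Sum>i<M. y l i * taboo h K l i)) \<longlonglongrightarrow>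
        b k0 j0 * h k0 j0 + (\<Sum>l\<le>L. \<Sum>i<M. y l i * Q l i)" by (intro tendsto_add tendsto_const tendsto_sum) auto
      have "b k0 j0 * h k0 j0 + (\<Sum>l\<le>L. \<Sum>i<M. y l i * taboo h K l i) \<le> Y" if K: "L \<le> K" for K
      proof -
        have "b k0 j0 * h k0 j0 \<le> (\<Sum>j<M. b k0 j * h k0 j)"
          using \<open>j0 < M\<close> b_nonneg h0 by (intro member_le_sum) auto
        also have "\<dots> \<le> (\<Sum>k\<le>K. \<Sum>j<M. b k j * h k j)"
          using L K b_nonneg h0 by (intro member_le_sum) (auto intro!: sum_nonneg)
        finally have "b k0 j0 * h k0 j0 \<le> (\<Sum>k\<le>K. \<Sum>j<M. b k j * h k j)" .
        moreover have "(\<Sum>l\<le>L. \<Sum>i<M. y l i * taboo h K l i) \<le> (\<Sum>l\<le>K + 1. \<Sum>i<M. y l i * taboo h K l i)"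
          using K y_nonneg tab0 by (intro sum_mono2) (auto intro!: sum_nonneg mult_nonneg_nonneg simp: taboo_def)
        moreover have "(\<Sum>k\<le>K. \<Sum>j<M. y k j * h k j) =
          (\<Sum>k\<le>K. \<Sum>j<M. b k j * h k j) + (\<Sum>l\<le>K + 1. \<Sum>i<M. y l i * taboo h K l i)"
          by (rule level_sum) (simp add: h_def)
        moreover have "(\<Sum>k\<le>K. \<Sum>j<M. y k j * h k j) \<le> Y"
          unfolding Y_def using yh0 by (intro sum_le_suminf yh_summ) auto
        ultimately show ?thesis by linarith
      qed
      then show "\<exists>N. \<forall>n\<ge>N. b k0 j0 * h k0 j0 + (\<Sum>l\<le>L. \<Sum>i<M. y l i * taboo h n l i) \<le> Y" by blast
    qed
    have 2: "b k0 j0 * h k0 j0 + y l0 i0 * (Q l0 i0 - h l0 i0) + (\<Sum>l\<le>L. \<Sum>i<M. y l i * h l i) \<le> Y"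
      if L: "k0 + l0 \<le> L" for L
    proof -
      have nn: "0 \<le> y l i * (Q l i - h l i)" if "i < M" for l i
        using sub[of l i] y_0 y_nonneg that by (cases "l = 0") auto
      have "y l0 i0 * (Q l0 i0 - h l0 i0) \<le> (\<Sum>i<M. y l0 i * (Q l0 i - h l0 i))"
        using \<open>i0 < M\<close> nn by (intro member_le_sum[of _ _ "\<lambda>i. y l0 i * (Q l0 i - h l0 i)"]) auto
      also have "\<dots> \<le> (\<Sum>l\<le>L. \<Sum>i<M. y l i * (Q l i - h l i))"
        using L nn by (intro member_le_sum[of _ _ "\<lambda>l. \<Sum>i<M. y l i * (Q l i - h l i)"]) (auto intro!: sum_nonneg)
      also have "\<dots> = (\<Sum>l\<le>L. \<Sum>i<M. y l i * Q l i) - (\<Sum>l\<le>L. \<Sum>i<M. y l i * h l i)"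
        by (simp add: right_diff_distrib sum_subtractf)
      finally show ?thesis using 1[of L] L by simp
    qed
    have "b k0 j0 * h k0 j0 + y l0 i0 * (Q l0 i0 - h l0 i0) + Y \<le> Y"
    proof (rule LIMSEQ_le_const2)
      have "(\<lambda>L. \<Sum>l\<le>L. \<Sum>i<M. y l i * h l i) \<longlonglongrightarrow> Y"
        unfolding Y_def by (rule summable_LIMSEQ'[OF yh_summ])
      then show "(\<lambda>L. b k0 j0 * h k0 j0 + y l0 i0 * (Q l0 i0 - h l0 i0) + (\<Sum>l\<le>L. \<Sum>i<M. y l i * h l i)) \<longlonglongrightarrow>
        b k0 j0 * h k0 j0 + y l0 i0 * (Q l0 i0 - h l0 i0) + Y" by (intro tendsto_intros)
    qed (use 2 in blast)
    then show ?thesis by simp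
  qed
  have Q_eq: "Q l i = h l i" if "1 \<le> l" "i < M" for l i
  proof -
    have "0 \<le> b 1 0 * h 1 0" using b_nonneg[OF M_pos] h0 by simp
    then have "y l i * (Q l i - h l i) \<le> 0" using key[of 1 0 l i] M_pos that by simp
    then show ?thesis using y_pos[OF that] sub[OF that] by (simp add: mult_le_0_iff)
  qed
  have b_h: "h k j = 0" if "1 \<le> k" "j < M" "0 < b k j" for k j
    using key[of k j 1 0] Q_eq[of 1 0] M_pos that h0[of k j] by (simp add: mult_le_0_iff)
  \<comment> \<open>Where \<open>h\<close> vanishes so does \<open>Q\<close>, hence \<open>h\<close>
    vanishes at every successor. The zero set contains the entry points from level 0 and is closed
    under the kernel.\<close>
  have all0: "h k j = 0" if "1 \<le> k" "j < M" for k j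
  proof -
    have "(k, j) \<in> {(k, j). h k j = 0}"
    proof (rule reach)
      fix k i k' j assume *: "1 \<le> k" "1 \<le> k'" "i < M" "j < M" "(k, i) \<in> {(k, j). h k j = 0}" "k \<le> k' + 1"
        "0 < A (k' + 1 - k) i j"
      have "A (k' + 1 - k) i j * h k' j \<le> (\<Sum>j<M. A (k' + 1 - k) i j * h k' j)"
        using * A_nonneg h0 by (intro member_le_sum) auto
      also have "\<dots> = (if k \<le> k' + 1 then \<Sum>j<M. A (k' + 1 - k) i j * h k' j else 0)" using * by simp
      also have "\<dots> \<le> taboo h k' k i" unfolding taboo_def
        using tab0[OF *(3)] by (intro member_le_sum[of k' "{..k'}" "\<lambda>k'. if k \<le> k' + 1 then \<Sum>j<M. A (k' + 1 - k) i j * h k' j else 0"]) auto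
      also have "\<dots> \<le> 0" using tab_le_Q[OF *(1,3), of k'] Q_eq[OF *(1,3)] * by simp
      finally show "(k', j) \<in> {(k, j). h k j = 0}" using *(7) h0[of k' j] by (simp add: mult_le_0_iff)
    qed (use b_h that in auto)
    then show ?thesis by simp
  qed
  \<comment> \<open>The contradiction: as \<open>\<theta> > 1\<close>, \<open>h\<close> is positive
    at high levels.\<close>
  obtain n where n: "vm / v 0 < \<theta> ^ n" using real_arch_pow[OF theta(1)] by blast
  have "\<theta> ^ n \<le> \<theta> ^ Suc n" using theta by (intro power_increasing) auto
  then have "vm / v 0 < \<theta> ^ Suc n" using n by linarith
  then have "vm < \<theta> ^ Suc n * v 0" using v_pos[OF M_pos] by (simp add: pos_divide_less_eq)
  then show False using all0[of "Suc n" 0] M_pos by (simp add: h_def)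
qed

end

section \<open>Tail asymptotics\<close>

lemma omega_power: "omega n ^ k = cis (2 * pi * real k / real n)"
proof -
  have "omega n ^ k = cis (real k * (2 * pi / real n))" unfolding omega_def by (rule Complex.DeMoivre)
  also have "real k * (2 * pi / real n) = 2 * pi * real k / real n" by simp
  finally show ?thesis .
qed

lemma omega_roots: "0 < n \<Longrightarrow> bij_betw (\<lambda>k. omega n ^ k) {..<n} {z. z ^ n = 1}"
  using Complex.bij_betw_roots_unity[of n] by (simp add: omega_power)

lemma norm_omega_power: "norm (omega n ^ k) = 1"
  by (simp add: omega_power)

context periodic_level_process
begin

abbreviation (input) rot :: "nat \<Rightarrow> complex" where "rot \<nu> \<equiv> omega \<tau> ^ \<nu>"

text \<open>Normalised so that the residue of \<open>X\<close> at
  \<open>\<zeta> = \<theta> w\<close>, in phase \<open>j\<close>, is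
  \<open>- \<zeta> * \<mu> j * w ^ p j * amp w\<close>; the factor \<open>\<zeta>\<close> comes from
  \<open>rhs\<close>.\<close>

definition amp :: "complex \<Rightarrow> complex" where
  "amp w = (\<Sum>j'<M. (bgf (complex_of_real \<theta> * w) j' - complex_of_real (\<Sum>i<M. y 1 i * A 0 i j'))
     * inverse (w ^ p j') * complex_of_real (v j')) / complex_of_real (dd - 1)"

lemma level_asymptotics:
  obtains r C where "\<theta> < r" "0 \<le> C"
    "\<And>k j. j < M \<Longrightarrow> norm (complex_of_real (y k j) -
      (\<Sum>\<nu><\<tau>. complex_of_real (\<mu> j) * rot \<nu> ^ p j * amp (rot \<nu>) / (complex_of_real \<theta> * rot \<nu>) ^ k))
      \<le> C / r ^ k"
proof -
  define f where "f z i j = (if i = j then z else 0) - Astar A z i j" for z i j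
  have "(\<lambda>z. f z i j) holomorphic_on ball 0 R" if "i < M" "j < M" for i j
    unfolding f_def using Astar_holomorphic[OF that] by (cases "i = j") (auto intro!: holomorphic_intros)
  then obtain D Adj where D: "D holomorphic_on ball 0 R"
    and Adj: "\<And>i j. i < M \<Longrightarrow> j < M \<Longrightarrow> (\<lambda>z. Adj z i j) holomorphic_on ball 0 R"
    and adj: "\<And>z i k. i < M \<Longrightarrow> k < M \<Longrightarrow> (\<Sum>j<M. f z i j * Adj z j k) = (if i = k then D z else 0)"
    and ker: "\<And>z. D z = 0 \<Longrightarrow> \<exists>u. (\<exists>i<M. u i \<noteq> 0) \<and> (\<forall>i<M. (\<Sum>j<M. f z i j * u j) = 0)"
    by (rule holomorphic_adjugate[of M f "ball 0 R"]) blast+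
  have fsum: "(\<Sum>j<M. f z i j * u j) = z * u i - (\<Sum>j<M. Astar A z i j * u j)" if "i < M" for z i u
    unfolding f_def using that by (simp add: left_diff_distrib sum_subtractf if_distrib[of "\<lambda>a. a * _"] sum.delta cong: if_cong)
  obtain z0 C0 where z0: "1 < z0" "z0 < \<theta>" "Perron z0 < z0"
    and growth: "\<And>z :: complex. \<And>j. z0 \<le> norm z \<Longrightarrow> norm z < \<theta> \<Longrightarrow> j < M \<Longrightarrow> norm (X z j) \<le> C0 / (\<theta> - norm z)"
    by (rule X_growth) blast
  \<comment> \<open>A kernel vector would make \<open>z0\<close> an eigenvalue of A*(z0), beyond its
    Perron root.\<close>
  have D0: "D (complex_of_real z0) \<noteq> 0"
  proof
    assume "D (complex_of_real z0) = 0"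
    then obtain u where u: "\<exists>i<M. u i \<noteq> 0" "\<And>i. i < M \<Longrightarrow> (\<Sum>j<M. f (complex_of_real z0) i j * u j) = 0"
      using ker by blast
    have "is_eigenvalue M (Astar A (complex_of_real z0)) (complex_of_real z0)"
      unfolding is_eigenvalue_def using u fsum[of _ "complex_of_real z0" u] by (intro exI[of _ u]) auto
    then have "norm (complex_of_real z0) \<le> Perron (norm (complex_of_real z0))"
      using z0 theta by (intro eigenvalue_Astar_le_Perron) auto
    then show False using z0 by simp
  qed
  have XD: "X z j * D z = (\<Sum>i<M. rhs z i * Adj z i j)" if z: "norm z < \<theta>" and j: "j < M" for z j
  proof -
    have r: "rhs z i = (\<Sum>l<M. X z l * f z l i)" if i: "i < M" for i
    proof -
      have "(\<Sum>l<M. X z l * f z l i) = z * X z i - (\<Sum>l<M. X z l * Astar A z l i)"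
        unfolding f_def using i
        by (simp add: right_diff_distrib sum_subtractf if_distrib[of "\<lambda>a. _ * a"] sum.delta' mult.commute cong: if_cong)
      then show ?thesis using X_eq[OF z i] by simp
    qed
    have "(\<Sum>i<M. rhs z i * Adj z i j) = (\<Sum>i<M. \<Sum>l<M. X z l * (f z l i * Adj z i j))"
      by (simp add: r sum_distrib_right mult.assoc)
    also have "\<dots> = (\<Sum>l<M. X z l * (\<Sum>i<M. f z l i * Adj z i j))"
      by (subst sum.swap) (simp add: sum_distrib_left)
    also have "\<dots> = (\<Sum>l<M. X z l * (if l = j then D z else 0))" using adj j by simp
    also have "\<dots> = X z j * D z" using j by (simp add: if_distrib[of "\<lambda>a. _ * a"] cong: if_cong)
    finally show ?thesis by simp
  qed
  \<comment> \<open>The pole set, residues and radius come separately for each phase; bundling them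
    allows a simultaneous choice.\<close>
  define good where "good j Z L r C' \<longleftrightarrow> finite Z \<and> (\<forall>\<zeta>\<in>Z. norm \<zeta> = \<theta>) \<and> \<theta> < r \<and>
    (\<forall>\<zeta>. norm \<zeta> = \<theta> \<longrightarrow> ((\<lambda>t. (complex_of_real t * \<zeta> - \<zeta>) * X (complex_of_real t * \<zeta>) j) \<longlongrightarrow> L \<zeta>) (at_left 1)) \<and>
    (\<forall>\<zeta>. norm \<zeta> = \<theta> \<longrightarrow> \<zeta> \<notin> Z \<longrightarrow> L \<zeta> = 0) \<and>
    (\<forall>k. norm (complex_of_real (y k j) + (\<Sum>\<zeta>\<in>Z. L \<zeta> / \<zeta> ^ Suc k)) \<le> C' / r ^ k)" for j Z L r C'
  have "\<exists>Z L r C'. good j Z L r C'" if j: "j < M" for j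
  proof -
    have N: "(\<lambda>z. \<Sum>i<M. rhs z i * Adj z i j) holomorphic_on ball 0 R"
      using j by (intro holomorphic_intros rhs_holomorphic Adj) auto
    have th0: "0 < \<theta>" using theta by simp
    have nz0: "norm (complex_of_real z0) < R" using z0 theta by simp
    show ?thesis
      by (rule simple_pole_coefficient_asymptotics[of \<theta> R "\<lambda>k. complex_of_real (y k j)" "\<lambda>z. X z j" D
            "\<lambda>z. \<Sum>i<M. rhs z i * Adj z i j" "complex_of_real z0" z0 C0,
            OF th0 theta(2) X_sums[OF _ j] D N XD[OF _ j] nz0 D0 growth[OF _ _ j] z0(2)])
        (assumption+, unfold good_def, intro exI conjI ballI allI impI)
  qed
  then obtain Z L rj Cj where good: "\<And>j. j < M \<Longrightarrow> good j (Z j) (L j) (rj j) (Cj j)" by metis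
  have finZ: "finite (Z j)" and Zn: "\<And>\<zeta>. \<zeta> \<in> Z j \<Longrightarrow> norm \<zeta> = \<theta>" and rj: "\<theta> < rj j"
    and Llim: "\<And>\<zeta>. norm \<zeta> = \<theta> \<Longrightarrow> ((\<lambda>t. (complex_of_real t * \<zeta> - \<zeta>) * X (complex_of_real t * \<zeta>) j) \<longlongrightarrow> L j \<zeta>) (at_left 1)"
    and L0: "\<And>\<zeta>. norm \<zeta> = \<theta> \<Longrightarrow> \<zeta> \<notin> Z j \<Longrightarrow> L j \<zeta> = 0"
    and bound: "\<And>k. norm (complex_of_real (y k j) + (\<Sum>\<zeta>\<in>Z j. L j \<zeta> / \<zeta> ^ Suc k)) \<le> Cj j / rj j ^ k"
    if "j < M" for j using good[OF that] unfolding good_def by blast+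
  define \<zeta>f where "\<zeta>f \<nu> = complex_of_real \<theta> * rot \<nu>" for \<nu> :: nat
  have n\<zeta>f: "norm (\<zeta>f \<nu>) = \<theta>" for \<nu> unfolding \<zeta>f_def using theta norm_omega_power by (simp add: norm_mult del: norm_power)
  have roots: "bij_betw (\<lambda>k. omega \<tau> ^ k) {..<\<tau>} {z. z ^ \<tau> = 1}" by (rule omega_roots[OF period_pos])
  have inj: "inj_on \<zeta>f {..<\<tau>}"
    using roots theta unfolding bij_betw_def inj_on_def \<zeta>f_def by auto
  have off: "L j \<zeta> = 0" if j: "j < M" and \<zeta>: "norm \<zeta> = \<theta>" "\<zeta> \<notin> \<zeta>f ` {..<\<tau>}" for j \<zeta>
  proof -
    define w where "w = \<zeta> / complex_of_real \<theta>"
    have w: "norm w = 1" "\<zeta> = complex_of_real \<theta> * w" using \<zeta> theta by (auto simp: w_def norm_divide)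
    have "w ^ \<tau> \<noteq> 1"
    proof
      assume "w ^ \<tau> = 1"
      then have "w \<in> (\<lambda>k. omega \<tau> ^ k) ` {..<\<tau>}" using roots by (simp add: bij_betw_def)
      then show False using \<zeta>(2) w(2) by (auto simp: \<zeta>f_def)
    qed
    then show ?thesis
      using residue_formula(1)[OF w, of "\<lambda>j. L j \<zeta>" j] Llim[OF _ \<zeta>(1)] j by blast
  qed
  have on: "L j (\<zeta>f \<nu>) / \<zeta>f \<nu> ^ Suc k = - (complex_of_real (\<mu> j) * rot \<nu> ^ p j * amp (rot \<nu>) / \<zeta>f \<nu> ^ k)"
    if j: "j < M" and \<nu>: "\<nu> < \<tau>" for j \<nu> k
  proof -
    define w where "w = rot \<nu>"
    have w: "norm w = 1" "\<zeta>f \<nu> = complex_of_real \<theta> * w" using norm_omega_power by (auto simp: w_def \<zeta>f_def)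
    have wt: "w ^ \<tau> = 1" using roots \<nu> unfolding w_def bij_betw_def by auto
    have \<zeta>0: "\<zeta>f \<nu> \<noteq> 0" using n\<zeta>f[of \<nu>] theta by auto
    have "L j (\<zeta>f \<nu>) = complex_of_real (\<mu> j) * w ^ p j *
      (\<Sum>j'<M. rhs (\<zeta>f \<nu>) j' * inverse (w ^ p j') * complex_of_real (v j')) / complex_of_real (1 - dd)"
      using residue_formula(2)[OF w, of "\<lambda>j. L j (\<zeta>f \<nu>)" j] Llim[OF _ n\<zeta>f] j wt by blast
    also have "(\<Sum>j'<M. rhs (\<zeta>f \<nu>) j' * inverse (w ^ p j') * complex_of_real (v j')) = \<zeta>f \<nu> * (amp w * complex_of_real (dd - 1))"
    proof -
      have cancel: "a / c * c = a" if "c \<noteq> 0" for a c :: complex using that by simp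
      have "complex_of_real (dd - 1) \<noteq> 0" using dd_gt_1 by simp
      then have "amp w * complex_of_real (dd - 1) = (\<Sum>j'<M. (bgf (\<zeta>f \<nu>) j' - complex_of_real (\<Sum>i<M. y 1 i * A 0 i j'))
        * inverse (w ^ p j') * complex_of_real (v j'))" unfolding amp_def w(2) by (rule cancel)
      then show ?thesis unfolding rhs_def by (simp only: sum_distrib_left mult.assoc)
    qed
    also have "complex_of_real (1 - dd) = - complex_of_real (dd - 1)" by simp
    also have "complex_of_real (\<mu> j) * w ^ p j * (\<zeta>f \<nu> * (amp w * complex_of_real (dd - 1))) / - complex_of_real (dd - 1)
      = - (\<zeta>f \<nu> * (complex_of_real (\<mu> j) * w ^ p j * amp w))"
    proof -
      have cancel: "a * (z * (k * d)) / - d = - (z * (a * k))" if "d \<noteq> 0" for a z k d :: complex using that by simp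
      show ?thesis by (rule cancel) (use dd_gt_1 in simp)
    qed
    finally have "L j (\<zeta>f \<nu>) = - (\<zeta>f \<nu> * (complex_of_real (\<mu> j) * w ^ p j * amp w))" .
    then show ?thesis unfolding w_def[symmetric] using \<zeta>0 by simp
  qed
  \<comment> \<open>\<open>Z j\<close> and the rotations of \<theta> need not coincide. Both sums
    extend to the union: residues vanish off \<open>Z j\<close> by construction, and off the
    rotations by the residue formula.\<close>
  have sumZ: "(\<Sum>\<zeta>\<in>Z j. L j \<zeta> / \<zeta> ^ Suc k) =
    - (\<Sum>\<nu><\<tau>. complex_of_real (\<mu> j) * rot \<nu> ^ p j * amp (rot \<nu>) / \<zeta>f \<nu> ^ k)" if j: "j < M" for j k
  proof -
    have "(\<Sum>\<zeta>\<in>Z j. L j \<zeta> / \<zeta> ^ Suc k) = (\<Sum>\<zeta>\<in>Z j \<union> \<zeta>f ` {..<\<tau>}. L j \<zeta> / \<zeta> ^ Suc k)"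
      using finZ[OF j] L0[OF j] n\<zeta>f by (intro sum.mono_neutral_left) auto
    also have "\<dots> = (\<Sum>\<zeta>\<in>\<zeta>f ` {..<\<tau>}. L j \<zeta> / \<zeta> ^ Suc k)"
      using finZ[OF j] off[OF j] Zn[OF j] by (intro sum.mono_neutral_right) auto
    also have "\<dots> = (\<Sum>\<nu><\<tau>. L j (\<zeta>f \<nu>) / \<zeta>f \<nu> ^ Suc k)" using inj by (simp add: sum.reindex)
    also have "\<dots> = (\<Sum>\<nu><\<tau>. - (complex_of_real (\<mu> j) * rot \<nu> ^ p j * amp (rot \<nu>) / \<zeta>f \<nu> ^ k))"
      by (intro sum.cong refl on[OF j]) auto
    finally show ?thesis by (simp add: sum_negf)
  qed
  define r where "r = Min (rj ` {..<M})"
  define C where "C = (\<Sum>j<M. \<bar>Cj j\<bar>)"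
  have ne: "{..<M} \<noteq> {}" using M_pos by (auto simp: lessThan_empty_iff)
  have r: "\<theta> < r" unfolding r_def using ne rj by (subst Min_gr_iff) auto
  show ?thesis
  proof (rule that[OF r, of C])
    show "0 \<le> C" unfolding C_def by (intro sum_nonneg) auto
    fix k j assume j: "j < M"
    have rr: "r \<le> rj j" unfolding r_def using j by (intro Min_le) auto
    have "\<bar>Cj j\<bar> \<le> C" unfolding C_def using j by (intro member_le_sum) auto
    have "norm (complex_of_real (y k j) + (\<Sum>\<zeta>\<in>Z j. L j \<zeta> / \<zeta> ^ Suc k)) \<le> Cj j / rj j ^ k" by (rule bound[OF j])
    also have "\<dots> \<le> C / rj j ^ k" using \<open>\<bar>Cj j\<bar> \<le> C\<close> rr r theta by (intro divide_right_mono) auto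
    also have "\<dots> \<le> C / r ^ k"
      using \<open>\<bar>Cj j\<bar> \<le> C\<close> rr r theta by (intro divide_left_mono power_mono mult_pos_pos zero_less_power) auto
    finally show "norm (complex_of_real (y k j) -
      (\<Sum>\<nu><\<tau>. complex_of_real (\<mu> j) * rot \<nu> ^ p j * amp (rot \<nu>) / (complex_of_real \<theta> * rot \<nu>) ^ k))
      \<le> C / r ^ k" using sumZ[OF j, of k] by (simp add: \<zeta>f_def)
  qed
qed

section \<open>Tail sums and their coefficients\<close>

definition tail :: "nat \<Rightarrow> nat \<Rightarrow> real" where "tail k j = (\<Sum>m. y (k + 1 + m) j)"

definition cc :: "nat \<Rightarrow> nat \<Rightarrow> complex" where
  "cc l j = (\<Sum>\<nu><\<tau>. 1 / rot \<nu> ^ l * (amp (rot \<nu>) / (complex_of_real \<theta> * rot \<nu> - 1))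
     * (complex_of_real (\<mu> j) * rot \<nu> ^ p j))"

text \<open>Summing geometric tails replaces \<open>1 / z ^ k\<close> by
  \<open>1 / (z ^ k * (z - 1))\<close>; this is the origin of the factor \<theta> \<omega>^\<nu> - 1
  in the denominators.\<close>

lemma tail_asymptotics:
  obtains r C where "\<theta> < r" "0 \<le> C"
    "\<And>k j. j < M \<Longrightarrow> norm (complex_of_real (tail k j) - cc k j / complex_of_real (\<theta> ^ k)) \<le> C / r ^ k"
proof -
  obtain r C where r: "\<theta> < r" "0 \<le> C" and bd:
    "\<And>k j. j < M \<Longrightarrow> norm (complex_of_real (y k j) -
      (\<Sum>\<nu><\<tau>. complex_of_real (\<mu> j) * rot \<nu> ^ p j * amp (rot \<nu>) / (complex_of_real \<theta> * rot \<nu>) ^ k))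
      \<le> C / r ^ k" by (rule level_asymptotics) blast
  have r1: "1 < r" using r theta by simp
  have geo: "(\<lambda>m. a / z ^ (k + 1 + m)) sums (a / (z ^ k * (z - 1)))" if "1 < norm z" for a z :: "'b :: {real_normed_field, banach}" and k
  proof -
    have z0: "z \<noteq> 0" "z \<noteq> 1" using that by auto
    have "norm (1 / z) < 1" using that z0 by (simp add: norm_divide divide_less_eq_1)
    then have s: "(\<lambda>m. a / z ^ (k + 1) * (1 / z) ^ m) sums (a / z ^ (k + 1) * (1 / (1 - 1 / z)))"
      by (intro sums_mult geometric_sums)
    have e1: "a / z ^ (k + 1) * (1 / (1 - 1 / z)) = a / (z ^ k * (z - 1))" using z0 by (simp add: field_simps)
    have e2: "a / z ^ (k + 1) * (1 / z) ^ m = a / z ^ (k + 1 + m)" for m by (simp add: power_add power_divide)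
    show ?thesis using s unfolding e1 e2 .
  qed
  show ?thesis
  proof (rule that[of r "C / (r - 1)"])
    fix k j assume j: "j < M"
    define a where "a \<nu> = complex_of_real (\<mu> j) * rot \<nu> ^ p j * amp (rot \<nu>)" for \<nu>
    define z where "z \<nu> = complex_of_real \<theta> * rot \<nu>" for \<nu>
    have nz: "norm (z \<nu>) = \<theta>" for \<nu> unfolding z_def using theta norm_omega_power by (simp add: norm_mult del: norm_power)
    have "summable (\<lambda>m. y (m + (k + 1)) j)" using y_summable[OF j] by (rule summable_ignore_initial_segment)
    then have "(\<lambda>m. y (k + 1 + m) j) sums tail k j" unfolding tail_def by (simp add: add.commute add.left_commute summable_sums)
    then have "(\<lambda>m. complex_of_real (y (k + 1 + m) j)) sums complex_of_real (tail k j)" by (rule sums_of_real)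
    moreover have "(\<lambda>m. \<Sum>\<nu><\<tau>. a \<nu> / z \<nu> ^ (k + 1 + m)) sums (\<Sum>\<nu><\<tau>. a \<nu> / (z \<nu> ^ k * (z \<nu> - 1)))"
      using nz theta by (intro sums_sum geo) auto
    ultimately have S: "(\<lambda>m. complex_of_real (y (k + 1 + m) j) - (\<Sum>\<nu><\<tau>. a \<nu> / z \<nu> ^ (k + 1 + m))) sums
      (complex_of_real (tail k j) - (\<Sum>\<nu><\<tau>. a \<nu> / (z \<nu> ^ k * (z \<nu> - 1))))" by (rule sums_diff)
    have G: "(\<lambda>m. C / r ^ (k + 1 + m)) sums (C / (r ^ k * (r - 1)))" using r1 by (intro geo) auto
    have "norm (complex_of_real (tail k j) - (\<Sum>\<nu><\<tau>. a \<nu> / (z \<nu> ^ k * (z \<nu> - 1)))) \<le> C / (r ^ k * (r - 1))"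
      unfolding sums_unique[OF S] sums_unique[OF G]
      by (rule norm_suminf_le[OF _ sums_summable[OF G]]) (use bd[OF j] in \<open>simp only: a_def z_def\<close>)
    moreover have "(\<Sum>\<nu><\<tau>. a \<nu> / (z \<nu> ^ k * (z \<nu> - 1))) = cc k j / complex_of_real (\<theta> ^ k)"
      unfolding cc_def sum_divide_distrib a_def z_def
      by (intro sum.cong refl) (simp add: power_mult_distrib field_simps)
    ultimately show "norm (complex_of_real (tail k j) - cc k j / complex_of_real (\<theta> ^ k)) \<le> C / (r - 1) / r ^ k"
      by (simp add: mult.commute)
  qed (use r r1 in auto)
qed

lemma root_of_unity: "\<nu> < \<tau> \<Longrightarrow> rot \<nu> ^ \<tau> = 1"
  using omega_roots[OF period_pos] unfolding bij_betw_def by auto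

lemma cc_periodic: "cc (n * \<tau> + l) j = cc l j"
  unfolding cc_def
proof (intro sum.cong refl, goal_cases)
  case (1 \<nu>)
  then have "rot \<nu> ^ \<tau> = 1" by (simp add: root_of_unity)
  then have "rot \<nu> ^ (n * \<tau>) = 1" by (metis mult.commute power_mult power_one)
  then show ?case by (simp add: power_add)
qed

text \<open>Presents the complex sum \<open>cc l j\<close> as a limit of nonnegative reals.
  Realness, sign and comparison of consecutive coefficients, all invisible in the formula, are read
  off from it.\<close>

lemma cc_limit:
  assumes j: "j < M"
  shows "(\<lambda>n. complex_of_real (\<theta> ^ (n * \<tau> + l) * tail (n * \<tau> + l) j)) \<longlonglongrightarrow> cc l j"
proof -
  obtain r C where r: "\<theta> < r" "0 \<le> C" and bd:
    "\<And>k j. j < M \<Longrightarrow> norm (complex_of_real (tail k j) - cc k j / complex_of_real (\<theta> ^ k)) \<le> C / r ^ k"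
    by (rule tail_asymptotics) blast
  have th: "\<theta> > 0" using theta by simp
  have le: "norm (complex_of_real (\<theta> ^ k * tail k j) - cc k j) \<le> C * (\<theta> / r) ^ k" for k
  proof -
    have "complex_of_real (\<theta> ^ k * tail k j) - cc k j = complex_of_real (\<theta> ^ k) * (complex_of_real (tail k j) - cc k j / complex_of_real (\<theta> ^ k))"
      using th by (simp add: right_diff_distrib)
    then have "norm (complex_of_real (\<theta> ^ k * tail k j) - cc k j) = \<theta> ^ k * norm (complex_of_real (tail k j) - cc k j / complex_of_real (\<theta> ^ k))"
      using th by (simp only: norm_mult norm_of_real) simp
    also have "\<dots> \<le> \<theta> ^ k * (C / r ^ k)" using th by (intro mult_left_mono bd[OF j]) auto
    also have "\<dots> = C * (\<theta> / r) ^ k" by (simp add: power_divide)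
    finally show ?thesis .
  qed
  have "(\<lambda>k. C * (\<theta> / r) ^ k) \<longlonglongrightarrow> C * 0" using r th by (intro tendsto_mult tendsto_const LIMSEQ_realpow_zero) auto
  then have lim0: "(\<lambda>k. C * (\<theta> / r) ^ k) \<longlonglongrightarrow> 0" by simp
  have "(\<lambda>k. complex_of_real (\<theta> ^ k * tail k j) - cc k j) \<longlonglongrightarrow> 0"
    by (rule Lim_null_comparison[OF always_eventually lim0]) (use le in blast)
  moreover have "filterlim (\<lambda>n. n * \<tau> + l) sequentially sequentially"
    using period_pos by (intro filterlim_subseq) (auto simp: strict_mono_def)
  ultimately have "(\<lambda>n. complex_of_real (\<theta> ^ (n * \<tau> + l) * tail (n * \<tau> + l) j) - cc (n * \<tau> + l) j) \<longlonglongrightarrow> 0"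
    by (rule filterlim_compose)
  then show ?thesis unfolding cc_periodic by (rule LIM_zero_cancel)
qed

section \<open>Positivity of the coefficients\<close>

lemma tail_nonneg: "j < M \<Longrightarrow> 0 \<le> tail k j"
  and tail_Suc: "j < M \<Longrightarrow> tail k j = y (Suc k) j + tail (Suc k) j"
proof -
  assume j: "j < M"
  have "summable (\<lambda>m. y (m + (k + 1)) j)" using y_summable[OF j] by (rule summable_ignore_initial_segment)
  then have s: "summable (\<lambda>m. y (k + 1 + m) j)" by (simp add: add.commute add.left_commute)
  show "0 \<le> tail k j" unfolding tail_def using s y_nonneg[OF j] by (intro suminf_nonneg) auto
  show "tail k j = y (Suc k) j + tail (Suc k) j"
    unfolding tail_def using suminf_split_head[OF s] by simp
qed

lemma cc_real:
  assumes "j < M"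
  shows "Im (cc l j) = 0" "0 \<le> Re (cc l j)" "Re (cc (Suc l) j) \<le> \<theta> * Re (cc l j)"
proof -
  note lim = cc_limit[OF assms]
  have lim_Re: "(\<lambda>n. \<theta> ^ (n * \<tau> + l) * tail (n * \<tau> + l) j) \<longlonglongrightarrow> Re (cc l j)" for l
    using tendsto_Re[OF lim[of l]] by (simp only: Re_complex_of_real)
  have "(\<lambda>n. 0) \<longlonglongrightarrow> Im (cc l j)" using tendsto_Im[OF lim[of l]] by (simp only: Im_complex_of_real)
  then show "Im (cc l j) = 0" by (simp add: LIMSEQ_const_iff)
  show "0 \<le> Re (cc l j)"
    using tail_nonneg[OF assms] theta by (intro tendsto_lowerbound[OF lim_Re]) auto
  show "Re (cc (Suc l) j) \<le> \<theta> * Re (cc l j)"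
  proof (rule LIMSEQ_le)
    show "(\<lambda>n. \<theta> * (\<theta> ^ (n * \<tau> + l) * tail (n * \<tau> + l) j)) \<longlonglongrightarrow> \<theta> * Re (cc l j)"
      by (intro tendsto_mult tendsto_const lim_Re)
    show "(\<lambda>n. \<theta> ^ (n * \<tau> + Suc l) * tail (n * \<tau> + Suc l) j) \<longlonglongrightarrow> Re (cc (Suc l) j)" by (rule lim_Re)
    have "\<theta> ^ (n * \<tau> + Suc l) * tail (n * \<tau> + Suc l) j \<le> \<theta> * (\<theta> ^ (n * \<tau> + l) * tail (n * \<tau> + l) j)" for n
    proof -
      have "tail (n * \<tau> + Suc l) j \<le> tail (n * \<tau> + l) j"
        using tail_Suc[OF assms, of "n * \<tau> + l"] y_nonneg[OF assms] by simp
      then have "\<theta> ^ (n * \<tau> + Suc l) * tail (n * \<tau> + Suc l) j \<le> \<theta> ^ (n * \<tau> + Suc l) * tail (n * \<tau> + l) j"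
        using theta by (intro mult_left_mono) auto
      then show ?thesis by simp
    qed
    then show "\<exists>N. \<forall>n\<ge>N. \<theta> ^ (n * \<tau> + Suc l) * tail (n * \<tau> + Suc l) j \<le> \<theta> * (\<theta> ^ (n * \<tau> + l) * tail (n * \<tau> + l) j)" by blast
  qed
qed

text \<open>The entry factors as \<open>\<mu> j * H (p j - l)\<close> with \<open>H\<close> of
  period \<open>\<tau>\<close>. For fixed \<open>j\<close> the arguments run through all residue
  classes, so \<open>H\<close> vanishes and with it the entries of all other phases.\<close>

lemma cc_zero_all:
  assumes j: "j < M" and zero: "\<And>n. cc (l + n) j = 0" and j': "j' < M"
  shows "cc l' j' = 0"
proof -
  define H where "H m = (\<Sum>\<nu><\<tau>. rot \<nu> powi m * (amp (rot \<nu>) / (complex_of_real \<theta> * rot \<nu> - 1)))" for m :: int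
  have ccH: "cc l j = complex_of_real (\<mu> j) * H (int (p j) - int l)" for l j
    unfolding cc_def H_def sum_distrib_left
  proof (intro sum.cong refl, goal_cases)
    case (1 \<nu>)
    have "rot \<nu> \<noteq> 0" using norm_omega_power[of \<tau> \<nu>] by (metis norm_zero zero_neq_one)
    then have "rot \<nu> powi (int (p j) - int l) = rot \<nu> ^ p j / rot \<nu> ^ l"
      by (simp add: power_int_diff)
    then show ?case by (simp add: mult_ac)
  qed
  have Hper: "H m = H m'" if "int \<tau> dvd m - m'" for m m'
    unfolding H_def using powi_cong_period[OF root_of_unity period_pos that] by (intro sum.cong) auto
  have H0: "H (int (p j) - int (l + n)) = 0" for n
    using zero[of n] ccH[of "l + n" j] mu_pos[OF j] by simp
  have "H m = 0" for m
  proof -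
    \<comment> \<open>The nonnegative shift that brings \<open>p j - (l + q)\<close> into the
      residue class of \<open>m\<close>.\<close>
    define q where "q = (int (p j) - int l - m) mod int \<tau>"
    have q0: "0 \<le> q" unfolding q_def using period_pos by simp
    have "int \<tau> dvd (int (p j) - int l - m) - q" unfolding q_def by (rule dvd_minus_mod)
    then have "int \<tau> dvd (int (p j) - int (l + nat q)) - m" using q0 by (simp add: algebra_simps)
    then show ?thesis using Hper H0 by metis
  qed
  then show ?thesis unfolding ccH by simp
qed

lemma cc_pos:
  assumes y_pos: "\<And>k j. 1 \<le> k \<Longrightarrow> j < M \<Longrightarrow> 0 < y k j"
    and reach: "\<And>Z k j. (\<And>k j. 1 \<le> k \<Longrightarrow> j < M \<Longrightarrow> 0 < b k j \<Longrightarrow> (k, j) \<in> Z) \<Longrightarrow>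
      (\<And>k i k' j. 1 \<le> k \<Longrightarrow> 1 \<le> k' \<Longrightarrow> i < M \<Longrightarrow> j < M \<Longrightarrow> (k, i) \<in> Z \<Longrightarrow> k \<le> k' + 1 \<Longrightarrow>
         0 < A (k' + 1 - k) i j \<Longrightarrow> (k', j) \<in> Z) \<Longrightarrow> 1 \<le> k \<Longrightarrow> j < M \<Longrightarrow> (k, j) \<in> Z"
    and j: "j < M"
  shows "0 < Re (cc l j)"
proof (rule ccontr)
  assume "\<not> 0 < Re (cc l j)"
  then have base: "Re (cc l j) = 0" using cc_real(2)[OF j, of l] by linarith
  \<comment> \<open>The index ranges over all naturals and \<open>cc\<close> is periodic, so
    propagating a zero upwards reaches every residue class.\<close>
  have "Re (cc (l + n) j) = 0" for n
  proof (induction n)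
    case (Suc n)
    then show ?case using cc_real(2)[OF j, of "l + Suc n"] cc_real(3)[OF j, of "l + n"] by simp
  qed (simp add: base)
  then have "cc (l + n) j = 0" for n using cc_real(1)[OF j] by (simp add: complex_eq_iff)
  then have all0: "cc k j' = 0" if "j' < M" for k j' using cc_zero_all[OF j _ that] by blast
  obtain r C where r: "\<theta> < r" "0 \<le> C" and bd:
    "\<And>k j. j < M \<Longrightarrow> norm (complex_of_real (tail k j) - cc k j / complex_of_real (\<theta> ^ k)) \<le> C / r ^ k"
    by (rule tail_asymptotics) blast
  have th: "\<theta> > 0" using theta by simp
  have "summable (\<lambda>k. \<theta> ^ k * y k j')" if j': "j' < M" for j'
  proof -
    have "summable (\<lambda>k. \<theta> ^ Suc k * y (Suc k) j')"
    proof (rule summable_comparison_test')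
      show "summable (\<lambda>k. \<theta> * C * (\<theta> / r) ^ k)"
        using r th by (intro summable_mult summable_geometric) auto
      fix k
      have "y (Suc k) j' \<le> tail k j'" using tail_Suc[OF j', of k] tail_nonneg[OF j', of "Suc k"] by simp
      also have "\<dots> \<le> C / r ^ k" using bd[OF j', of k] all0[OF j'] tail_nonneg[OF j', of k] by simp
      finally have "\<theta> ^ Suc k * y (Suc k) j' \<le> \<theta> ^ Suc k * (C / r ^ k)" using th by (intro mult_left_mono) auto
      also have "\<dots> = \<theta> * C * (\<theta> / r) ^ k" by (simp add: power_divide)
      finally show "norm (\<theta> ^ Suc k * y (Suc k) j') \<le> \<theta> * C * (\<theta> / r) ^ k"
        using y_nonneg[OF j', of "Suc k"] th by simp
    qed
    then show ?thesis using summable_Suc_iff[of "\<lambda>k. \<theta> ^ k * y k j'"] by blast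
  qed
  then show False using not_summable_at_theta[OF y_pos reach] by blast
qed

end

section \<open>Reduction of the chain to its level process\<close>

lemma summable_beyond_conv_radius_mat:
  assumes "ereal t < conv_radius_mat Y m n" "0 < t"
    and "\<And>k i j. i < m \<Longrightarrow> j < n \<Longrightarrow> 0 \<le> Y k i j"
  obtains R where "t < R" "\<And>s i j. 0 \<le> s \<Longrightarrow> s \<le> R \<Longrightarrow> i < m \<Longrightarrow> j < n \<Longrightarrow> summable (\<lambda>k. s ^ k * Y k i j)"
proof -
  obtain R where R: "t < R" "\<forall>i<m. \<forall>j<n. summable (\<lambda>k. R ^ k * Y k i j)"
    using assms(1) unfolding conv_radius_mat_def less_Sup_iff by auto
  show ?thesis
  proof (rule that[OF R(1)])
    fix s i j assume s: "0 \<le> s" "s \<le> R" and ij: "i < m" "j < n"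
    show "summable (\<lambda>k. s ^ k * Y k i j)"
    proof (rule summable_comparison_test'[of "\<lambda>k. R ^ k * Y k i j" 0])
      show "norm (s ^ k * Y k i j) \<le> R ^ k * Y k i j" for k
        using s assms(3)[OF ij, of k] by (simp add: mult_right_mono power_mono)
    qed (use R(2) ij in auto)
  qed
qed

lemma pos_if_mult_eq_1: "c * s = 1 \<Longrightarrow> 0 < s \<Longrightarrow> 0 < (c :: real)"
  using zero_less_mult_pos2[of c s] by simp

lemma state_space_iff: "(k, j) \<in> state_space M0 M \<longleftrightarrow> (if k = 0 then j < M0 else j < M)"
  by (auto simp: state_space_def)

text \<open>A column of level \<open>k\<close> has nonzero entries only in rows of level 0 and of
  levels up to \<open>k + 1\<close>, which reduces the infinite balance equation to a finite
  sum.\<close>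

lemma stationary_level_eq:
  assumes "stationary_prob (state_space M0 M) (mg1_T B0 Bk C0 A) x" "1 \<le> k" "j < M"
  shows "x (k, j) = (\<Sum>i<M0. x (0, i) * Bk k i j) + (\<Sum>l = 1..k + 1. \<Sum>i<M. x (l, i) * A (k + 1 - l) i j)"
proof -
  define F where "F = Pair 0 ` {..<M0} \<union> {1..k + 1} \<times> {..<M}"
  have "((\<lambda>s. x s * mg1_T B0 Bk C0 A s (k, j)) has_sum x (k, j)) (state_space M0 M)"
    using assms unfolding stationary_prob_def by (auto simp: state_space_iff)
  moreover have "F \<subseteq> state_space M0 M" unfolding F_def by (auto simp: state_space_iff)
  moreover have "mg1_T B0 Bk C0 A s (k, j) = 0" if "s \<in> state_space M0 M - F" for s
    using that assms(2) unfolding F_def by (cases s) (auto simp: mg1_T_def state_space_iff split: if_splits)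
  ultimately have "((\<lambda>s. x s * mg1_T B0 Bk C0 A s (k, j)) has_sum x (k, j)) F"
    by (subst has_sum_cong_neutral[where T = "state_space M0 M"]) auto
  moreover have "finite F" unfolding F_def by auto
  ultimately have "x (k, j) = (\<Sum>s\<in>F. x s * mg1_T B0 Bk C0 A s (k, j))"
    using has_sum_finite has_sum_unique by blast
  also have "\<dots> = (\<Sum>s\<in>Pair 0 ` {..<M0}. x s * mg1_T B0 Bk C0 A s (k, j)) +
      (\<Sum>s\<in>{1..k + 1} \<times> {..<M}. x s * mg1_T B0 Bk C0 A s (k, j))"
    unfolding F_def by (rule sum.union_disjoint) auto
  also have "(\<Sum>s\<in>Pair 0 ` {..<M0}. x s * mg1_T B0 Bk C0 A s (k, j)) = (\<Sum>i<M0. x (0, i) * Bk k i j)"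
    using assms(2) by (subst sum.reindex) (auto simp: inj_on_def mg1_T_def)
  also have "(\<Sum>s\<in>{1..k + 1} \<times> {..<M}. x s * mg1_T B0 Bk C0 A s (k, j)) =
      (\<Sum>l = 1..k + 1. \<Sum>i<M. x (l, i) * A (k + 1 - l) i j)"
    unfolding sum.cartesian_product using assms(2) by (intro sum.cong) (auto simp: mg1_T_def)
  finally show ?thesis .
qed

text \<open>The mass of a state dominates every single inflow \<open>x s * P s t\<close>, so
  positivity propagates along transitions; it starts somewhere because the total mass is 1.\<close>

lemma stationary_pos:
  assumes "stationary_prob S P x" "irreducible_on S P" "\<And>s t. s \<in> S \<Longrightarrow> t \<in> S \<Longrightarrow> 0 \<le> P s t"
    and "t \<in> S"
  shows "0 < x t"
proof -
  have nn: "0 \<le> x s" if "s \<in> S" for s using assms(1) that by (auto simp: stationary_prob_def)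
  have sum1: "(x has_sum 1) S" using assms(1) by (auto simp: stationary_prob_def)
  have "\<exists>a\<in>S. 0 < x a"
  proof (rule ccontr)
    assume "\<not> ?thesis"
    then have "x s = 0" if "s \<in> S" for s using nn[OF that] that by force
    then have "(x has_sum 0) S" by (simp add: has_sum_0)
    then show False using sum1 has_sum_unique by fastforce
  qed
  then obtain a where a: "a \<in> S" "0 < x a" by blast
  have "S \<subseteq> {s. 0 < x s}"
  proof (rule irreducible_on_closed[OF assms(2) a(1)])
    fix s t assume st: "s \<in> S" "t \<in> S" "s \<in> {s. 0 < x s}" "0 < P s t"
    have hs: "((\<lambda>s. x s * P s t) has_sum x t) S" using assms(1) st by (auto simp: stationary_prob_def)
    have "((\<lambda>s. x s * P s t) has_sum (x s * P s t)) {s}" by (simp add: has_sum_finiteI)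
    then have "x s * P s t \<le> x t"
    proof (rule has_sum_mono2[OF _ hs])
      show "0 \<le> x s' * P s' t" if "s' \<in> S - {s}" for s'
        using that st nn assms(3) by (intro mult_nonneg_nonneg) blast+
    qed (use st in simp)
    moreover have "0 < x s * P s t" using st by simp
    ultimately have "0 < x t" by linarith
    then show "t \<in> {s. 0 < x s}" by blast
  qed (use a in auto)
  then show ?thesis using assms(4) by blast
qed

lemma stationary_level_summable:
  assumes "stationary_prob (state_space M0 M) P x" "j < M"
  shows "summable (\<lambda>k. x (Suc k, j))"
proof -
  have nn: "0 \<le> x s" if "s \<in> state_space M0 M" for s using assms(1) that by (auto simp: stationary_prob_def)
  have "x summable_on state_space M0 M"
    using assms(1) by (auto simp: stationary_prob_def summable_on_def)
  then have "x summable_on (\<lambda>k. (Suc k, j)) ` UNIV"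
    by (rule summable_on_subset) (use assms(2) in \<open>auto simp: state_space_iff\<close>)
  then have "(x \<circ> (\<lambda>k. (Suc k, j))) summable_on UNIV"
    by (subst (asm) summable_on_reindex) (auto simp: inj_on_def)
  then show ?thesis
    using nn assms(2) by (subst (asm) summable_on_UNIV_nonneg_real_iff) (auto simp: o_def state_space_iff)
qed

theorem theorem3p1:
  fixes M0 M :: nat
    and A :: "nat \<Rightarrow> nat \<Rightarrow> nat \<Rightarrow> real"
    and B0 :: "nat \<Rightarrow> nat \<Rightarrow> real"
    and Bk :: "nat \<Rightarrow> nat \<Rightarrow> nat \<Rightarrow> real"
    and C0 :: "nat \<Rightarrow> nat \<Rightarrow> real"
    and \<pi> \<mu> v :: "nat \<Rightarrow> real"
    and \<theta> :: real
    and p :: "nat \<Rightarrow> nat"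
    and x :: "nat \<times> nat \<Rightarrow> real"
  assumes M0_pos: "0 < M0" and M_pos: "0 < M"
    and A_nonneg: "\<And>k i j. i < M \<Longrightarrow> j < M \<Longrightarrow> 0 \<le> A k i j"
    and B0_nonneg: "\<And>i j. i < M0 \<Longrightarrow> j < M0 \<Longrightarrow> 0 \<le> B0 i j"
    and Bk_nonneg: "\<And>k i j. 1 \<le> k \<Longrightarrow> i < M0 \<Longrightarrow> j < M \<Longrightarrow> 0 \<le> Bk k i j"
    and C0_nonneg: "\<And>i j. i < M \<Longrightarrow> j < M0 \<Longrightarrow> 0 \<le> C0 i j"
    and T_stochastic: "\<And>s. s \<in> state_space M0 M \<Longrightarrow>
          ((\<lambda>t. mg1_T B0 Bk C0 A s t) has_sum 1) (state_space M0 M)"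
    and A_summable: "\<And>i j. i < M \<Longrightarrow> j < M \<Longrightarrow> summable (\<lambda>k. A k i j)"
    and A_stochastic: "\<And>i. i < M \<Longrightarrow> (\<Sum>j<M. msum A i j) = 1"
    and B_summable: "\<And>i j. i < M0 \<Longrightarrow> j < M \<Longrightarrow> summable (\<lambda>k. Bk (Suc k) i j)"
    and B_rows: "\<And>i. i < M0 \<Longrightarrow>
          (\<Sum>j<M0. B0 i j) + (\<Sum>j<M. (\<Sum>k. Bk (Suc k) i j)) = 1"
    and pi_stat: "\<And>j. j < M \<Longrightarrow> (\<Sum>i<M. \<pi> i * msum A i j) = \<pi> j"
    and pi_norm: "(\<Sum>i<M. \<pi> i) = 1"
    \<comment> \<open>Assumption 1\<close>
    and T_irred: "irreducible_on (state_space M0 M) (mg1_T B0 Bk C0 A)"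
    and A_irred: "irreducible_on {..<M} (msum A)"
    and rho_lt_1: "(\<Sum>i<M. \<pi> i * (\<Sum>j<M. (\<Sum>k. real k * A k i j))) < 1"
    and B_mean_finite: "\<And>i j. i < M0 \<Longrightarrow> j < M \<Longrightarrow> summable (\<lambda>k. real k * Bk k i j)"
    \<comment> \<open>Assumption 2\<close>
    and rA: "conv_radius_mat A M M > 1"
    and rB: "conv_radius_mat (\<lambda>k. if k = 0 then (\<lambda>_ _. 0) else Bk k) M0 M > 1"
    \<comment> \<open>Assumption 3\<close>
    and theta_gt1: "1 < \<theta>" and theta_lt_rA: "ereal \<theta> < conv_radius_mat A M M"
    and theta_fix: "complex_of_real \<theta> = delta M (Astar A (complex_of_real \<theta>))"
    \<comment> \<open>additional hypothesis\<close>
    and theta_lt_rB: "ereal \<theta> < conv_radius_mat (\<lambda>k. if k = 0 then (\<lambda>_ _. 0) else Bk k) M0 M"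
    \<comment> \<open>PF left / right eigenvectors of Gamma_A*(theta) = theta^-1 A*(theta)\<close>
    and mu_eig: "\<And>j. j < M \<Longrightarrow> (\<Sum>i<M. \<mu> i * (AstarR A \<theta> i j / \<theta>)) = \<mu> j"
    and v_eig: "\<And>i. i < M \<Longrightarrow> (\<Sum>j<M. (AstarR A \<theta> i j / \<theta>) * v j) = v i"
    and mu_norm: "(\<Sum>i<M. \<mu> i) = 1"
    and mu_v_norm: "(\<Sum>i<M. \<mu> i * v i) = 1"
    \<comment> \<open>the phase function p\<close>
    and p_range: "\<And>j. j < M \<Longrightarrow> p j < mad_period A M"
    and p_prop: "\<And>k i j. i < M \<Longrightarrow> j < M \<Longrightarrow> 0 < A k i j \<Longrightarrow>
          int (mad_period A M) dvd (int k - 1) - (int (p j) - int (p i))"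
    \<comment> \<open>the stationary distribution\<close>
    and x_stat: "stationary_prob (state_space M0 M) (mg1_T B0 Bk C0 A) x"
  shows "\<exists>\<epsilon>0>0. \<forall>l < mad_period A M. \<forall>j < M.
     (\<lambda>n. complex_of_real (xbar x (n * mad_period A M + l) j)
          - complex_of_real (\<theta> powi (- int (n * mad_period A M + l)))
            * coef_c M0 M (mad_period A M) A Bk x \<theta>
                (deriv (\<lambda>y. Re (delta M (Astar A (complex_of_real y)))) \<theta>) \<mu> v p l j)
     \<in> O(\<lambda>n. complex_of_real ((\<theta> + \<epsilon>0) powi (- int (n * mad_period A M + l))))
     \<and> Im (coef_c M0 M (mad_period A M) A Bk x \<theta>
                (deriv (\<lambda>y. Re (delta M (Astar A (complex_of_real y)))) \<theta>) \<mu> v p l j) = 0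
     \<and> Re (coef_c M0 M (mad_period A M) A Bk x \<theta>
                (deriv (\<lambda>y. Re (delta M (Astar A (complex_of_real y)))) \<theta>) \<mu> v p l j) > 0"
proof -
  have th0: "0 < \<theta>" using theta_gt1 by simp
  obtain RA where RA: "\<theta> < RA" "\<And>s i j. 0 \<le> s \<Longrightarrow> s \<le> RA \<Longrightarrow> i < M \<Longrightarrow> j < M \<Longrightarrow> summable (\<lambda>k. s ^ k * A k i j)"
    by (rule summable_beyond_conv_radius_mat[OF theta_lt_rA th0 A_nonneg]) (assumption+, rule that)
  \<comment> \<open>Index 0 is cleared as in the radius hypothesis: the series B*(z) starts at
    1.\<close>
  define Bz where "Bz k = (if k = 0 then (\<lambda>_ _. 0) else Bk k)" for k
  have Bz_nonneg: "0 \<le> Bz k i j" if "i < M0" "j < M" for k i j using Bk_nonneg that by (simp add: Bz_def)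
  obtain RB where RB: "\<theta> < RB" "\<And>s i j. 0 \<le> s \<Longrightarrow> s \<le> RB \<Longrightarrow> i < M0 \<Longrightarrow> j < M \<Longrightarrow> summable (\<lambda>k. s ^ k * Bz k i j)"
    by (rule summable_beyond_conv_radius_mat[of \<theta> Bz M0 M, OF _ th0 Bz_nonneg])
       (use theta_lt_rB in \<open>simp add: Bz_def[abs_def]\<close>, assumption+, rule that)
  define R where "R = min RA RB"
  have R: "\<theta> < R" "R \<le> RA" "R \<le> RB" using RA RB by (auto simp: R_def)
  interpret G: matrix_gf M A R
    using M_pos A_nonneg A_irred R RA(2)[of R] theta_gt1 by unfold_locales auto
  have A1: "AstarR A 1 i j = msum A i j" for i j by (simp add: AstarR_def msum_def)
  have stoch: "(\<Sum>j<M. AstarR A 1 i j) = 1" if "i < M" for i using A_stochastic[OF that] by (simp add: A1)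
  have P1: "G.Perron 1 = 1" using stoch R theta_gt1 by (intro G.Perron_eqI[of 1 "\<lambda>_. 1"]) auto
  \<comment> \<open>No sign of \<open>\<pi>\<close> is given. Uniqueness makes it a multiple of a
    positive left vector, and its normalisation makes the factor positive; \<open>\<mu>\<close> and
    \<open>v\<close> are treated in the same way below.\<close>
  have pi_pos: "0 < \<pi> i" if "i < M" for i
  proof -
    obtain u where u: "\<And>i. i < M \<Longrightarrow> 0 < u i" "\<And>j. j < M \<Longrightarrow> (\<Sum>i<M. u i * AstarR A 1 i j) = 1 * u j"
      by (rule G.Perron_exists[of 1]) (use R theta_gt1 P1 in auto)
    interpret tr: irreducible_matrix M "\<lambda>i j. AstarR A 1 j i"
      by (rule irreducible_matrix.transpose[OF G.irreducible_AstarR]) (use R theta_gt1 in auto)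
    obtain c where c: "\<forall>i<M. \<pi> i = c * u i"
      using tr.eigenvector_unique[of u 1 \<pi>] u pi_stat by (auto simp: A1 mult.commute)
    have "c * (\<Sum>i<M. u i) = 1" using pi_norm c by (simp add: sum_distrib_left)
    moreover have "0 < (\<Sum>i<M. u i)" using u M_pos by (intro sum_pos) auto
    ultimately have "0 < c" by (rule pos_if_mult_eq_1)
    then show ?thesis using c u(1) that by simp
  qed
  have dA1: "G.dAstarR 1 i j = (\<Sum>k. real k * A k i j)" if ij: "i < M" "j < M" for i j
  proof -
    have "summable (\<lambda>k. diffs (\<lambda>k. A k i j) k * 1 ^ k)"
      using R theta_gt1 G.A_summable_R[OF ij] termdiff_converges[of 1 R "\<lambda>k. A k i j"] 
        powser_inside[of "\<lambda>k. A k i j" R] by (simp add: mult.commute)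
    then have "summable (\<lambda>k. real (Suc k) * A (Suc k) i j)" by (simp add: diffs_def)
    then have "(\<Sum>k. real k * A k i j) = (\<Sum>k. real (Suc k) * A (Suc k) i j)"
      using suminf_split_head[of "\<lambda>k. real k * A k i j"] summable_Suc_iff[of "\<lambda>k. real k * A k i j"] by simp
    then show ?thesis by (simp add: G.dAstarR_def diffs_def)
  qed
  \<comment> \<open>With left vector \<open>\<pi>\<close> and right vector 1 the derivative formula
    evaluates to \<rho>.\<close>
  have der1: "\<exists>d<1. (G.Perron has_real_derivative d) (at 1)"
  proof (intro exI conjI)
    show "(G.Perron has_real_derivative (\<Sum>i<M. \<pi> i * (\<Sum>j<M. G.dAstarR 1 i j * 1)) / (\<Sum>i<M. \<pi> i * 1)) (at 1)"
      using R theta_gt1 pi_pos pi_stat stoch by (intro G.Perron_has_derivative) (auto simp: P1 A1)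
    show "(\<Sum>i<M. \<pi> i * (\<Sum>j<M. G.dAstarR 1 i j * 1)) / (\<Sum>i<M. \<pi> i * 1) < 1"
      using rho_lt_1 pi_norm by (simp add: dA1)
  qed
  obtain u w where u: "\<And>i. i < M \<Longrightarrow> 0 < u i" "\<And>j. j < M \<Longrightarrow> (\<Sum>i<M. u i * AstarR A \<theta> i j) = \<theta> * u j"
    and w: "\<And>i. i < M \<Longrightarrow> 0 < w i" "\<And>i. i < M \<Longrightarrow> (\<Sum>j<M. AstarR A \<theta> i j * w j) = \<theta> * w i"
  proof (rule G.Perron_exists[of \<theta>])
    fix u w assume *: "\<And>i. i < M \<Longrightarrow> 0 < u i" "\<And>i. i < M \<Longrightarrow> 0 < w i"
      "\<And>j. j < M \<Longrightarrow> (\<Sum>i<M. u i * AstarR A \<theta> i j) = G.Perron \<theta> * u j"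
      "\<And>i. i < M \<Longrightarrow> (\<Sum>j<M. AstarR A \<theta> i j * w j) = G.Perron \<theta> * w i"
    have "G.Perron \<theta> = \<theta>" using theta_fix unfolding G.Perron_def by (metis Re_complex_of_real)
    then show thesis using that[of u w] * by simp
  qed (use theta_gt1 R in auto)
  have mu_eig': "(\<Sum>i<M. \<mu> i * AstarR A \<theta> i j) = \<theta> * \<mu> j" if "j < M" for j
    using mu_eig[OF that] theta_gt1 by (simp add: field_simps flip: sum_divide_distrib)
  have v_eig': "(\<Sum>j<M. AstarR A \<theta> i j * v j) = \<theta> * v i" if "i < M" for i
    using v_eig[OF that] theta_gt1 by (simp add: field_simps flip: sum_divide_distrib)
  have mu_pos: "0 < \<mu> i" if "i < M" for i
  proof -
    interpret tr: irreducible_matrix M "\<lambda>i j. AstarR A \<theta> j i"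
      by (rule irreducible_matrix.transpose[OF G.irreducible_AstarR]) (use R theta_gt1 in auto)
    obtain c where c: "\<forall>i<M. \<mu> i = c * u i"
      using tr.eigenvector_unique[of u \<theta> \<mu>] u mu_eig' by (auto simp: mult.commute)
    have "c * (\<Sum>i<M. u i) = 1" using mu_norm c by (simp add: sum_distrib_left)
    moreover have "0 < (\<Sum>i<M. u i)" using u M_pos by (intro sum_pos) auto
    ultimately have "0 < c" by (rule pos_if_mult_eq_1)
    then show ?thesis using c u(1) that by simp
  qed
  have v_pos: "0 < v i" if "i < M" for i
  proof -
    interpret irreducible_matrix M "AstarR A \<theta>"
      by (rule G.irreducible_AstarR) (use R theta_gt1 in auto)
    obtain c where c: "\<forall>i<M. v i = c * w i"
      using eigenvector_unique[of w \<theta> v] w v_eig' by auto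
    have "c * (\<Sum>i<M. \<mu> i * w i) = 1" using mu_v_norm c by (simp add: sum_distrib_left mult_ac)
    moreover have "0 < (\<Sum>i<M. \<mu> i * w i)" using mu_pos w M_pos by (intro sum_pos) auto
    ultimately have "0 < c" by (rule pos_if_mult_eq_1)
    then show ?thesis using c w(1) that by simp
  qed
  \<comment> \<open>Removing level 0 leaves levels governed by \<open>A\<close> alone, with level 0
    acting as the external inflow \<open>b\<close>.\<close>
  define y where "y k j = (if k = 0 then 0 else x (k, j))" for k j
  define b where "b k j = (\<Sum>i<M0. x (0, i) * Bz k i j)" for k j
  have T_nonneg: "0 \<le> mg1_T B0 Bk C0 A s t" if "s \<in> state_space M0 M" "t \<in> state_space M0 M" for s t
    using that A_nonneg B0_nonneg Bk_nonneg C0_nonneg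
    by (cases s; cases t) (auto simp: mg1_T_def state_space_iff split: if_splits)
  have x_pos: "0 < x (k, j)" if "(k, j) \<in> state_space M0 M" for k j
    by (rule stationary_pos[OF x_stat T_irred T_nonneg that])
  have x0: "0 < x (0, i)" if "i < M0" for i using x_pos[of 0 i] that by (simp add: state_space_iff)
  have y_pos: "0 < y k j" if "1 \<le> k" "j < M" for k j using x_pos[of k j] that by (simp add: state_space_iff y_def)
  have y_summable: "summable (\<lambda>k. y k j)" if "j < M" for j
    using stationary_level_summable[OF x_stat that] summable_Suc_iff[of "\<lambda>k. y k j"] by (simp add: y_def)
  have b_nonneg: "0 \<le> b k j" if "j < M" for k j
    unfolding b_def using x0 Bz_nonneg that by (intro sum_nonneg) (simp add: less_imp_le)
  have b_summable: "summable (\<lambda>k. R ^ k * b k j)" if j: "j < M" for j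
  proof -
    have "summable (\<lambda>k. \<Sum>i<M0. x (0, i) * (R ^ k * Bz k i j))"
      using RB(2)[of R] R j theta_gt1 by (intro summable_sum summable_mult) auto
    then show ?thesis by (simp add: b_def sum_distrib_left mult_ac)
  qed
  have y_eq: "y k j = b k j + (\<Sum>l\<le>k + 1. \<Sum>i<M. y l i * A (k + 1 - l) i j)" if "1 \<le> k" "j < M" for k j
  proof -
    have "(\<Sum>l\<le>k + 1. \<Sum>i<M. y l i * A (k + 1 - l) i j) = (\<Sum>l = 1..k + 1. \<Sum>i<M. y l i * A (k + 1 - l) i j)"
      by (intro sum.mono_neutral_right) (auto simp: y_def)
    also have "\<dots> = (\<Sum>l = 1..k + 1. \<Sum>i<M. x (l, i) * A (k + 1 - l) i j)"
      by (intro sum.cong) (auto simp: y_def)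
    finally show ?thesis using stationary_level_eq[OF x_stat that] that by (simp add: y_def b_def Bz_def)
  qed
  interpret Pr: periodic_level_process M A R \<theta> \<mu> v y b p
  proof unfold_locales
    show "0 < mad_period A M" using p_range[OF M_pos] by simp
    show "0 \<le> y k j" if "j < M" for k j using y_pos[of k j] that by (cases "k = 0") (auto simp: y_def)
    show "y 0 j = 0" for j by (simp add: y_def)
    show "b 0 j = 0" for j by (simp add: b_def Bz_def)
  qed (fact theta_gt1 R(1) stoch der1 mu_pos v_pos mu_eig' v_eig' mu_v_norm y_summable b_nonneg b_summable y_eq p_prop)+
  have reach: "(k, j) \<in> Z" if Zb: "\<And>k j. 1 \<le> k \<Longrightarrow> j < M \<Longrightarrow> 0 < b k j \<Longrightarrow> (k, j) \<in> Z"
    and ZA: "\<And>k i k' j. 1 \<le> k \<Longrightarrow> 1 \<le> k' \<Longrightarrow> i < M \<Longrightarrow> j < M \<Longrightarrow> (k, i) \<in> Z \<Longrightarrow> k \<le> k' + 1 \<Longrightarrow>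
         0 < A (k' + 1 - k) i j \<Longrightarrow> (k', j) \<in> Z" and kj: "1 \<le> k" "j < M" for Z k j
  proof -
    \<comment> \<open>All of level 0 is put into the closed set, so returns to it are harmless; a
      transition from level 0 to a level \<open>k \<ge> 1\<close> lands where \<open>b\<close> is
      positive, because \<open>x (0, i) > 0\<close>.\<close>
    have "state_space M0 M \<subseteq> {s. fst s = 0 \<or> s \<in> Z}"
    proof (rule irreducible_on_closed[OF T_irred, of "(0, 0)"])
      fix s t assume st: "s \<in> state_space M0 M" "t \<in> state_space M0 M" "s \<in> {s. fst s = 0 \<or> s \<in> Z}"
        "0 < mg1_T B0 Bk C0 A s t"
      obtain l i k' j' where [simp]: "s = (l, i)" "t = (k', j')" by (cases s, cases t)
      show "t \<in> {s. fst s = 0 \<or> s \<in> Z}"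
      proof (cases "k' = 0")
        case False
        then have j': "j' < M" using st by (simp add: state_space_iff)
        show ?thesis
        proof (cases "l = 0")
          case True
          then have i: "i < M0" and Bpos: "0 < Bz k' i j'" using st False by (auto simp: state_space_iff mg1_T_def Bz_def)
          have "0 < b k' j'" unfolding b_def
            by (rule sum_pos2[of _ i]) (use i Bpos x0 Bz_nonneg j' in \<open>auto simp: less_imp_le\<close>)
          then show ?thesis using Zb[of k' j'] False j' by simp
        next
          case l: False
          then have i: "i < M" using st by (simp add: state_space_iff)
          have "l \<le> k' + 1 \<and> 0 < A (k' + 1 - l) i j'" using st(4) l False by (simp add: mg1_T_def split: if_splits)
          then show ?thesis using ZA[of l k' i j'] l False i j' st(3) by simp
        qed
      qed simp
    qed (use M0_pos in \<open>auto simp: state_space_iff\<close>)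
    moreover have "(k, j) \<in> state_space M0 M" using kj by (simp add: state_space_iff)
    ultimately show ?thesis using kj by auto
  qed
  have xbar_eq: "xbar x k j = Pr.tail k j" for k j by (simp add: xbar_def Pr.tail_def y_def)
  have dd_eq: "deriv (\<lambda>y. Re (delta M (Astar A (complex_of_real y)))) \<theta> = Pr.dd"
    using DERIV_imp_deriv[OF Pr.Perron_deriv_theta] by (simp add: G.Perron_def[abs_def])
  have bgf_eq: "Pr.bgf z j = (\<Sum>i<M0. complex_of_real (x (0, i)) * Bstar Bk z i j)" if z: "norm z \<le> R" and j: "j < M" for z j
  proof -
    have "(\<lambda>k. if k = 0 then 0 else z ^ k * complex_of_real (Bk k i j)) sums Bstar Bk z i j" if i: "i < M0" for i
      unfolding Bstar_def
    proof (rule summable_sums[OF summable_norm_cancel[OF summable_comparison_test'[OF RB(2)[of R i j]]]])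
      fix k
      have "norm z ^ k * Bz k i j \<le> R ^ k * Bz k i j" using z Bz_nonneg[OF i j] by (intro mult_right_mono power_mono) auto
      then show "norm (norm (if k = 0 then 0 else z ^ k * complex_of_real (Bk k i j))) \<le> R ^ k * Bz k i j"
        using Bk_nonneg[OF _ i j, of k] by (cases "k = 0") (auto simp: Bz_def norm_mult norm_power)
    qed (use R theta_gt1 i j in auto)
    then have "(\<lambda>k. \<Sum>i<M0. complex_of_real (x (0, i)) * (if k = 0 then 0 else z ^ k * complex_of_real (Bk k i j))) sums
      (\<Sum>i<M0. complex_of_real (x (0, i)) * Bstar Bk z i j)" by (intro sums_sum sums_mult) auto
    moreover have "(\<Sum>i<M0. complex_of_real (x (0, i)) * (if k = 0 then 0 else z ^ k * complex_of_real (Bk k i j))) =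
      complex_of_real (b k j) * z ^ k" for k
      by (cases "k = 0") (simp_all add: b_def Bz_def sum_distrib_left sum_distrib_right mult_ac)
    ultimately show ?thesis unfolding Pr.bgf_def by (simp add: sums_iff)
  qed
  have coef_eq: "coef_c M0 M (mad_period A M) A Bk x \<theta> Pr.dd \<mu> v p l j = Pr.cc l j" for l j
    unfolding coef_c_def Pr.cc_def Let_def
  proof (intro sum.cong refl, goal_cases)
    case (1 \<nu>)
    define w where "w = omega (mad_period A M) ^ \<nu>"
    have "norm (complex_of_real \<theta> * w) \<le> R"
      using R theta_gt1 norm_omega_power[of "mad_period A M" \<nu>] by (simp add: norm_mult w_def del: norm_power)
    then have "(\<Sum>j'<M. ((\<Sum>i<M0. complex_of_real (x (0, i)) * Bstar Bk (complex_of_real \<theta> * w) i j')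
                    - (\<Sum>i<M. complex_of_real (x (1, i) * A 0 i j'))) * inverse (w ^ p j') * complex_of_real (v j'))
      = (\<Sum>j'<M. (Pr.bgf (complex_of_real \<theta> * w) j' - complex_of_real (\<Sum>i<M. y 1 i * A 0 i j'))
         * inverse (w ^ p j') * complex_of_real (v j'))"
      by (intro sum.cong refl) (simp add: bgf_eq y_def)
    then show ?case
      unfolding w_def[symmetric] Pr.amp_def by (simp only: divide_divide_eq_left mult.commute[of "complex_of_real (Pr.dd - 1)"])
  qed
  obtain r C where r: "\<theta> < r" "0 \<le> C" and bd:
    "\<And>k j. j < M \<Longrightarrow> norm (complex_of_real (Pr.tail k j) - Pr.cc k j / complex_of_real (\<theta> ^ k)) \<le> C / r ^ k"
    by (rule Pr.tail_asymptotics) blast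
  show ?thesis
    unfolding dd_eq coef_eq xbar_eq
  proof (intro exI[of _ "r - \<theta>"] conjI allI impI)
    show "0 < r - \<theta>" using r by simp
    fix l j assume j: "j < M"
    show "Im (Pr.cc l j) = 0" by (rule Pr.cc_real(1)[OF j])
    show "Re (Pr.cc l j) > 0" by (rule Pr.cc_pos[OF y_pos reach j])
    show "(\<lambda>n. complex_of_real (Pr.tail (n * mad_period A M + l) j)
          - complex_of_real (\<theta> powi (- int (n * mad_period A M + l))) * Pr.cc l j)
     \<in> O(\<lambda>n. complex_of_real ((\<theta> + (r - \<theta>)) powi (- int (n * mad_period A M + l))))"
    proof (intro bigoI[of _ C] always_eventually allI)
      fix n
      define k where "k = n * mad_period A M + l"
      have "Pr.cc k j = Pr.cc l j" unfolding k_def by (rule Pr.cc_periodic)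
      then have e1: "complex_of_real (\<theta> powi (- int k)) * Pr.cc l j = Pr.cc k j / complex_of_real (\<theta> ^ k)"
        by (simp add: power_int_minus divide_inverse mult.commute)
      have e2: "C * norm (complex_of_real ((\<theta> + (r - \<theta>)) powi (- int k))) = C / r ^ k"
        using r theta_gt1 by (simp add: power_int_minus norm_power divide_inverse norm_inverse)
      show "norm (complex_of_real (Pr.tail (n * mad_period A M + l) j)
          - complex_of_real (\<theta> powi (- int (n * mad_period A M + l))) * Pr.cc l j)
        \<le> C * norm (complex_of_real ((\<theta> + (r - \<theta>)) powi (- int (n * mad_period A M + l))))"
        unfolding k_def[symmetric] e1 e2 by (rule bd[OF j])
    qed
  qed
qed

end
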